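(* Let $p\geq 1$, let $\Gamma$ be a finite simplicial graph with vertex set $V\Gamma$, let $\mathfrak{G}=\{G_v\mid v\in V\Gamma\}$ be a family of groups, each $G_v$ generated by a finite set $X_v$, and let $G=\Gamma\mathfrak{G}$ be the corresponding graph product. Suppose that each group $G_v$ admits a coarse embedding $f_v$ into an $L_p$-space and that there is a concave map $\rho'\colon\mathbb{N}\to\mathbb{R}_{\geq 0}$ with $\lim_{t\to\infty}\rho'(t)=+\infty$ such that $$\forall v\in V\Gamma,\ \forall x,y\in G_v:\quad d_v(x,y)\geq\|f_v(x)-f_v(y)\|\geq\rho'(d_v(x,y)),$$ where $d_v$ is the word length distance on $G_v$ associated to $X_v$. Let $d$ be the word length distance on $G$ associated to $X=\bigcup_{v\in V\Gamma}X_v$. If $p=1$, then there is a coarse embedding $\phi$ of $G$ into an $L_p$-space such that $$\forall x,y\in G:\quad \|\phi(x)-\phi(y)\|\geq\rho'(d(x,y)).$$ If $p>1$, then for any function $f\colon\mathbb{N}\to\mathbb{R}_{\geq0}$ satisfying $(C_p^c)$, there is a coarse embedding $\phi$ of $G$ into an $L_p$-space such that $$\forall x,y\in G:\quad \|\phi(x)-\phi(y)\|\geq\rho(d(x,y)),$$ where $\rho(n)=\min(\rho'(n),f(n))$.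
   Context: A simplicial graph is a graph without loops or multiple edges; an edge is a 2-element subset of the vertex set. The graph product $\Gamma\mathfrak{G}$ of a collection of groups $\mathfrak{G}=\{G_v\mid v\in V\Gamma\}$ with respect to $\Gamma$ is the group obtained from the free product of the $G_v$ by adding the relations $[g_v,g_u]=1$ for all $g_v\in G_v$, $g_u\in G_u$ such that $\{v,u\}$ is an edge of $\Gamma$. An $L_p$-space is a space $L_p(\Omega,\mu)$ for a measure space $(\Omega,\mu)$. A coarse embedding of a finitely generated group $H$, with word metric $d_H$ for a finite generating set, into $L_p(\Omega,\mu)$ is a map $f\colon H\to L_p(\Omega,\mu)$ for which there are a non-decreasing $\rho_-\colon\mathbb{R}^+\to\mathbb{R}^+$ with $\lim_{t\to\infty}\rho_-(t)=+\infty$ and a constant $C>0$ such that $\rho_-(d_H(g,h))\leq\|f(g)-f(h)\|_p\leq C\,d_H(g,h)$ for all $g,h\in H$. A function $f\colon\mathbb{N}\to\mathbb{R}_{\geq0}$ (with $0\in\mathbb{N}$) is called concave if $f(0)=0$, $f$ is non-decreasing, and $f(n+m)-f(n)\leq f(n)-f(n-m)$ for all $n\geq m$ in $\mathbb{N}$. A function $f\colon\mathbb{N}\to\mathbb{R}_{\geq0}$ satisfies $(C_p^c)$ if it is concave, it satisfies Tessera's property $(C_p)$, namely $\sum_{n=1}^\infty\frac1n\left(\frac{f(n)}{n}\right)^p<\infty$, and $\frac{f(n)^p}{n}$ is non-decreasing for all $n$ sufficiently large. *)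

theory Defs
  imports "HOL-Analysis.Analysis" "HOL-Algebra.Generated_Groups"
begin

section \<open>Graph products of groups\<close>

definition simplicial_graph :: "'v set \<Rightarrow> 'v set set \<Rightarrow> bool" where
  "simplicial_graph V E \<longleftrightarrow> (\<forall>e\<in>E. e \<subseteq> V \<and> card e = 2)"

definition gp_words :: "'v set \<Rightarrow> ('v \<Rightarrow> ('a, 'b) monoid_scheme) \<Rightarrow> ('v \<times> 'a) list set" where
  "gp_words V G = lists (SIGMA v:V. carrier (G v))"

text \<open>The congruence on words over the disjoint union of the vertex groups. The rules
  \<open>unit\<close> and \<open>mult\<close> alone present the free product of the vertex groups; \<open>comm\<close> adds the
  relations of the graph product. No rule for formal inverses is needed, because the inverse of
  the letter \<open>(v, g)\<close> is the letter \<open>(v, inv g)\<close>.\<close>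

inductive gp_cong ::
    "'v set \<Rightarrow> 'v set set \<Rightarrow> ('v \<Rightarrow> ('a, 'b) monoid_scheme) \<Rightarrow>
     ('v \<times> 'a) list \<Rightarrow> ('v \<times> 'a) list \<Rightarrow> bool"
  for V E G where
  refl: "w \<in> gp_words V G \<Longrightarrow> gp_cong V E G w w"
| sym: "gp_cong V E G w w' \<Longrightarrow> gp_cong V E G w' w"
| trans: "gp_cong V E G w w' \<Longrightarrow> gp_cong V E G w' w'' \<Longrightarrow> gp_cong V E G w w''"
| in_context: "gp_cong V E G w w' \<Longrightarrow> a \<in> gp_words V G \<Longrightarrow> b \<in> gp_words V G \<Longrightarrow>
    gp_cong V E G (a @ w @ b) (a @ w' @ b)"
| unit: "v \<in> V \<Longrightarrow> gp_cong V E G [(v, \<one>\<^bsub>G v\<^esub>)] []"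
| mult: "v \<in> V \<Longrightarrow> g \<in> carrier (G v) \<Longrightarrow> h \<in> carrier (G v) \<Longrightarrow>
    gp_cong V E G [(v, g), (v, h)] [(v, g \<otimes>\<^bsub>G v\<^esub> h)]"
| comm: "{u, v} \<in> E \<Longrightarrow> u \<in> V \<Longrightarrow> v \<in> V \<Longrightarrow> g \<in> carrier (G u) \<Longrightarrow> h \<in> carrier (G v) \<Longrightarrow>
    gp_cong V E G [(u, g), (v, h)] [(v, h), (u, g)]"

definition gp_class ::
    "'v set \<Rightarrow> 'v set set \<Rightarrow> ('v \<Rightarrow> ('a, 'b) monoid_scheme) \<Rightarrow>
     ('v \<times> 'a) list \<Rightarrow> ('v \<times> 'a) list set" where
  "gp_class V E G w = {w'. gp_cong V E G w w'}"

definition graph_product ::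
    "'v set \<Rightarrow> 'v set set \<Rightarrow> ('v \<Rightarrow> ('a, 'b) monoid_scheme) \<Rightarrow> ('v \<times> 'a) list set monoid" where
  "graph_product V E G =
     \<lparr>carrier = gp_class V E G ` gp_words V G,
      mult = (\<lambda>A B. \<Union>a\<in>A. \<Union>b\<in>B. gp_class V E G (a @ b)),
      one = gp_class V E G []\<rparr>"

definition gp_incl ::
    "'v set \<Rightarrow> 'v set set \<Rightarrow> ('v \<Rightarrow> ('a, 'b) monoid_scheme) \<Rightarrow> 'v \<Rightarrow> 'a \<Rightarrow> ('v \<times> 'a) list set" where
  "gp_incl V E G v g = gp_class V E G [(v, g)]"

lemma gp_cong_words:
  assumes "gp_cong V E G w w'" and "\<And>v. v \<in> V \<Longrightarrow> group (G v)"
  shows "w \<in> gp_words V G \<and> w' \<in> gp_words V G"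
  using assms(1)
proof induction
  case (unit v)
  then interpret group "G v" by (rule assms(2))
  show ?case using unit by (auto simp: gp_words_def)
next
  case (mult v g h)
  then interpret group "G v" by (intro assms(2))
  show ?case using mult by (auto simp: gp_words_def)
qed (auto simp: gp_words_def)

lemma gp_class_eq_iff:
  assumes "\<And>v. v \<in> V \<Longrightarrow> group (G v)" "w \<in> gp_words V G"
  shows "gp_class V E G w = gp_class V E G w' \<longleftrightarrow> gp_cong V E G w w'"
proof
  assume eq: "gp_class V E G w = gp_class V E G w'"
  have "w \<in> gp_class V E G w'"
    unfolding eq[symmetric] using gp_cong.refl[OF assms(2), of E] by (simp add: gp_class_def)
  then show "gp_cong V E G w w'" by (simp add: gp_class_def gp_cong.sym)
next
  assume "gp_cong V E G w w'"
  then show "gp_class V E G w = gp_class V E G w'"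
    unfolding gp_class_def by (intro Collect_cong) (meson gp_cong.sym gp_cong.trans)
qed

lemma gp_words_append:
  "a \<in> gp_words V G \<Longrightarrow> b \<in> gp_words V G \<Longrightarrow> a @ b \<in> gp_words V G"
  by (simp add: gp_words_def)

lemma gp_cong_append:
  assumes G: "\<And>v. v \<in> V \<Longrightarrow> group (G v)"
    and "gp_cong V E G a a'" "gp_cong V E G b b'"
  shows "gp_cong V E G (a @ b) (a' @ b')"
proof -
  have w: "a' \<in> gp_words V G" "b \<in> gp_words V G" "[] \<in> gp_words V G"
    using gp_cong_words[OF assms(2) G] gp_cong_words[OF assms(3) G] by (auto simp: gp_words_def)
  have "gp_cong V E G (a @ b) (a' @ b)"
    using gp_cong.in_context[OF assms(2) w(3,2)] by simp
  moreover have "gp_cong V E G (a' @ b) (a' @ b')"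
    using gp_cong.in_context[OF assms(3) w(1,3)] by simp
  ultimately show ?thesis by (rule gp_cong.trans)
qed

lemma gp_mult_class:
  assumes G: "\<And>v. v \<in> V \<Longrightarrow> group (G v)"
    and a: "a \<in> gp_words V G" and b: "b \<in> gp_words V G"
  shows "gp_class V E G a \<otimes>\<^bsub>graph_product V E G\<^esub> gp_class V E G b = gp_class V E G (a @ b)"
proof -
  have "gp_class V E G (a' @ b') = gp_class V E G (a @ b)"
    if "gp_cong V E G a a'" "gp_cong V E G b b'" for a' b'
    using gp_cong_append[OF G that] gp_class_eq_iff[OF G gp_words_append[OF a b], of E "a' @ b'"]
    by simp
  then have *: "gp_class V E G (a' @ b') = gp_class V E G (a @ b)"
    if "a' \<in> gp_class V E G a" "b' \<in> gp_class V E G b" for a' b'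
    using that by (simp add: gp_class_def)
  have "a \<in> gp_class V E G a" "b \<in> gp_class V E G b"
    using gp_cong.refl[OF a, of E] gp_cong.refl[OF b, of E] by (simp_all add: gp_class_def)
  then show ?thesis
    unfolding graph_product_def monoid.simps using * by blast
qed

lemma gp_cong_left_inverse:
  assumes G: "\<And>v. v \<in> V \<Longrightarrow> group (G v)" and "w \<in> gp_words V G"
  shows "\<exists>w'\<in>gp_words V G. gp_cong V E G (w' @ w) []"
  using assms(2)
proof (induction w)
  case Nil
  then show ?case using gp_cong.refl[of "[]" V G E] by (intro bexI[of _ "[]"]) (simp_all add: gp_words_def)
next
  case (Cons x w)
  obtain v g where x: "x = (v, g)" by (cases x)
  from Cons.prems x have v: "v \<in> V" "g \<in> carrier (G v)" and w: "w \<in> gp_words V G"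
    by (auto simp: gp_words_def)
  interpret group "G v" by (rule G[OF v(1)])
  obtain w' where w': "w' \<in> gp_words V G" "gp_cong V E G (w' @ w) []"
    using Cons.IH w by blast
  have "gp_cong V E G [(v, inv\<^bsub>G v\<^esub> g), (v, g)] []"
    using gp_cong.trans[OF gp_cong.mult[where G = G and v = v, OF v(1) inv_closed[OF v(2)] v(2)]]
      gp_cong.unit[OF v(1), of E G] v(2)
    by simp
  from gp_cong.in_context[OF this w'(1) w]
  have "gp_cong V E G (w' @ [(v, inv\<^bsub>G v\<^esub> g), (v, g)] @ w) (w' @ w)" by simp
  then have "gp_cong V E G ((w' @ [(v, inv\<^bsub>G v\<^esub> g)]) @ x # w) []"
    using gp_cong.trans[OF _ w'(2)] x by simp
  moreover have "w' @ [(v, inv\<^bsub>G v\<^esub> g)] \<in> gp_words V G"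
    using w'(1) v by (auto simp: gp_words_def)
  ultimately show ?case by blast
qed

lemma group_graph_product:
  assumes G: "\<And>v. v \<in> V \<Longrightarrow> group (G v)"
  shows "group (graph_product V E G)"
proof -
  let ?P = "graph_product V E G"
  have car: "carrier ?P = gp_class V E G ` gp_words V G"
    and one: "\<one>\<^bsub>?P\<^esub> = gp_class V E G []" by (simp_all add: graph_product_def)
  have nil: "[] \<in> gp_words V G" by (simp add: gp_words_def)
  note mul = gp_mult_class[OF G] and app = gp_words_append
  show ?thesis
  proof (rule groupI)
    fix x assume "x \<in> carrier ?P"
    then obtain w where w: "x = gp_class V E G w" "w \<in> gp_words V G" unfolding car by blast
    obtain w' where w': "w' \<in> gp_words V G" "gp_cong V E G (w' @ w) []"
      using gp_cong_left_inverse[OF G w(2)] by blast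
    have "gp_class V E G w' \<otimes>\<^bsub>?P\<^esub> x = \<one>\<^bsub>?P\<^esub>"
      using w w' by (simp add: mul one gp_class_eq_iff[OF G] app)
    then show "\<exists>y\<in>carrier ?P. y \<otimes>\<^bsub>?P\<^esub> x = \<one>\<^bsub>?P\<^esub>" using w' car by blast
  qed (auto simp: car one nil mul app)
qed

lemma gp_incl_hom:
  assumes G: "\<And>v. v \<in> V \<Longrightarrow> group (G v)" and v: "v \<in> V"
  shows "gp_incl V E G v \<in> hom (G v) (graph_product V E G)"
proof (rule homI)
  fix g h assume gh: "g \<in> carrier (G v)" "h \<in> carrier (G v)"
  then have w: "[(v, g)] \<in> gp_words V G" "[(v, h)] \<in> gp_words V G"
    "[(v, g), (v, h)] \<in> gp_words V G"
    using v by (auto simp: gp_words_def)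
  show "gp_incl V E G v g \<in> carrier (graph_product V E G)"
    using w by (simp add: gp_incl_def graph_product_def)
  have "gp_cong V E G [(v, g), (v, h)] [(v, g \<otimes>\<^bsub>G v\<^esub> h)]"
    using v gh by (rule gp_cong.mult)
  then have "gp_class V E G [(v, g), (v, h)] = gp_class V E G [(v, g \<otimes>\<^bsub>G v\<^esub> h)]"
    using gp_class_eq_iff[OF G w(3), of E] by simp
  then show "gp_incl V E G v (g \<otimes>\<^bsub>G v\<^esub> h) =
      gp_incl V E G v g \<otimes>\<^bsub>graph_product V E G\<^esub> gp_incl V E G v h"
    unfolding gp_incl_def using gp_mult_class[where V = V and G = G, OF G w(1,2), of E] by simp
qed

section \<open>Word metrics\<close>

definition generates :: "('a, 'b) monoid_scheme \<Rightarrow> 'a set \<Rightarrow> bool" where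
  "generates H X \<longleftrightarrow> X \<subseteq> carrier H \<and> generate H X = carrier H"

definition word_length :: "('a, 'b) monoid_scheme \<Rightarrow> 'a set \<Rightarrow> 'a \<Rightarrow> nat" where
  "word_length H X g =
     (LEAST n. \<exists>xs. length xs = n \<and> set xs \<subseteq> X \<union> m_inv H ` X \<and>
        foldr (\<lambda>x y. x \<otimes>\<^bsub>H\<^esub> y) xs \<one>\<^bsub>H\<^esub> = g)"

definition word_dist :: "('a, 'b) monoid_scheme \<Rightarrow> 'a set \<Rightarrow> 'a \<Rightarrow> 'a \<Rightarrow> nat" where
  "word_dist H X x y = word_length H X (inv\<^bsub>H\<^esub> x \<otimes>\<^bsub>H\<^esub> y)"

section \<open>Coarse embeddings into $L_p$-spaces\<close>

text \<open>Elements of $L_p(\Omega,\mu)$ are given by representatives: \<open>Lp_norm\<close> is a seminorm on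
  these functions, and depends only on the class modulo equality almost everywhere.\<close>

definition Lp_space :: "real \<Rightarrow> 'w measure \<Rightarrow> ('w \<Rightarrow> real) set" where
  "Lp_space p M = {u \<in> borel_measurable M. integrable M (\<lambda>x. \<bar>u x\<bar> powr p)}"

definition Lp_norm :: "real \<Rightarrow> 'w measure \<Rightarrow> ('w \<Rightarrow> real) \<Rightarrow> real" where
  "Lp_norm p M u = (integral\<^sup>L M (\<lambda>x. \<bar>u x\<bar> powr p)) powr (1 / p)"

definition Lp_dist :: "real \<Rightarrow> 'w measure \<Rightarrow> ('w \<Rightarrow> real) \<Rightarrow> ('w \<Rightarrow> real) \<Rightarrow> real" where
  "Lp_dist p M u u' = Lp_norm p M (\<lambda>x. u x - u' x)"

definition coarse_embedding_Lp ::
    "real \<Rightarrow> 'w measure \<Rightarrow> ('a, 'b) monoid_scheme \<Rightarrow> 'a set \<Rightarrow> ('a \<Rightarrow> 'w \<Rightarrow> real) \<Rightarrow> bool" where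
  "coarse_embedding_Lp p M H X f \<longleftrightarrow>
     f \<in> carrier H \<rightarrow> Lp_space p M \<and>
     (\<exists>\<rho> C. mono_on {0..} \<rho> \<and> (\<forall>t\<ge>0. 0 \<le> \<rho> t) \<and> filterlim \<rho> at_top at_top \<and> 0 < C \<and>
        (\<forall>g\<in>carrier H. \<forall>h\<in>carrier H.
           \<rho> (real (word_dist H X g h)) \<le> Lp_dist p M (f g) (f h) \<and>
           Lp_dist p M (f g) (f h) \<le> C * real (word_dist H X g h)))"

section \<open>Control functions\<close>

definition concave_map :: "(nat \<Rightarrow> real) \<Rightarrow> bool" where
  "concave_map f \<longleftrightarrow> (\<forall>n. 0 \<le> f n) \<and> f 0 = 0 \<and> mono f \<and>
     (\<forall>n m. m \<le> n \<longrightarrow> f (n + m) - f n \<le> f n - f (n - m))"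

definition tessera_C :: "real \<Rightarrow> (nat \<Rightarrow> real) \<Rightarrow> bool" where
  "tessera_C p f \<longleftrightarrow>
     summable (\<lambda>k. 1 / real (Suc k) * (f (Suc k) / real (Suc k)) powr p)"

definition concave_tessera_C :: "real \<Rightarrow> (nat \<Rightarrow> real) \<Rightarrow> bool" where
  "concave_tessera_C p f \<longleftrightarrow> concave_map f \<and> tessera_C p f \<and>
     (\<exists>N. mono_on {N..} (\<lambda>n. f n powr p / real n))"

end

theory Submission
  imports Defs
begin

text \<open>
  Call a coset \<open>p\<langle>star v\<rangle>\<close> of the subgroup generated by \<open>G\<^sub>v\<close> and the \<open>G\<^sub>u\<close> with \<open>u\<close> adjacent
  to \<open>v\<close> a hyperplane of type \<open>v\<close>. Read a word as a path in the graph product; a letter of \<open>G\<^sub>v\<close>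
  crosses the hyperplane of type \<open>v\<close> in which it starts. The product of the letters that cross a
  given hyperplane is invariant under the defining relations (\<open>coord_cong\<close>), so every element of the
  graph product has a coordinate in \<open>G\<^sub>v\<close> at every hyperplane of type \<open>v\<close>, and almost all of its
  coordinates are trivial. If a word has as few letters as possible, its letters cross pairwise
  distinct hyperplanes, since two letters at one hyperplane could be moved together and merged
  (\<open>reduced_distinct_crossed\<close>). Hence the distance of two elements is at most the sum of the
  distances of their coordinates (\<open>dist_le_sum_coord_dist\<close>).

  Applying \<open>f\<^sub>v\<close> to every coordinate and taking the direct sum gives a Lipschitz map, because a
  generator changes a single coordinate. For \<open>p = 1\<close> norms add up in the direct sum, and the bound
  \<open>\<rho>'\<close> survives because a concave function is subadditive (\<open>graph_product_embedding_L1\<close>).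

  For \<open>p > 1\<close> this map loses too much on elements with many short coordinates, and a second map is
  added. The hyperplanes of one type at which \<open>x\<close> has a nontrivial coordinate are linearly ordered
  along every reduced path from \<open>1\<close> to \<open>x\<close>: with the length of the coordinate as the length of an
  interval, they tile \<open>[0, N)\<close>, and the left end of the interval of a hyperplane is the same for all \<open>x\<close>. The second
  map puts the value \<open>W d\<close> on the point at distance \<open>d\<close> from the right end of this tiling
  (\<open>profile\<close>). A generator moves only the right end, so it shifts all distances by at most one and
  costs \<open>\<Sum>d. \<bar>W (d + 1) - W d\<bar> powr p\<close>, which Tessera's condition makes finite for weights
  built from \<open>h\<close> (\<open>weight_steps_bounded\<close>). Conversely, if \<open>x\<close> has coordinates of total length \<open>a\<close> at
  hyperplanes where \<open>y\<close> has trivial ones, the \<open>p\<close>-th power of the distance of the images is at least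
  \<open>\<Sum>d=1..a. W d powr p\<close>, which dominates a multiple of \<open>h a powr p\<close> (\<open>weight_sum_ge\<close>).

  The two maps complement each other because at most one hyperplane of each type carries different
  nontrivial coordinates of both \<open>x\<close> and \<open>y\<close> (\<open>branching_unique\<close>). So a fixed proportion of the distance of
  \<open>x\<close> and \<open>y\<close> lies either at one hyperplane, where \<open>f\<^sub>v\<close> provides \<open>\<rho>'\<close>, or at hyperplanes crossed
  on the way to only one of them, where the profile provides \<open>h\<close> (\<open>energy_dichotomy\<close>). Concave
  functions lose only a constant factor in passing to this proportion, and a factor is absorbed by
  scaling the map, because the Lipschitz constant of a coarse embedding is arbitrary.
\<close>

section \<open>Word length\<close>

lemma word_length_one [simp]: "word_length H X \<one>\<^bsub>H\<^esub> = 0"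
  unfolding word_length_def by (rule Least_eq_0) simp

text \<open>The length of an element is defined as a least number, so it is realised as soon as some word in
  the generators represents the element. Stated without generation of the whole group, this also
  yields geodesics in the graph product.\<close>

lemma word_length_attained:
  assumes "set xs \<subseteq> X \<union> m_inv H ` X" "foldr (\<lambda>x y. x \<otimes>\<^bsub>H\<^esub> y) xs \<one>\<^bsub>H\<^esub> = g"
  obtains ys where "length ys = word_length H X g" "set ys \<subseteq> X \<union> m_inv H ` X"
    "foldr (\<lambda>x y. x \<otimes>\<^bsub>H\<^esub> y) ys \<one>\<^bsub>H\<^esub> = g"
proof -
  have "\<exists>n. \<exists>xs. length xs = n \<and> set xs \<subseteq> X \<union> m_inv H ` X \<and>
      foldr (\<lambda>x y. x \<otimes>\<^bsub>H\<^esub> y) xs \<one>\<^bsub>H\<^esub> = g"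
    using assms by blast
  from LeastI_ex[OF this] show ?thesis using that unfolding word_length_def by blast
qed

context group begin

lemma foldr_mult_closed:
  "set xs \<subseteq> carrier G \<Longrightarrow> foldr (\<otimes>) xs \<one> \<in> carrier G"
  by (induction xs) auto

lemma foldr_mult_append:
  "set xs \<subseteq> carrier G \<Longrightarrow> set ys \<subseteq> carrier G \<Longrightarrow>
     foldr (\<otimes>) (xs @ ys) \<one> = foldr (\<otimes>) xs \<one> \<otimes> foldr (\<otimes>) ys \<one>"
  by (induction xs) (auto simp: m_assoc foldr_mult_closed simp del: foldr_append)

lemma word_length_le:
  "set xs \<subseteq> X \<union> m_inv G ` X \<Longrightarrow> foldr (\<otimes>) xs \<one> = g \<Longrightarrow> word_length G X g \<le> length xs"
  unfolding word_length_def by (rule Least_le) blast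

lemma symmetric_generators_closed:
  "generates G X \<Longrightarrow> X \<union> m_inv G ` X \<subseteq> carrier G"
  by (auto simp: generates_def)

lemma generator_word_exists:
  assumes "generates G X" "g \<in> carrier G"
  shows "\<exists>xs. set xs \<subseteq> X \<union> m_inv G ` X \<and> foldr (\<otimes>) xs \<one> = g"
proof -
  have X: "X \<subseteq> carrier G" using assms(1) by (simp add: generates_def)
  have "g \<in> generate G X" using assms by (simp add: generates_def)
  then show ?thesis
  proof induction
    case one
    show ?case by (rule exI[of _ "[]"]) simp
  next
    case (incl h)
    then show ?case using X by (intro exI[of _ "[h]"]) auto
  next
    case (inv h)
    then show ?case using X by (intro exI[of _ "[inv h]"]) auto
  next
    case (eng h1 h2)
    then obtain xs ys where "set xs \<subseteq> X \<union> m_inv G ` X" "foldr (\<otimes>) xs \<one> = h1"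
      "set ys \<subseteq> X \<union> m_inv G ` X" "foldr (\<otimes>) ys \<one> = h2" by auto
    then show ?case
      using symmetric_generators_closed[OF assms(1)]
      by (intro exI[of _ "xs @ ys"]) (simp add: foldr_mult_append subset_trans del: foldr_append)
  qed
qed

lemma geodesic_word_exists:
  assumes "generates G X" "g \<in> carrier G"
  shows "\<exists>xs. length xs = word_length G X g \<and> set xs \<subseteq> X \<union> m_inv G ` X \<and> foldr (\<otimes>) xs \<one> = g"
  using generator_word_exists[OF assms] word_length_attained[of _ X G g] by metis

lemma word_length_eq_0D:
  "generates G X \<Longrightarrow> g \<in> carrier G \<Longrightarrow> word_length G X g = 0 \<Longrightarrow> g = \<one>"
  using geodesic_word_exists[of X g] by auto

lemma word_length_mult_le:
  assumes X: "generates G X" and gh: "g \<in> carrier G" "h \<in> carrier G"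
  shows "word_length G X (g \<otimes> h) \<le> word_length G X g + word_length G X h"
proof -
  obtain xs ys where xs: "length xs = word_length G X g" "set xs \<subseteq> X \<union> m_inv G ` X"
      "foldr (\<otimes>) xs \<one> = g"
    and ys: "length ys = word_length G X h" "set ys \<subseteq> X \<union> m_inv G ` X" "foldr (\<otimes>) ys \<one> = h"
    using geodesic_word_exists[OF X] gh by metis
  have "word_length G X (g \<otimes> h) \<le> length (xs @ ys)"
    using xs ys symmetric_generators_closed[OF X]
    by (intro word_length_le) (simp_all add: foldr_mult_append subset_trans del: foldr_append)
  then show ?thesis by (simp add: xs ys)
qed

lemma word_length_generator:
  "generates G X \<Longrightarrow> a \<in> X \<union> m_inv G ` X \<Longrightarrow> word_length G X a \<le> 1"
  using word_length_le[of "[a]" X a] symmetric_generators_closed[of X] by auto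

lemma symmetric_generators_inv:
  "generates G X \<Longrightarrow> a \<in> X \<union> m_inv G ` X \<Longrightarrow> inv a \<in> X \<union> m_inv G ` X"
  by (auto simp: generates_def subset_iff)

lemma inv_foldr_mult:
  "set xs \<subseteq> carrier G \<Longrightarrow> inv (foldr (\<otimes>) xs \<one>) = foldr (\<otimes>) (rev (map (m_inv G) xs)) \<one>"
proof (induction xs)
  case (Cons a xs)
  have "foldr (\<otimes>) (rev (map (m_inv G) xs) @ [inv a]) \<one>
      = foldr (\<otimes>) (rev (map (m_inv G) xs)) \<one> \<otimes> foldr (\<otimes>) [inv a] \<one>"
    using Cons.prems by (intro foldr_mult_append) auto
  then show ?case
    using Cons by (simp add: inv_mult_group foldr_mult_closed del: foldr_append)
qed simp

lemma word_length_inv: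
  assumes X: "generates G X" and g: "g \<in> carrier G"
  shows "word_length G X (inv g) = word_length G X g"
proof -
  have *: "word_length G X (inv g) \<le> word_length G X g" if g: "g \<in> carrier G" for g
  proof -
    obtain xs where xs: "length xs = word_length G X g" "set xs \<subseteq> X \<union> m_inv G ` X"
        "foldr (\<otimes>) xs \<one> = g"
      using geodesic_word_exists[OF X g] by blast
    have "word_length G X (inv g) \<le> length (rev (map (m_inv G) xs))"
    proof (rule word_length_le)
      show "set (rev (map (m_inv G) xs)) \<subseteq> X \<union> m_inv G ` X"
        using xs(2) symmetric_generators_inv[OF X] by auto
      show "foldr (\<otimes>) (rev (map (m_inv G) xs)) \<one> = inv g"
        using inv_foldr_mult[OF subset_trans[OF xs(2) symmetric_generators_closed[OF X]]] xs(3) by simp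
    qed
    then show ?thesis using xs(1) by simp
  qed
  show ?thesis using *[OF g] *[of "inv g"] g by simp
qed

lemma countable_carrier_if_generated:
  assumes X: "generates G X" and "countable X"
  shows "countable (carrier G)"
proof -
  have "carrier G \<subseteq> (\<lambda>xs. foldr (\<otimes>) xs \<one>) ` lists (X \<union> m_inv G ` X)"
    using generator_word_exists[OF X] by fastforce
  moreover have "countable (lists (X \<union> m_inv G ` X))"
    using assms(2) by (intro countable_lists countable_Un countable_image)
  ultimately show ?thesis by (meson countable_image countable_subset)
qed

end

section \<open>Disjoint sums of measures\<close>

text \<open>Direct sums of $L_p$-spaces are realised on a disjoint union of measure spaces. The summands differ
  and need not be \<open>\<sigma>\<close>-finite, so a product measure does not serve, and the \<open>\<sigma>\<close>-algebra and the measure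
  are given slice by slice.\<close>

definition sum_measure :: "(nat \<Rightarrow> 'w measure) \<Rightarrow> (nat \<times> 'w) measure" where
  "sum_measure M = measure_of (SIGMA i:UNIV. space (M i))
     {A. A \<subseteq> (SIGMA i:UNIV. space (M i)) \<and> (\<forall>i. Pair i -` A \<in> sets (M i))}
     (\<lambda>A. \<Sum>i. emeasure (M i) (Pair i -` A))"

lemma sigma_algebra_sum_measure:
  "sigma_algebra (SIGMA i:UNIV. space (M i))
     {A. A \<subseteq> (SIGMA i:UNIV. space (M i)) \<and> (\<forall>i. Pair i -` A \<in> sets (M i))}"
proof -
  have diff: "Pair i -` ((SIGMA i:UNIV. space (M i)) - A) = space (M i) - Pair i -` A" for i A
    by auto
  have UN: "Pair i -` (\<Union>n. A n) = (\<Union>n. Pair i -` A n)" for i and A :: "nat \<Rightarrow> _"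
    by auto
  show ?thesis
    unfolding sigma_algebra_iff2 by (auto simp: diff UN intro!: sets.countable_UN)
qed

lemma space_sum_measure: "space (sum_measure M) = (SIGMA i:UNIV. space (M i))"
  unfolding sum_measure_def by (rule space_measure_of) blast

lemma sets_sum_measure:
  "A \<in> sets (sum_measure M) \<longleftrightarrow>
     A \<subseteq> (SIGMA i:UNIV. space (M i)) \<and> (\<forall>i. Pair i -` A \<in> sets (M i))"
  unfolding sum_measure_def
  using sigma_algebra.sets_measure_of_eq[OF sigma_algebra_sum_measure[of M]] by simp

lemma suminf_swap_ennreal:
  fixes f :: "nat \<Rightarrow> nat \<Rightarrow> ennreal"
  shows "(\<Sum>n. \<Sum>i. f n i) = (\<Sum>i. \<Sum>n. f n i)"
proof -
  have "(\<Sum>n. \<Sum>i. f n i) = (\<integral>\<^sup>+n. (\<Sum>i. f n i) \<partial>count_space UNIV)"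
    by (simp add: nn_integral_count_space_nat)
  also have "\<dots> = (\<Sum>i. \<integral>\<^sup>+n. f n i \<partial>count_space UNIV)" by (rule nn_integral_suminf) simp
  finally show ?thesis by (simp add: nn_integral_count_space_nat)
qed

lemma emeasure_sum_measure:
  assumes "A \<in> sets (sum_measure M)"
  shows "emeasure (sum_measure M) A = (\<Sum>i. emeasure (M i) (Pair i -` A))"
proof -
  let ?S = "{A. A \<subseteq> (SIGMA i:UNIV. space (M i)) \<and> (\<forall>i. Pair i -` A \<in> sets (M i))}"
  have "countably_additive ?S (\<lambda>A. \<Sum>i. emeasure (M i) (Pair i -` A))"
  proof (rule countably_additiveI)
    fix A :: "nat \<Rightarrow> (nat \<times> 'a) set"
    assume A: "range A \<subseteq> ?S" "disjoint_family A"
    have "(\<Sum>n. emeasure (M i) (Pair i -` A n)) = emeasure (M i) (Pair i -` (\<Union>n. A n))" for i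
    proof -
      have "disjoint_family (\<lambda>n. Pair i -` A n)"
        using A(2) by (auto simp: disjoint_family_on_def)
      then show ?thesis using A(1) by (subst suminf_emeasure) (auto simp: vimage_UN)
    qed
    then show "(\<Sum>n. \<Sum>i. emeasure (M i) (Pair i -` A n)) = (\<Sum>i. emeasure (M i) (Pair i -` (\<Union>n. A n)))"
      by (subst suminf_swap_ennreal) simp
  qed
  moreover have "positive ?S (\<lambda>A. \<Sum>i. emeasure (M i) (Pair i -` A))"
    by (simp add: positive_def)
  moreover have "A \<in> ?S" using assms by (simp add: sets_sum_measure)
  ultimately show ?thesis
    unfolding sum_measure_def
    by (intro emeasure_measure_of_sigma[OF sigma_algebra_sum_measure]) auto
qed

lemma measurable_sum_measure:
  "f \<in> measurable (sum_measure M) N \<longleftrightarrow> (\<forall>i. (\<lambda>w. f (i, w)) \<in> measurable (M i) N)"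
proof -
  have vim: "Pair i -` (f -` A \<inter> (SIGMA i:UNIV. space (M i))) = (\<lambda>w. f (i, w)) -` A \<inter> space (M i)"
    for i A by auto
  have "f -` A \<inter> (SIGMA i:UNIV. space (M i)) \<in> sets (sum_measure M) \<longleftrightarrow>
      (\<forall>i. (\<lambda>w. f (i, w)) -` A \<inter> space (M i) \<in> sets (M i))" for A
    unfolding sets_sum_measure vim by simp
  then show ?thesis
    unfolding measurable_def space_sum_measure by (auto simp: Pi_iff)
qed

lemma nn_integral_sum_measure:
  assumes "f \<in> borel_measurable (sum_measure M)"
  shows "(\<integral>\<^sup>+x. f x \<partial>sum_measure M) = (\<Sum>i. \<integral>\<^sup>+w. f (i, w) \<partial>M i)"
  using assms
proof (induction rule: borel_measurable_induct)
  case (cong f g)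
  have "(\<integral>\<^sup>+x. f x \<partial>sum_measure M) = (\<integral>\<^sup>+x. g x \<partial>sum_measure M)"
    using cong(3) by (intro nn_integral_cong)
  moreover have "(\<integral>\<^sup>+w. f (i, w) \<partial>M i) = (\<integral>\<^sup>+w. g (i, w) \<partial>M i)" for i
    using cong(3) by (intro nn_integral_cong) (auto simp: space_sum_measure)
  ultimately show ?case using cong by simp
next
  case (set A)
  have "(\<integral>\<^sup>+w. indicator A (i, w) \<partial>M i) = emeasure (M i) (Pair i -` A)" for i
  proof -
    have "(\<integral>\<^sup>+w. indicator A (i, w) \<partial>M i) = (\<integral>\<^sup>+w. indicator (Pair i -` A) w \<partial>M i)"
      by (intro nn_integral_cong) (auto simp: indicator_def)
    then show ?thesis using set by (simp add: sets_sum_measure)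
  qed
  then show ?case using set by (simp add: emeasure_sum_measure)
next
  case (mult u c)
  then have "(\<lambda>w. u (i, w)) \<in> borel_measurable (M i)" for i
    by (simp add: measurable_sum_measure)
  then show ?case using mult by (simp add: nn_integral_cmult)
next
  case (add u v)
  then have "(\<lambda>w. u (i, w)) \<in> borel_measurable (M i)" "(\<lambda>w. v (i, w)) \<in> borel_measurable (M i)" for i
    by (simp_all add: measurable_sum_measure)
  then show ?case using add by (simp add: nn_integral_add suminf_add)
next
  case (seq U)
  have U: "(\<lambda>w. U n (i, w)) \<in> borel_measurable (M i)" for n i
    using seq by (simp add: measurable_sum_measure)
  have inc: "incseq (\<lambda>n w. U n (i, w))" for i
    using seq(3) by (auto simp: incseq_def le_fun_def)
  have "(\<integral>\<^sup>+x. (SUP n. U n) x \<partial>sum_measure M) = (\<integral>\<^sup>+x. (SUP n. U n x) \<partial>sum_measure M)"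
    by (simp add: SUP_apply image_comp)
  also have "\<dots> = (SUP n. \<integral>\<^sup>+x. U n x \<partial>sum_measure M)"
    using seq by (intro nn_integral_monotone_convergence_SUP) auto
  also have "\<dots> = (SUP n. \<Sum>i. \<integral>\<^sup>+w. U n (i, w) \<partial>M i)" using seq by simp
  also have "\<dots> = (\<Sum>i. SUP n. \<integral>\<^sup>+w. U n (i, w) \<partial>M i)"
    using inc by (intro ennreal_suminf_SUP_eq[symmetric])
      (auto simp: incseq_def le_fun_def intro!: nn_integral_mono)
  also have "\<dots> = (\<Sum>i. \<integral>\<^sup>+w. (SUP n. U n (i, w)) \<partial>M i)"
    using U inc by (subst nn_integral_monotone_convergence_SUP) auto
  finally show ?case by (simp add: SUP_apply image_comp)
qed

text \<open>Only functions supported on finitely many slices occur below; for these the series over the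
  slices is a finite sum and integrability can be read off slice by slice.\<close>

lemma integral_sum_measure:
  fixes g :: "nat \<times> 'w \<Rightarrow> real"
  assumes nonneg: "\<And>x. 0 \<le> g x"
    and int: "\<And>i. integrable (M i) (\<lambda>w. g (i, w))"
    and F: "finite F" "\<And>i w. i \<notin> F \<Longrightarrow> g (i, w) = 0"
  shows "integrable (sum_measure M) g"
    and "integral\<^sup>L (sum_measure M) g = (\<Sum>i\<in>F. \<integral>w. g (i, w) \<partial>M i)"
proof -
  have meas: "g \<in> borel_measurable (sum_measure M)"
    using int by (simp add: measurable_sum_measure borel_measurable_integrable)
  have "(\<integral>\<^sup>+x. ennreal (g x) \<partial>sum_measure M) = (\<Sum>i. \<integral>\<^sup>+w. ennreal (g (i, w)) \<partial>M i)"
    using meas by (intro nn_integral_sum_measure) simp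
  also have "\<dots> = (\<Sum>i\<in>F. \<integral>\<^sup>+w. ennreal (g (i, w)) \<partial>M i)"
    using F by (intro suminf_finite) auto
  also have "\<dots> = (\<Sum>i\<in>F. ennreal (\<integral>w. g (i, w) \<partial>M i))"
    using int nonneg by (intro sum.cong nn_integral_eq_integral) auto
  also have "\<dots> = ennreal (\<Sum>i\<in>F. \<integral>w. g (i, w) \<partial>M i)"
    using nonneg by (intro sum_ennreal) auto
  finally have *: "(\<integral>\<^sup>+x. ennreal (g x) \<partial>sum_measure M) = ennreal (\<Sum>i\<in>F. \<integral>w. g (i, w) \<partial>M i)" .
  have "has_bochner_integral (sum_measure M) g (\<Sum>i\<in>F. \<integral>w. g (i, w) \<partial>M i)"
    using meas nonneg by (intro has_bochner_integral_nn_integral[OF _ _ _ *]) (auto intro!: sum_nonneg)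
  then show "integrable (sum_measure M) g"
    "integral\<^sup>L (sum_measure M) g = (\<Sum>i\<in>F. \<integral>w. g (i, w) \<partial>M i)"
    by (auto simp: has_bochner_integral_iff)
qed

section \<open>The $L_p$ seminorm\<close>

text \<open>Convexity of \<open>t powr p\<close>. It takes the place of the Minkowski inequality: applied pointwise to
  the increments of a path and then integrated, it bounds the length of the path.\<close>

lemma sum_powr_le:
  fixes a :: "nat \<Rightarrow> real"
  assumes p: "1 \<le> p" and a: "\<And>i. 0 \<le> a i"
  shows "(\<Sum>i<n. a i) powr p \<le> real n powr (p - 1) * (\<Sum>i<n. a i powr p)"
proof -
  let ?S = "{i. i < n \<and> 0 < a i}"
  have eq: "(\<Sum>i<n. a i) = (\<Sum>i\<in>?S. a i)" "(\<Sum>i<n. a i powr p) = (\<Sum>i\<in>?S. a i powr p)"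
    using a by (auto intro!: sum.mono_neutral_right simp: less_le)
  show ?thesis
  proof (cases "?S = {}")
    case True
    then show ?thesis using a by (simp only: eq) (simp add: sum_nonneg)
  next
    case False
    define c where "c = card ?S"
    have c: "real c > 0" "c \<le> n"
      using False card_mono[of "{..<n}" ?S] by (auto simp: c_def card_gt_0_iff)
    \<comment> \<open>vanishing terms are dropped, because the convexity used is that on the open half-line\<close>
    have "(\<Sum>i\<in>?S. (1 / real c) *\<^sub>R a i) powr p \<le> (\<Sum>i\<in>?S. (1 / real c) * (a i powr p))"
      using False c powr_convex[OF p] by (intro convex_on_sum) (auto simp: c_def)
    then have "((\<Sum>i\<in>?S. a i) / real c) powr p \<le> (\<Sum>i\<in>?S. a i powr p) / real c"
      by (simp add: sum_divide_distrib)
    then have "(\<Sum>i\<in>?S. a i) powr p \<le> real c powr p * ((\<Sum>i\<in>?S. a i powr p) / real c)"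
      using c a by (simp add: powr_divide sum_nonneg field_simps)
    also have "\<dots> = real c powr (p - 1) * (\<Sum>i\<in>?S. a i powr p)"
      using c by (simp add: powr_diff)
    also have "\<dots> \<le> real n powr (p - 1) * (\<Sum>i\<in>?S. a i powr p)"
      using c p by (intro mult_right_mono powr_mono2 sum_nonneg) auto
    finally show ?thesis by (simp only: eq)
  qed
qed

lemma abs_diff_powr_le:
  fixes a b :: real
  assumes "1 \<le> p"
  shows "\<bar>a - b\<bar> powr p \<le> 2 powr p * (\<bar>a\<bar> powr p + \<bar>b\<bar> powr p)"
proof -
  have "\<bar>a - b\<bar> powr p \<le> (2 * max \<bar>a\<bar> \<bar>b\<bar>) powr p"
    using assms by (intro powr_mono2) auto
  also have "\<dots> = 2 powr p * max \<bar>a\<bar> \<bar>b\<bar> powr p" by (simp add: powr_mult)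
  also have "\<dots> \<le> 2 powr p * (\<bar>a\<bar> powr p + \<bar>b\<bar> powr p)"
    by (intro mult_left_mono) (auto simp: max_def)
  finally show ?thesis .
qed

lemma Lp_space_diff:
  assumes p: "1 \<le> p" and u: "u \<in> Lp_space p M" "v \<in> Lp_space p M"
  shows "(\<lambda>x. u x - v x) \<in> Lp_space p M"
proof -
  have [measurable]: "u \<in> borel_measurable M" "v \<in> borel_measurable M"
    and int: "integrable M (\<lambda>x. \<bar>u x\<bar> powr p)" "integrable M (\<lambda>x. \<bar>v x\<bar> powr p)"
    using u by (auto simp: Lp_space_def)
  have "integrable M (\<lambda>x. \<bar>u x - v x\<bar> powr p)"
  proof (rule Bochner_Integration.integrable_bound)
    show "integrable M (\<lambda>x. 2 powr p * (\<bar>u x\<bar> powr p + \<bar>v x\<bar> powr p))" using int by simp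
    show "AE x in M. norm (\<bar>u x - v x\<bar> powr p) \<le> norm (2 powr p * (\<bar>u x\<bar> powr p + \<bar>v x\<bar> powr p))"
      using abs_diff_powr_le[OF p] by (intro AE_I2) simp
  qed simp
  then show ?thesis by (simp add: Lp_space_def)
qed

lemma Lp_space_cmult:
  assumes u: "u \<in> Lp_space p M"
  shows "(\<lambda>x. c * u x) \<in> Lp_space p M"
  using assms by (auto simp: Lp_space_def abs_mult powr_mult)

lemma powr_le_powrD:
  fixes x y :: real
  assumes "0 < p" "0 \<le> y" "x powr p \<le> y powr p"
  shows "x \<le> y"
proof (rule ccontr)
  assume "\<not> x \<le> y"
  then have "y powr p < x powr p" using assms by (intro powr_less_mono2) auto
  then show False using assms(3) by simp
qed

lemma Lp_dist_nonneg: "0 \<le> Lp_dist p M u v"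
  by (simp add: Lp_dist_def Lp_norm_def)

lemma Lp_norm_powr:
  "0 < p \<Longrightarrow> Lp_norm p M u powr p = (\<integral>x. \<bar>u x\<bar> powr p \<partial>M)"
  unfolding Lp_norm_def by (simp add: powr_powr integral_nonneg_AE)

lemma Lp_dist_cmult:
  assumes "0 < p" "0 \<le> c"
  shows "Lp_dist p M (\<lambda>x. c * u x) (\<lambda>x. c * v x) = c * Lp_dist p M u v"
proof -
  have "(\<lambda>x. \<bar>c * u x - c * v x\<bar> powr p) = (\<lambda>x. c powr p * \<bar>u x - v x\<bar> powr p)"
    using assms by (simp add: powr_mult abs_mult flip: right_diff_distrib)
  then show ?thesis
    using assms by (simp add: Lp_dist_def Lp_norm_def powr_mult powr_powr integral_nonneg_AE)
qed

text \<open>A path with steps of size at most \<open>K powr (1 / p)\<close> has length at most that times the number of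
  steps; this turns a bound for single generators into a Lipschitz bound.\<close>

lemma Lp_telescope:
  assumes p: "1 \<le> p" and u: "\<And>i. i \<le> n \<Longrightarrow> u i \<in> Lp_space p M"
    and step: "\<And>i. i < n \<Longrightarrow> (\<integral>x. \<bar>u (Suc i) x - u i x\<bar> powr p \<partial>M) \<le> K"
  shows "Lp_dist p M (u 0) (u n) \<le> K powr (1 / p) * real n"
proof (cases "n = 0")
  case True
  then show ?thesis by (simp add: Lp_dist_def Lp_norm_def)
next
  case False
  let ?d = "\<lambda>i x. u (Suc i) x - u i x"
  have d: "?d i \<in> Lp_space p M" if "i < n" for i
    using that by (intro Lp_space_diff[OF p] u) auto
  then have int: "integrable M (\<lambda>x. \<bar>?d i x\<bar> powr p)" if "i < n" for i
    using that by (auto simp: Lp_space_def)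
  have diff: "(\<lambda>x. u 0 x - u n x) \<in> Lp_space p M" by (intro Lp_space_diff[OF p] u) auto
  have "0 \<le> (\<integral>x. \<bar>?d 0 x\<bar> powr p \<partial>M)" by (intro integral_nonneg_AE) auto
  also have "\<dots> \<le> K" using False by (intro step) auto
  finally have K: "0 \<le> K" .
  have pw: "\<bar>u 0 x - u n x\<bar> powr p \<le> real n powr (p - 1) * (\<Sum>i<n. \<bar>?d i x\<bar> powr p)" for x
  proof -
    have "\<bar>u 0 x - u n x\<bar> = \<bar>\<Sum>i<n. ?d i x\<bar>" by (simp add: sum_lessThan_telescope[of "\<lambda>i. u i x"])
    also have "\<dots> \<le> (\<Sum>i<n. \<bar>?d i x\<bar>)" by (rule sum_abs)
    finally have "\<bar>u 0 x - u n x\<bar> powr p \<le> (\<Sum>i<n. \<bar>?d i x\<bar>) powr p"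
      using p by (intro powr_mono2) auto
    also have "\<dots> \<le> real n powr (p - 1) * (\<Sum>i<n. \<bar>?d i x\<bar> powr p)"
      by (intro sum_powr_le p) auto
    finally show ?thesis .
  qed
  have "(\<integral>x. \<bar>u 0 x - u n x\<bar> powr p \<partial>M) \<le> (\<integral>x. real n powr (p - 1) * (\<Sum>i<n. \<bar>?d i x\<bar> powr p) \<partial>M)"
    using diff int pw by (intro integral_mono integrable_mult_right Bochner_Integration.integrable_sum)
      (auto simp: Lp_space_def)
  also have "\<dots> = real n powr (p - 1) * (\<Sum>i<n. \<integral>x. \<bar>?d i x\<bar> powr p \<partial>M)"
    using int by (simp add: Bochner_Integration.integral_sum)
  also have "\<dots> \<le> real n powr (p - 1) * (\<Sum>i<n. K)"
    using step by (intro mult_left_mono sum_mono) auto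
  also have "\<dots> = real n powr p * K"
    using False by (simp add: powr_diff)
  finally have "Lp_dist p M (u 0) (u n) \<le> (real n powr p * K) powr (1 / p)"
    unfolding Lp_dist_def Lp_norm_def
    using p by (intro powr_mono2 integral_nonneg_AE) auto
  also have "\<dots> = K powr (1 / p) * real n"
    using K p by (simp add: powr_mult powr_powr)
  finally show ?thesis .
qed

text \<open>The direct sum of a countable family of maps into $L_p$-spaces, each point of the source being
  sent to a finitely supported family. The index set is moved into the natural numbers; slices
  outside its image get the empty measure space.\<close>

lemma Lp_direct_sum:
  fixes \<psi> :: "'g \<Rightarrow> 'i \<Rightarrow> 'w \<Rightarrow> real" and M :: "'i \<Rightarrow> 'w measure"
  assumes p: "1 \<le> p" and I: "countable I"
    and \<psi>: "\<And>g i. g \<in> A \<Longrightarrow> i \<in> I \<Longrightarrow> \<psi> g i \<in> Lp_space p (M i)"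
    and fin: "\<And>g. g \<in> A \<Longrightarrow> finite {i \<in> I. \<psi> g i \<noteq> (\<lambda>_. 0)}"
  obtains N :: "(nat \<times> 'w) measure" and \<phi> :: "'g \<Rightarrow> nat \<times> 'w \<Rightarrow> real"
  where "\<And>g. g \<in> A \<Longrightarrow> \<phi> g \<in> Lp_space p N"
    and "\<And>g h F. g \<in> A \<Longrightarrow> h \<in> A \<Longrightarrow> finite F \<Longrightarrow> F \<subseteq> I \<Longrightarrow>
      (\<And>i. i \<in> I - F \<Longrightarrow> \<psi> g i = \<psi> h i) \<Longrightarrow>
      (\<integral>x. \<bar>\<phi> g x - \<phi> h x\<bar> powr p \<partial>N) = (\<Sum>i\<in>F. \<integral>w. \<bar>\<psi> g i w - \<psi> h i w\<bar> powr p \<partial>M i)"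
proof -
  define e where "e = to_nat_on I"
  have inj: "inj_on e I" unfolding e_def by (rule inj_on_to_nat_on[OF I])
  define d where "d = inv_into I e"
  have de [simp]: "d (e i) = i" if "i \<in> I" for i unfolding d_def using inj that by simp
  have dI [simp]: "d n \<in> I" if "n \<in> e ` I" for n unfolding d_def using that by (rule inv_into_into)
  define M' where "M' n = (if n \<in> e ` I then M (d n) else count_space {})" for n
  define \<phi> where "\<phi> g = (\<lambda>(n, w). if n \<in> e ` I then \<psi> g (d n) w else 0)" for g
  let ?N = "sum_measure M'"
  have key: "integrable ?N (\<lambda>x. \<bar>\<phi> g x - \<phi> h x\<bar> powr p) \<and>
      (\<integral>x. \<bar>\<phi> g x - \<phi> h x\<bar> powr p \<partial>?N) = (\<Sum>i\<in>F. \<integral>w. \<bar>\<psi> g i w - \<psi> h i w\<bar> powr p \<partial>M i)"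
    if gh: "\<And>i. i \<in> I \<Longrightarrow> (\<lambda>w. \<psi> g i w - \<psi> h i w) \<in> Lp_space p (M i)"
      and F: "finite F" "F \<subseteq> I" "\<And>i. i \<in> I - F \<Longrightarrow> \<psi> g i = \<psi> h i" for g h F
  proof -
    let ?g = "\<lambda>x. \<bar>\<phi> g x - \<phi> h x\<bar> powr p"
    have *: "integrable (M' n) (\<lambda>w. ?g (n, w))" for n
      using gh[of "d n"] by (auto simp: \<phi>_def M'_def Lp_space_def)
    have **: "?g (n, w) = 0" if "n \<notin> e ` F" for n w
    proof (cases "n \<in> e ` I")
      case True
      then have "d n \<in> I - F" using that by auto
      then show ?thesis using F(3) by (simp add: \<phi>_def)
    qed (simp add: \<phi>_def)
    have "finite (e ` F)" using F by simp
    note r = integral_sum_measure[of ?g M' "e ` F", OF _ * this **]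
    have "(\<Sum>n\<in>e ` F. \<integral>w. ?g (n, w) \<partial>M' n) = (\<Sum>i\<in>F. \<integral>w. ?g (e i, w) \<partial>M' (e i))"
      using inj F by (subst sum.reindex) (auto intro: inj_on_subset)
    also have "\<dots> = (\<Sum>i\<in>F. \<integral>w. \<bar>\<psi> g i w - \<psi> h i w\<bar> powr p \<partial>M i)"
    proof (rule sum.cong[OF HOL.refl])
      fix i assume "i \<in> F"
      then have i: "i \<in> I" "e i \<in> e ` I" using F by auto
      then show "(\<integral>w. ?g (e i, w) \<partial>M' (e i)) = (\<integral>w. \<bar>\<psi> g i w - \<psi> h i w\<bar> powr p \<partial>M i)"
        by (simp add: \<phi>_def M'_def)
    qed
    finally show ?thesis using r by simp
  qed
  have "\<phi> g \<in> Lp_space p ?N" if g: "g \<in> A" for g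
  proof -
    let ?g = "\<lambda>x. \<bar>\<phi> g x\<bar> powr p"
    have *: "integrable (M' n) (\<lambda>w. ?g (n, w))" for n
      using \<psi>[OF g, of "d n"] by (auto simp: \<phi>_def M'_def Lp_space_def)
    have "integrable ?N ?g"
    proof (rule integral_sum_measure[OF _ *])
      show "finite (e ` {i \<in> I. \<psi> g i \<noteq> (\<lambda>_. 0)})" using fin[OF g] by simp
      fix n w assume "n \<notin> e ` {i \<in> I. \<psi> g i \<noteq> (\<lambda>_. 0)}"
      then show "?g (n, w) = 0" by (auto simp: \<phi>_def)
    qed simp
    moreover have "\<phi> g \<in> borel_measurable ?N"
      unfolding measurable_sum_measure using \<psi>[OF g] by (auto simp: \<phi>_def M'_def Lp_space_def)
    ultimately show ?thesis by (simp add: Lp_space_def)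
  qed
  moreover have "(\<integral>x. \<bar>\<phi> g x - \<phi> h x\<bar> powr p \<partial>?N) = (\<Sum>i\<in>F. \<integral>w. \<bar>\<psi> g i w - \<psi> h i w\<bar> powr p \<partial>M i)"
    if "g \<in> A" "h \<in> A" "finite F" "F \<subseteq> I" "\<And>i. i \<in> I - F \<Longrightarrow> \<psi> g i = \<psi> h i" for g h F
    using key[OF Lp_space_diff[OF p \<psi>[OF that(1)] \<psi>[OF that(2)]] that(3-5)] by simp
  ultimately show ?thesis by (rule that)
qed

section \<open>Concave functions and the weight\<close>

text \<open>Concavity with \<open>m = 1\<close>: the increments decrease. Everything else that is used of concavity,
  namely subadditivity and its iterates, follows from this.\<close>

lemma concave_map_increments:
  assumes "concave_map f" "a \<le> b"
  shows "f (Suc b) - f b \<le> f (Suc a) - f a"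
proof -
  have conc: "\<forall>n m. m \<le> n \<longrightarrow> f (n + m) - f n \<le> f n - f (n - m)"
    using assms(1) by (simp add: concave_map_def)
  show ?thesis using assms(2)
  proof (induction b rule: dec_induct)
    case (step n)
    have "f (Suc n + 1) - f (Suc n) \<le> f (Suc n) - f (Suc n - 1)"
      using conc[rule_format, of 1 "Suc n"] by simp
    then show ?case using step by simp
  qed simp
qed

lemma concave_map_subadditive:
  assumes "concave_map f"
  shows "f (a + b) \<le> f a + f b"
proof -
  have "f (a + b) - f b = (\<Sum>i<a. f (Suc i + b) - f (i + b))"
    using sum_lessThan_telescope[of "\<lambda>i. f (i + b)" a] by simp
  also have "\<dots> \<le> (\<Sum>i<a. f (Suc i) - f i)"
    using concave_map_increments[OF assms] by (intro sum_mono) auto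
  also have "\<dots> = f a" using assms sum_lessThan_telescope[of f a] by (simp add: concave_map_def)
  finally show ?thesis by simp
qed

lemma concave_map_sum_le:
  assumes "concave_map f" "finite A"
  shows "f (\<Sum>i\<in>A. n i) \<le> (\<Sum>i\<in>A. f (n i))"
  using assms(2)
proof induction
  case empty
  then show ?case using assms(1) by (simp add: concave_map_def)
next
  case (insert i A)
  then show ?case using concave_map_subadditive[OF assms(1), of "n i" "\<Sum>i\<in>A. n i"] by simp
qed

lemma concave_map_mult_le:
  assumes "concave_map f"
  shows "f (k * n) \<le> real k * f n"
  using concave_map_sum_le[OF assms, of "{..<k}" "\<lambda>_. n"] by simp

text \<open>An enumeration of \<open>D\<close> in increasing order dominates \<open>1, \<dots>, card D\<close> termwise. Thus a lower
  bound for a monotone weight needs only the number of distances that occur, not which they are.\<close>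

lemma sum_atLeastAtMost_card_le:
  fixes F :: "nat \<Rightarrow> real"
  assumes "mono F" "finite D" "0 \<notin> D"
  shows "(\<Sum>d=1..card D. F d) \<le> (\<Sum>d\<in>D. F d)"
  using assms(2,3)
proof (induction "card D" arbitrary: D)
  case 0
  then show ?case by simp
next
  case (Suc n)
  then have ne: "D \<noteq> {}" by auto
  have m: "Max D \<in> D" using Suc ne by (intro Max_in)
  have "D \<subseteq> {1..Max D}"
  proof
    fix d assume "d \<in> D"
    moreover from this have "d \<noteq> 0" using Suc.prems by metis
    ultimately show "d \<in> {1..Max D}" using Suc.prems by simp
  qed
  then have "card D \<le> Max D" using card_mono[of "{1..Max D}" D] by simp
  then have "F (card D) \<le> F (Max D)" using assms(1) by (simp add: monoD)
  moreover have "(\<Sum>d=1..card (D - {Max D}). F d) \<le> (\<Sum>d\<in>D - {Max D}. F d)"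
    using Suc m by (intro Suc.hyps(1)) auto
  moreover have "(\<Sum>d\<in>D. F d) = F (Max D) + (\<Sum>d\<in>D - {Max D}. F d)"
    by (rule sum.remove[OF Suc.prems(1) m])
  moreover have "card D = Suc (card (D - {Max D}))"
    by (rule card.remove[OF Suc.prems(1) m])
  ultimately show ?case by simp
qed

text \<open>The weight is the sum of its increments, so that, after the first one, their \<open>p\<close>-th powers are exactly the
  terms of Tessera's series while the weight is monotone by construction. The extra \<open>1\<close> at the first step makes
  \<open>\<Sum>k=1..a. weight p h k powr p\<close> at least \<open>a\<close>, hence unbounded even when \<open>h\<close> is bounded.\<close>

definition weight_step :: "real \<Rightarrow> (nat \<Rightarrow> real) \<Rightarrow> nat \<Rightarrow> real" where
  "weight_step p h d = (if d = 0 then 1 else 0) + h (Suc d) / real (Suc d) powr (1 + 1 / p)"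

definition weight :: "real \<Rightarrow> (nat \<Rightarrow> real) \<Rightarrow> nat \<Rightarrow> real" where
  "weight p h n = (\<Sum>d<n. weight_step p h d)"

context
  fixes p :: real and h :: "nat \<Rightarrow> real"
  assumes p: "1 \<le> p" and h: "concave_map h"
begin

private lemma h_nonneg: "0 \<le> h n" using h by (simp add: concave_map_def)

private lemma h_mono: "m \<le> n \<Longrightarrow> h m \<le> h n" using h by (simp add: concave_map_def monoD)

lemma weight_step_nonneg: "0 \<le> weight_step p h d"
  using h_nonneg by (simp add: weight_step_def)

lemma weight_0: "weight p h 0 = 0" by (simp add: weight_def)

lemma weight_Suc: "weight p h (Suc d) - weight p h d = weight_step p h d"
  by (simp add: weight_def)

lemma weight_mono: "m \<le> n \<Longrightarrow> weight p h m \<le> weight p h n"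
  unfolding weight_def by (intro sum_mono2) (auto simp: weight_step_nonneg)

lemma weight_nonneg: "0 \<le> weight p h n"
  using weight_mono[of 0 n] by (simp add: weight_0)

lemma weight_1: "weight p h 1 = 1 + h 1" by (simp add: weight_def weight_step_def)

text \<open>Since \<open>(1 + 1 / p) * p = p + 1\<close>, the \<open>p\<close>-th power of an increment is the corresponding term of
  Tessera's series, except for the first increment.\<close>

lemma weight_steps_bounded:
  assumes "tessera_C p h"
  obtains B where "\<And>n. (\<Sum>d<n. \<bar>weight p h (Suc d) - weight p h d\<bar> powr p) \<le> B"
proof -
  let ?t = "\<lambda>k. 1 / real (Suc k) * (h (Suc k) / real (Suc k)) powr p"
  have s: "summable ?t" using assms by (simp add: tessera_C_def)
  have *: "weight_step p h d powr p \<le> (if d = 0 then (1 + h 1) powr p else 0) + ?t d" for d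
  proof (cases "d = 0")
    case True
    then show ?thesis by (simp add: weight_step_def)
  next
    case False
    have "weight_step p h d powr p = h (Suc d) powr p / real (Suc d) powr ((1 + 1 / p) * p)"
      using False h_nonneg by (simp add: weight_step_def powr_divide powr_powr)
    also have "(1 + 1 / p) * p = p + 1" using p by (simp add: field_simps)
    also have "h (Suc d) powr p / real (Suc d) powr (p + 1) = ?t d"
      using h_nonneg by (simp add: powr_add powr_divide field_simps)
    finally show ?thesis using False by simp
  qed
  have "(\<Sum>d<n. \<bar>weight p h (Suc d) - weight p h d\<bar> powr p) \<le> (1 + h 1) powr p + suminf ?t" for n
  proof -
    have "(\<Sum>d<n. \<bar>weight p h (Suc d) - weight p h d\<bar> powr p) = (\<Sum>d<n. weight_step p h d powr p)"
      by (simp add: weight_Suc weight_step_nonneg)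
    also have "\<dots> \<le> (\<Sum>d<n. (if d = 0 then (1 + h 1) powr p else 0) + ?t d)"
      by (intro sum_mono *)
    also have "\<dots> = (\<Sum>d<n. if d = 0 then (1 + h 1) powr p else 0) + (\<Sum>d<n. ?t d)"
      by (rule sum.distrib)
    also have "(\<Sum>d<n. if d = 0 then (1 + h 1) powr p else 0) \<le> (1 + h 1) powr p"
      by (simp add: sum.delta)
    also have "(\<Sum>d<n. ?t d) \<le> suminf ?t" using h_nonneg by (intro sum_le_suminf[OF s]) auto
    finally show ?thesis by simp
  qed
  then show ?thesis by (rule that)
qed

text \<open>The increments with index between \<open>d\<close> and \<open>2 * d\<close> alone suffice, as \<open>h\<close> is monotone.\<close>

lemma weight_double_ge:
  assumes "1 \<le> d"
  shows "weight p h (2 * d) \<ge> h d * real d / real (2 * d) powr (1 + 1 / p)"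
proof -
  have "h d * real d / real (2 * d) powr (1 + 1 / p) = (\<Sum>k=d..<2*d. h d / real (2 * d) powr (1 + 1 / p))"
    by simp
  also have "\<dots> \<le> (\<Sum>k=d..<2*d. weight_step p h k)"
  proof (rule sum_mono)
    fix k assume k: "k \<in> {d..<2*d}"
    have "h d / real (2 * d) powr (1 + 1 / p) \<le> h (Suc k) / real (Suc k) powr (1 + 1 / p)"
      using k p by (intro frac_le h_nonneg h_mono powr_mono2) auto
    then show "h d / real (2 * d) powr (1 + 1 / p) \<le> weight_step p h k"
      unfolding weight_step_def by (rule order_trans) simp
  qed
  also have "\<dots> \<le> weight p h (2 * d)"
    unfolding weight_def by (intro sum_mono2) (auto simp: weight_step_nonneg)
  finally show ?thesis .
qed

text \<open>The \<open>2 * d\<close> terms with index above \<open>2 * d\<close> are at least \<open>weight p h (2 * d) powr p\<close>; the powers of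
  \<open>d\<close> cancel and a factor \<open>1 / 2\<close> remains.\<close>

lemma weight_sum_ge_4:
  assumes "1 \<le> d"
  shows "(\<Sum>k=1..4*d. weight p h k powr p) \<ge> (h d / 2) powr p"
proof -
  have pp: "(1 + 1 / p) * p = p + 1" using p by (simp add: field_simps)
  have "(h d * real d / real (2 * d) powr (1 + 1 / p)) powr p
      = (h d * real d) powr p / real (2 * d) powr (p + 1)"
    using h_nonneg p by (simp only: powr_divide powr_powr pp)
  also have "(h d * real d) powr p = (h d / 2) powr p * real (2 * d) powr p"
    using h_nonneg by (subst powr_mult[symmetric]) auto
  also have "real (2 * d) powr (p + 1) = real (2 * d) powr p * real (2 * d)"
    using assms by (simp add: powr_add)
  finally have "(h d / 2) powr p = real (2 * d) * (h d * real d / real (2 * d) powr (1 + 1 / p)) powr p"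
    using assms by simp
  also have "\<dots> \<le> real (2 * d) * weight p h (2 * d) powr p"
    using weight_double_ge[OF assms] h_nonneg p by (intro mult_left_mono powr_mono2) auto
  also have "\<dots> = (\<Sum>k=2*d+1..4*d. weight p h (2 * d) powr p)" by simp
  also have "\<dots> \<le> (\<Sum>k=2*d+1..4*d. weight p h k powr p)"
    using p by (intro sum_mono powr_mono2 weight_nonneg weight_mono) auto
  also have "\<dots> \<le> (\<Sum>k=1..4*d. weight p h k powr p)" by (intro sum_mono2) auto
  finally show ?thesis .
qed

text \<open>The factor \<open>14 = 7 * 2\<close>: with \<open>d = a div 4\<close> one has \<open>a \<le> 7 * d\<close> when \<open>4 \<le> a\<close>, so that \<open>h a \<le> 7 * h d\<close>,
  and the bound for \<open>4 * d\<close> loses another factor \<open>2\<close>. For \<open>0 < a < 4\<close> the first term of the sum is enough.\<close>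

lemma weight_sum_ge:
  "(\<Sum>k=1..a. weight p h k powr p) \<ge> (h a / 14) powr p"
  "(\<Sum>k=1..a. weight p h k powr p) \<ge> real a"
proof -
  have ge1: "weight p h k powr p \<ge> (1 + h 1) powr p" if "1 \<le> k" for k
    using weight_mono[OF that] p h_nonneg[of 1] weight_1 by (intro powr_mono2) auto
  have one: "(1 + h 1) powr p \<ge> 1" using h_nonneg[of 1] p by (simp add: ge_one_powr_ge_zero)
  have "real a = (\<Sum>k=1..a. 1)" by simp
  also have "\<dots> \<le> (\<Sum>k=1..a. weight p h k powr p)"
    using order_trans[OF one ge1] by (intro sum_mono) auto
  finally show "(\<Sum>k=1..a. weight p h k powr p) \<ge> real a" .
  show "(\<Sum>k=1..a. weight p h k powr p) \<ge> (h a / 14) powr p"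
  proof (cases "a < 4")
    case True
    show ?thesis
    proof (cases "a = 0")
      case True
      then show ?thesis using h by (simp add: concave_map_def)
    next
      case False
      have "h a \<le> real a * h 1" using concave_map_mult_le[OF h, of a 1] by simp
      also have "\<dots> \<le> 14 * h 1" using True h_nonneg by (intro mult_right_mono) auto
      finally have "(h a / 14) powr p \<le> (1 + h 1) powr p"
        using h_nonneg p by (intro powr_mono2) auto
      also have "\<dots> \<le> weight p h 1 powr p" using ge1[of 1] by simp
      also have "\<dots> = (\<Sum>k\<in>{1}. weight p h k powr p)" by simp
      also have "\<dots> \<le> (\<Sum>k=1..a. weight p h k powr p)" using False by (intro sum_mono2) auto
      finally show ?thesis .
    qed
  next
    case False
    define d where "d = a div 4"
    have d: "1 \<le> d" "4 * d \<le> a" "a \<le> 7 * d" using False unfolding d_def by presburger+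
    have "h a \<le> h (7 * d)" using d by (intro h_mono)
    also have "\<dots> \<le> 7 * h d" using concave_map_mult_le[OF h, of 7 d] by simp
    finally have "(h a / 14) powr p \<le> (h d / 2) powr p"
      using h_nonneg p by (intro powr_mono2) auto
    also have "\<dots> \<le> (\<Sum>k=1..4*d. weight p h k powr p)" by (rule weight_sum_ge_4[OF d(1)])
    also have "\<dots> \<le> (\<Sum>k=1..a. weight p h k powr p)" using d by (intro sum_mono2) auto
    finally show ?thesis .
  qed
qed

end
text \<open>A lower control function on the natural numbers suffices, because word distances are natural
  numbers; composed with the floor it becomes a control function on the reals.\<close>

lemma coarse_embedding_LpI:
  fixes R :: "nat \<Rightarrow> real"
  assumes \<phi>: "\<And>g. g \<in> carrier H \<Longrightarrow> \<phi> g \<in> Lp_space p M"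
    and R: "mono R" "\<And>n. 0 \<le> R n" "filterlim R at_top sequentially"
    and lower: "\<And>g h. g \<in> carrier H \<Longrightarrow> h \<in> carrier H \<Longrightarrow>
      R (word_dist H X g h) \<le> Lp_dist p M (\<phi> g) (\<phi> h)"
    and upper: "\<And>g h. g \<in> carrier H \<Longrightarrow> h \<in> carrier H \<Longrightarrow>
      Lp_dist p M (\<phi> g) (\<phi> h) \<le> C * real (word_dist H X g h)"
    and C: "0 < C"
  shows "coarse_embedding_Lp p M H X \<phi>"
  unfolding coarse_embedding_Lp_def
proof (intro conjI exI[of _ "\<lambda>t. R (nat \<lfloor>t\<rfloor>)"] exI[of _ C] ballI)
  show "mono_on {0..} (\<lambda>t::real. R (nat \<lfloor>t\<rfloor>))"
    using R(1) by (intro mono_onI) (auto intro!: monoD[OF R(1)] nat_mono floor_mono)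
  have "filterlim (\<lambda>t::real. nat \<lfloor>t\<rfloor>) sequentially at_top"
    by (rule filterlim_compose[OF filterlim_nat_sequentially filterlim_floor_sequentially])
  from filterlim_compose[OF R(3) this]
  show "filterlim (\<lambda>t::real. R (nat \<lfloor>t\<rfloor>)) at_top at_top" .
qed (use assms in auto)

section \<open>Words and their congruence\<close>

locale graph_product_data =
  fixes V :: "'v set" and E :: "'v set set"
    and G :: "'v \<Rightarrow> ('a, 'b) monoid_scheme" and X :: "'v \<Rightarrow> 'a set"
  assumes simplicial: "simplicial_graph V E"
    and group_vertex: "v \<in> V \<Longrightarrow> group (G v)"
    and generates_vertex: "v \<in> V \<Longrightarrow> generates (G v) (X v)"
begin

abbreviation "words \<equiv> gp_words V G"
abbreviation congruent_words (infix "\<doteq>" 50) where "w \<doteq> w' \<equiv> gp_cong V E G w w'"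
abbreviation "len v \<equiv> word_length (G v) (X v)"

lemma words_simps [simp]:
  "[] \<in> words"
  "x # w \<in> words \<longleftrightarrow> fst x \<in> V \<and> snd x \<in> carrier (G (fst x)) \<and> w \<in> words"
  "a @ b \<in> words \<longleftrightarrow> a \<in> words \<and> b \<in> words"
  by (cases x; auto simp: gp_words_def)+

lemma cong_words: "w \<doteq> w' \<Longrightarrow> w \<in> words \<and> w' \<in> words"
  using gp_cong_words group_vertex by blast

lemma cong_append: "a \<doteq> a' \<Longrightarrow> b \<doteq> b' \<Longrightarrow> a @ b \<doteq> a' @ b'"
  using gp_cong_append group_vertex by blast

lemma cong_refl [simp]: "w \<in> words \<Longrightarrow> w \<doteq> w" by (rule gp_cong.refl)

lemmas cong_sym = gp_cong.sym [of V E G]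
lemmas cong_trans [trans] = gp_cong.trans [of V E G]

definition inv_word :: "('v \<times> 'a) list \<Rightarrow> ('v \<times> 'a) list" where
  "inv_word w = rev (map (\<lambda>x. (fst x, inv\<^bsub>G (fst x)\<^esub> snd x)) w)"

lemma inv_word_words [simp]: "w \<in> words \<Longrightarrow> inv_word w \<in> words"
  using group.inv_closed[OF group_vertex] by (induction w) (auto simp: inv_word_def)

lemma cong_inv_right: "w \<in> words \<Longrightarrow> w @ inv_word w \<doteq> []"
proof (induction w)
  case Nil
  then show ?case by (simp add: inv_word_def)
next
  case (Cons x w)
  obtain v g where x: "x = (v, g)" by (cases x)
  with Cons.prems have v: "v \<in> V" "g \<in> carrier (G v)" and w: "w \<in> words" by auto
  interpret group "G v" by (rule group_vertex[OF v(1)])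
  have gi: "inv\<^bsub>G v\<^esub> g \<in> carrier (G v)" using v(2) by simp
  have "[x] @ (w @ inv_word w) @ [(v, inv\<^bsub>G v\<^esub> g)] \<doteq> [x] @ [] @ [(v, inv\<^bsub>G v\<^esub> g)]"
    using v gi x by (intro gp_cong.in_context Cons.IH w) auto
  also have "\<dots> \<doteq> [(v, g \<otimes>\<^bsub>G v\<^esub> inv\<^bsub>G v\<^esub> g)]"
    using gp_cong.mult[where G = G and v = v, OF v gi] x by simp
  also have "\<dots> \<doteq> []" using gp_cong.unit[OF v(1)] v(2) by simp
  finally show ?case by (simp add: inv_word_def x)
qed

lemma cong_inv_left: "w \<in> words \<Longrightarrow> inv_word w @ w \<doteq> []"
proof (induction w)
  case Nil
  then show ?case by (simp add: inv_word_def)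
next
  case (Cons x w)
  obtain v g where x: "x = (v, g)" by (cases x)
  with Cons.prems have v: "v \<in> V" "g \<in> carrier (G v)" and w: "w \<in> words" by auto
  interpret group "G v" by (rule group_vertex[OF v(1)])
  have gi: "inv\<^bsub>G v\<^esub> g \<in> carrier (G v)" using v(2) by simp
  have "[(v, inv\<^bsub>G v\<^esub> g), (v, g)] \<doteq> [(v, inv\<^bsub>G v\<^esub> g \<otimes>\<^bsub>G v\<^esub> g)]"
    using gp_cong.mult[where G = G and v = v, OF v(1) gi v(2)] by simp
  also have "\<dots> \<doteq> []" using gp_cong.unit[OF v(1)] v(2) by simp
  finally have "inv_word w @ [(v, inv\<^bsub>G v\<^esub> g), (v, g)] @ w \<doteq> inv_word w @ [] @ w"
    using w by (intro gp_cong.in_context) auto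
  also have "\<dots> \<doteq> []" using Cons.IH w by simp
  finally show ?case by (simp add: inv_word_def x)
qed

lemma cong_cancel_left:
  assumes "p \<in> words" "p @ u \<doteq> p @ u'"
  shows "u \<doteq> u'"
proof -
  have u: "u \<in> words" "u' \<in> words" using cong_words[OF assms(2)] by auto
  have *: "inv_word p @ p @ a \<doteq> a" if "a \<in> words" for a
    using gp_cong.in_context[OF cong_inv_left[OF assms(1)], of "[]" a] that by simp
  have "u \<doteq> inv_word p @ p @ u" by (rule cong_sym[OF *[OF u(1)]])
  also have "\<dots> \<doteq> inv_word p @ p @ u'"
    using assms(1) by (intro cong_append[OF cong_refl assms(2)]) simp
  also have "\<dots> \<doteq> u'" by (rule *[OF u(2)])
  finally show ?thesis .
qed

definition star :: "'v \<Rightarrow> 'v set" where "star v = {u. u = v \<or> {u, v} \<in> E}"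

definition star_words :: "'v \<Rightarrow> ('v \<times> 'a) list set" where
  "star_words v = {w \<in> words. fst ` set w \<subseteq> star v}"

lemma star_words_simps [simp]:
  "[] \<in> star_words v"
  "a @ b \<in> star_words v \<longleftrightarrow> a \<in> star_words v \<and> b \<in> star_words v"
  "x # w \<in> star_words v \<longleftrightarrow>
     fst x \<in> V \<and> fst x \<in> star v \<and> snd x \<in> carrier (G (fst x)) \<and> w \<in> star_words v"
  by (auto simp: star_words_def)

lemma star_words_words: "w \<in> star_words v \<Longrightarrow> w \<in> words" by (simp add: star_words_def)

lemma star_self [simp]: "v \<in> star v" by (simp add: star_def)

lemma star_words_inv [simp]: "w \<in> star_words v \<Longrightarrow> inv_word w \<in> star_words v"
  using inv_word_words[of w] by (auto simp: star_words_def inv_word_def)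

text \<open>Deleting all letters outside a set of vertices is the retraction of the graph product onto the
  subproduct over that set.\<close>

lemma cong_restrict:
  "w \<doteq> w' \<Longrightarrow> filter (\<lambda>x. fst x \<in> S) w \<doteq> filter (\<lambda>x. fst x \<in> S) w'"
proof (induction rule: gp_cong.induct)
  case (refl w)
  then have "filter (\<lambda>x. fst x \<in> S) w \<in> words" by (auto simp: gp_words_def)
  then show ?case by simp
next
  case (sym w w')
  then show ?case using gp_cong.sym by blast
next
  case (trans w w' w'')
  then show ?case using gp_cong.trans by blast
next
  case (in_context w w' a b)
  have "filter (\<lambda>x. fst x \<in> S) a \<in> words" "filter (\<lambda>x. fst x \<in> S) b \<in> words"
    using in_context by (auto simp: gp_words_def)
  then show ?case using in_context gp_cong.in_context by simp
next
  case (unit v)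
  then show ?case using gp_cong.unit by auto
next
  case (mult v g h)
  then show ?case using gp_cong.mult[where G = G and v = v, of V g h] by auto
next
  case (comm u v g h)
  then show ?case using gp_cong.comm[where G = G and u = u and v = v, of E V g h] by auto
qed

section \<open>Hyperplanes and coordinates\<close>

text \<open>The left coset of the class of \<open>p\<close> modulo the subgroup over the star of \<open>v\<close>, as the set of all words
  that represent an element of it. A hyperplane is such a coset together with its type, since
  different vertices may have the same star.\<close>

definition hyperplane_at :: "'v \<Rightarrow> ('v \<times> 'a) list \<Rightarrow> ('v \<times> 'a) list set" where
  "hyperplane_at v p = {q. \<exists>u\<in>star_words v. p @ u \<doteq> q}"

lemma hyperplane_at_self: "p \<in> words \<Longrightarrow> p \<in> hyperplane_at v p"
  unfolding hyperplane_at_def by (auto intro!: bexI[of _ "[]"])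

lemma hyperplane_at_cong: "p \<doteq> q \<Longrightarrow> hyperplane_at v p = hyperplane_at v q"
proof -
  have "hyperplane_at v q \<subseteq> hyperplane_at v p" if "p \<doteq> q" for p q
  proof
    fix r assume "r \<in> hyperplane_at v q"
    then obtain u where u: "u \<in> star_words v" "q @ u \<doteq> r" by (auto simp: hyperplane_at_def)
    have "p @ u \<doteq> q @ u" using that u star_words_words by (intro cong_append) auto
    then show "r \<in> hyperplane_at v p" using u cong_trans by (auto simp: hyperplane_at_def)
  qed
  then show "p \<doteq> q \<Longrightarrow> hyperplane_at v p = hyperplane_at v q" using cong_sym by blast
qed

lemma hyperplane_at_append_star:
  assumes "p \<in> words" "u \<in> star_words v"
  shows "hyperplane_at v (p @ u) = hyperplane_at v p"
proof -
  have sub: "hyperplane_at v (p @ u) \<subseteq> hyperplane_at v p" if "u \<in> star_words v" for p u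
  proof
    fix r assume "r \<in> hyperplane_at v (p @ u)"
    then obtain u' where "u' \<in> star_words v" "p @ u @ u' \<doteq> r" by (auto simp: hyperplane_at_def)
    then show "r \<in> hyperplane_at v p" using that unfolding hyperplane_at_def by (intro CollectI bexI[of _ "u @ u'"]) auto
  qed
  have "p @ u @ inv_word u \<doteq> p @ []"
    using assms cong_inv_right star_words_words by (intro cong_append) auto
  then have "hyperplane_at v p = hyperplane_at v ((p @ u) @ inv_word u)" by (intro hyperplane_at_cong) (auto intro: cong_sym)
  also have "\<dots> \<subseteq> hyperplane_at v (p @ u)" using assms by (intro sub) auto
  finally show ?thesis using sub assms by blast
qed

lemma hyperplane_at_eqD:
  assumes "q \<in> words" "hyperplane_at v p = hyperplane_at v q"
  obtains u where "u \<in> star_words v" "p @ u \<doteq> q"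
  using hyperplane_at_self[OF assms(1), of v] assms(2) by (auto simp: hyperplane_at_def)

text \<open>The hyperplanes crossed by the letters of \<open>w\<close> on the path that starts at \<open>p\<close>.\<close>

primrec crossed :: "('v \<times> 'a) list \<Rightarrow> ('v \<times> 'a) list \<Rightarrow> ('v \<times> ('v \<times> 'a) list set) list" where
  "crossed p [] = []"
| "crossed p (x # w) = (fst x, hyperplane_at (fst x) p) # crossed (p @ [x]) w"

text \<open>The change of the coordinate at the hyperplane \<open>k\<close> along the path \<open>w\<close> that starts at \<open>p\<close>. The
  coordinate of \<open>w\<close> itself is \<open>coord k [] w\<close>.\<close>

primrec coord :: "('v \<times> ('v \<times> 'a) list set) \<Rightarrow> ('v \<times> 'a) list \<Rightarrow> ('v \<times> 'a) list \<Rightarrow> 'a" where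
  "coord k p [] = \<one>\<^bsub>G (fst k)\<^esub>"
| "coord k p (x # w) =
     (if k = (fst x, hyperplane_at (fst x) p) then snd x \<otimes>\<^bsub>G (fst k)\<^esub> coord k (p @ [x]) w
      else coord k (p @ [x]) w)"

lemma coord_closed:
  "w \<in> words \<Longrightarrow> fst k \<in> V \<Longrightarrow> coord k p w \<in> carrier (G (fst k))"
proof (induction w arbitrary: p)
  case Nil
  interpret group "G (fst k)" using Nil by (intro group_vertex)
  show ?case by simp
next
  case (Cons x w)
  then interpret group "G (fst x)" by (intro group_vertex) auto
  show ?case using Cons by auto
qed

lemma coord_append:
  "a \<in> words \<Longrightarrow> b \<in> words \<Longrightarrow> fst k \<in> V \<Longrightarrow>
     coord k p (a @ b) = coord k p a \<otimes>\<^bsub>G (fst k)\<^esub> coord k (p @ a) b"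
proof (induction a arbitrary: p)
  case Nil
  interpret group "G (fst k)" using Nil by (intro group_vertex)
  show ?case using coord_closed Nil by simp
next
  case (Cons x a)
  then interpret group "G (fst x)" by (intro group_vertex) auto
  show ?case using Cons coord_closed[of a k] coord_closed[of b k] by (auto simp: m_assoc)
qed

lemma coord_base_cong: "p \<doteq> q \<Longrightarrow> w \<in> words \<Longrightarrow> coord k p w = coord k q w"
proof (induction w arbitrary: p q)
  case (Cons x w)
  have "p @ [x] \<doteq> q @ [x]" using Cons.prems by (intro cong_append) auto
  then have "coord k (p @ [x]) w = coord k (q @ [x]) w" using Cons by auto
  then show ?case by (simp only: coord.simps hyperplane_at_cong[OF Cons.prems(1)])
qed simp

text \<open>Letters of \<open>G\<^sub>v\<close>, and of the \<open>G\<^sub>u\<close> with \<open>u\<close> adjacent to \<open>v\<close>, do not leave the hyperplane of type \<open>v\<close> in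
  which they start. So in a relation \<open>mult\<close> both letters cross the same hyperplane, and in a relation
  \<open>comm\<close> each letter crosses the same hyperplane in either order.\<close>

lemma coord_cong:
  "w \<doteq> w' \<Longrightarrow> p \<in> words \<Longrightarrow> fst k \<in> V \<Longrightarrow> coord k p w = coord k p w'"
proof (induction arbitrary: p rule: gp_cong.induct)
  case (in_context w w' a b)
  have w: "w \<in> words" "w' \<in> words" using cong_words in_context by blast+
  have "p @ a @ w \<doteq> p @ a @ w'" using in_context by (intro cong_append) auto
  then have "coord k (p @ a @ w) b = coord k (p @ a @ w') b"
    using in_context by (intro coord_base_cong)
  moreover have "coord k (p @ a) w = coord k (p @ a) w'" using in_context by simp
  ultimately show ?case using in_context w by (simp add: coord_append)
next
  case (unit v)
  interpret group "G v" using unit by (intro group_vertex)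
  show ?case by auto
next
  case (mult v g h)
  interpret group "G v" using mult by (intro group_vertex)
  have "hyperplane_at v (p @ [(v, g)]) = hyperplane_at v p" using mult by (intro hyperplane_at_append_star) auto
  then show ?case using mult by (auto simp: m_assoc)
next
  case (comm u v g h)
  interpret u: group "G u" using comm by (intro group_vertex)
  interpret v: group "G v" using comm by (intro group_vertex)
  have "{u, v} \<in> E" "{v, u} \<in> E" using comm by (simp_all add: insert_commute)
  then have "u \<noteq> v" using simplicial by (auto simp: simplicial_graph_def)
  moreover have "hyperplane_at u (p @ [(v, h)]) = hyperplane_at u p" "hyperplane_at v (p @ [(u, g)]) = hyperplane_at v p"
    using comm \<open>{v, u} \<in> E\<close> by (auto intro!: hyperplane_at_append_star simp: star_def)
  ultimately show ?case using comm by auto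
qed auto

lemma crossed_append: "crossed p (a @ b) = crossed p a @ crossed (p @ a) b"
  by (induction a arbitrary: p) auto

lemma in_crossedD:
  "k \<in> set (crossed p w) \<Longrightarrow> \<exists>a x b. w = a @ x # b \<and> k = (fst x, hyperplane_at (fst x) (p @ a))"
proof (induction w arbitrary: p)
  case (Cons x w)
  show ?case
  proof (cases "k = (fst x, hyperplane_at (fst x) p)")
    case True
    then show ?thesis by (intro exI[of _ "[]"] exI[of _ x] exI[of _ w]) auto
  next
    case False
    then have "k \<in> set (crossed (p @ [x]) w)" using Cons.prems by simp
    from Cons.IH[OF this] obtain a y b where "w = a @ y # b" "k = (fst y, hyperplane_at (fst y) (p @ [x] @ a))"
      by (metis append.assoc)
    then show ?thesis by (intro exI[of _ "x # a"] exI[of _ y] exI[of _ b]) auto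
  qed
qed simp

lemma coord_eq_one: "k \<notin> set (crossed p w) \<Longrightarrow> coord k p w = \<one>\<^bsub>G (fst k)\<^esub>"
  by (induction w arbitrary: p) auto

lemma crossed_fst_V: "w \<in> words \<Longrightarrow> k \<in> set (crossed p w) \<Longrightarrow> fst k \<in> V"
  by (induction w arbitrary: p) auto

section \<open>Reduced words\<close>

definition reduced :: "('v \<times> 'a) list \<Rightarrow> bool" where
  "reduced w \<longleftrightarrow> w \<in> words \<and> (\<forall>w'. w \<doteq> w' \<longrightarrow> length w \<le> length w')"

lemma reduced_words: "reduced w \<Longrightarrow> w \<in> words" by (simp add: reduced_def)

lemma reduced_exists:
  assumes "w \<in> words"
  obtains w' where "reduced w'" "w \<doteq> w'"
proof -
  define w' where "w' = arg_min length (\<lambda>w'. w \<doteq> w')"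
  have *: "w \<doteq> w'" "\<And>u. w \<doteq> u \<Longrightarrow> length w' \<le> length u"
    unfolding w'_def using arg_min_natI[of "\<lambda>w'. w \<doteq> w'" w length] 
      arg_min_nat_le[of "\<lambda>w'. w \<doteq> w'" _ length] assms by auto
  then have "reduced w'" using cong_words cong_trans unfolding reduced_def by blast
  with * show ?thesis using that by blast
qed

lemma reduced_infix:
  assumes "reduced (a @ w @ b)" shows "reduced w"
  unfolding reduced_def
proof (intro conjI allI impI)
  show "w \<in> words" using assms reduced_words by force
  fix w' assume "w \<doteq> w'"
  then have "a @ w @ b \<doteq> a @ w' @ b" using assms reduced_words by (force intro!: gp_cong.in_context)
  then have "length (a @ w @ b) \<le> length (a @ w' @ b)" using assms unfolding reduced_def by blast
  then show "length w \<le> length w'" by simp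
qed

lemma cong_move_letter:
  assumes "m \<in> words" "\<And>x. x \<in> set m \<Longrightarrow> {fst x, v} \<in> E" "v \<in> V" "h \<in> carrier (G v)"
  shows "m @ [(v, h)] \<doteq> (v, h) # m"
  using assms(1,2)
proof (induction m)
  case Nil
  then show ?case using assms by simp
next
  case (Cons x m)
  have "[x] @ (m @ [(v, h)]) \<doteq> [x] @ ((v, h) # m)"
    using Cons by (intro cong_append) auto
  also have "[x] @ ((v, h) # m) = [x, (v, h)] @ m" by simp
  also have "\<dots> \<doteq> [(v, h), x] @ m"
    using Cons.prems assms gp_cong.comm[of "fst x" v E V "snd x" G h]
    by (intro cong_append) auto
  finally show ?case by simp
qed

text \<open>If both letters crossed the same hyperplane, the subword before the second one would represent an
  element of the subgroup over the star of \<open>v\<close>. Retracting onto this subgroup deletes no letter, by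
  minimality, so all letters between the two lie over the star. The letters between the first one
  and the next one of type \<open>v\<close> then commute with \<open>G\<^sub>v\<close>, and these two could be merged.\<close>

lemma reduced_hyperplane_neq:
  assumes red: "reduced ((v, g) # m @ [(v, h)])" and p: "p \<in> words"
  shows "hyperplane_at v p \<noteq> hyperplane_at v (p @ (v, g) # m)"
proof
  assume eq: "hyperplane_at v p = hyperplane_at v (p @ (v, g) # m)"
  have w: "v \<in> V" "g \<in> carrier (G v)" "h \<in> carrier (G v)" "m \<in> words"
    using reduced_words[OF red] by auto
  interpret group "G v" using w by (intro group_vertex)
  obtain u where u: "u \<in> star_words v" "p @ u \<doteq> p @ (v, g) # m"
    using hyperplane_at_eqD[OF _ eq] p w by auto
  let ?F = "filter (\<lambda>x. fst x \<in> star v)"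
  have "u \<doteq> (v, g) # m" using cong_cancel_left[OF p u(2)] .
  from cong_restrict[OF this, of "star v"]
  have "?F u \<doteq> (v, g) # ?F m" by simp
  moreover have "?F u = u" using u(1) by (auto simp: star_words_def filter_id_conv)
  ultimately have "(v, g) # m \<doteq> (v, g) # ?F m"
    using \<open>u \<doteq> (v, g) # m\<close> cong_sym cong_trans by metis
  moreover have "reduced ((v, g) # m)" using reduced_infix[of "[]" "(v, g) # m" "[(v, h)]"] red by simp
  ultimately have "length m \<le> length (?F m)" by (auto simp: reduced_def)
  then have star: "\<forall>x\<in>set m. fst x \<in> star v"
    by (metis (no_types, lifting) filter_id_conv length_filter_le length_filter_less nat_less_le not_le)
  obtain m1 g' m2 where m: "m @ [(v, h)] = m1 @ (v, g') # m2" "\<forall>x\<in>set m1. fst x \<noteq> v"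
  proof -
    obtain ys y zs where "m @ [(v, h)] = ys @ y # zs" "fst y = v" "\<forall>x\<in>set ys. fst x \<noteq> v"
      using split_list_first_prop[of "m @ [(v, h)]" "\<lambda>x. fst x = v"] by auto
    then show ?thesis using that by (metis prod.collapse)
  qed
  have sub: "set m1 \<subseteq> set m"
  proof
    fix x assume "x \<in> set m1"
    then have "x \<in> set (m @ [(v, h)])" "fst x \<noteq> v" using m by auto
    then show "x \<in> set m" by auto
  qed
  have w1: "m1 \<in> words" "m2 \<in> words" "g' \<in> carrier (G v)"
  proof -
    have "m1 @ (v, g') # m2 \<in> words" using w by (simp flip: m(1))
    then show "m1 \<in> words" "m2 \<in> words" "g' \<in> carrier (G v)" by auto
  qed
  have red1: "reduced ((v, g) # m1 @ [(v, g')])"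
    using reduced_infix[of "[]" "(v, g) # m1 @ [(v, g')]" m2] red m(1) by simp
  have "[(v, g)] @ m1 @ [(v, g')] \<doteq> [(v, g)] @ (v, g') # m1"
    using sub star m(2) w w1 by (intro cong_append cong_move_letter) (auto simp: star_def)
  also have "[(v, g)] @ (v, g') # m1 = [(v, g), (v, g')] @ m1" by simp
  also have "\<dots> \<doteq> [(v, g \<otimes>\<^bsub>G v\<^esub> g')] @ m1"
    using w w1 by (intro cong_append gp_cong.mult cong_refl) auto
  finally show False using red1 by (auto simp: reduced_def)
qed

lemma reduced_distinct_crossed:
  "reduced w \<Longrightarrow> p \<in> words \<Longrightarrow> distinct (crossed p w)"
proof (induction w arbitrary: p)
  case (Cons x w)
  have w: "fst x \<in> V" "snd x \<in> carrier (G (fst x))" "w \<in> words" 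
    using reduced_words[OF Cons.prems(1)] by auto
  have "(fst x, hyperplane_at (fst x) p) \<notin> set (crossed (p @ [x]) w)"
  proof
    assume "(fst x, hyperplane_at (fst x) p) \<in> set (crossed (p @ [x]) w)"
    from in_crossedD[OF this] obtain a y b where
      y: "w = a @ y # b" "fst y = fst x" "hyperplane_at (fst x) p = hyperplane_at (fst x) (p @ x # a)"
      by (metis Pair_inject append.assoc append_Cons append_Nil)
    have "reduced ([] @ (x # a @ [y]) @ b)" using Cons.prems y(1) by simp
    from reduced_infix[OF this] have "reduced ((fst x, snd x) # a @ [(fst x, snd y)])"
      by (metis y(2) prod.collapse)
    from reduced_hyperplane_neq[OF this Cons.prems(2)] y(3) show False by simp
  qed
  moreover have "reduced w" using reduced_infix[of "[x]" w "[]"] Cons.prems by simp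
  moreover have "p @ [x] \<in> words" using w Cons.prems by simp
  ultimately show ?case using Cons.IH by simp
qed simp

text \<open>If no hyperplane is crossed twice, the coordinate at a crossed hyperplane is the letter that
  crosses it.\<close>

lemma coord_reduced_sum:
  assumes "distinct (crossed p w)" "w \<in> words"
  shows "(\<Sum>k\<in>set (crossed p w). if fst k \<in> A then len (fst k) (coord k p w) else 0)
       = (\<Sum>x\<leftarrow>w. if fst x \<in> A then len (fst x) (snd x) else 0)"
  using assms
proof (induction w arbitrary: p)
  case (Cons x w)
  let ?k = "(fst x, hyperplane_at (fst x) p)"
  interpret group "G (fst x)" using Cons.prems by (intro group_vertex) auto
  have notin: "?k \<notin> set (crossed (p @ [x]) w)" using Cons.prems by simp
  have "coord ?k p (x # w) = snd x" using coord_eq_one[OF notin] Cons.prems by simp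
  moreover have "(\<Sum>k\<in>set (crossed (p @ [x]) w). if fst k \<in> A then len (fst k) (coord k p (x # w)) else 0)
      = (\<Sum>k\<in>set (crossed (p @ [x]) w). if fst k \<in> A then len (fst k) (coord k (p @ [x]) w) else 0)"
    using notin by (intro sum.cong HOL.refl) auto
  ultimately show ?case using Cons.IH[of "p @ [x]"] Cons.prems notin
    by (simp del: coord.simps)
qed simp

section \<open>The linear order on the hyperplanes of one type\<close>

definition letter_weight :: "'v \<Rightarrow> ('v \<times> 'a) list \<Rightarrow> nat" where
  "letter_weight v w = (\<Sum>x\<leftarrow>w. if fst x = v then len v (snd x) else 0)"

definition coord_length :: "('v \<times> 'a) list \<Rightarrow> ('v \<times> ('v \<times> 'a) list set) \<Rightarrow> nat" where
  "coord_length w k = len (fst k) (coord k [] w)"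

text \<open>The total length of the tiling of \<open>w\<close> in type \<open>v\<close>. The sum ranges over the support only, which
  is finite.\<close>

definition type_length :: "'v \<Rightarrow> ('v \<times> 'a) list \<Rightarrow> nat" where
  "type_length v w = (\<Sum>k | fst k = v \<and> coord_length w k \<noteq> 0. coord_length w k)"

text \<open>The left end of the interval of \<open>k\<close>: the total length of all other coordinates of the same type at
  any element of the coset \<open>k\<close>. Moving inside the coset changes no other coordinate of this type, so
  the choice of the element does not matter (\<open>offset_eq\<close>).\<close>

definition offset :: "('v \<times> ('v \<times> 'a) list set) \<Rightarrow> nat" where
  "offset k = (\<Sum>k' | fst k' = fst k \<and> k' \<noteq> k \<and> coord_length (SOME q. q \<in> snd k) k' \<noteq> 0.
              coord_length (SOME q. q \<in> snd k) k')"

lemma coord_length_support: "coord_length w k \<noteq> 0 \<Longrightarrow> k \<in> set (crossed [] w)"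
  by (metis coord_length_def coord_eq_one word_length_one)

lemma finite_coord_length_support: "finite {k. P k \<and> coord_length w k \<noteq> 0}"
proof (rule finite_subset[OF _ finite_set[of "crossed [] w"]])
  show "{k. P k \<and> coord_length w k \<noteq> 0} \<subseteq> set (crossed [] w)"
    by (rule subsetI, rule coord_length_support[of w]) simp
qed

lemma coord_length_cong: "w \<doteq> w' \<Longrightarrow> fst k \<in> V \<Longrightarrow> coord_length w k = coord_length w' k"
  using coord_cong[of w w' "[]" k] by (simp add: coord_length_def)

lemma type_length_cong: "w \<doteq> w' \<Longrightarrow> v \<in> V \<Longrightarrow> type_length v w = type_length v w'"
  unfolding type_length_def by (intro sum.cong) (auto simp: coord_length_cong)

lemma type_length_reduced:
  assumes "reduced w" shows "type_length v w = letter_weight v w"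
proof -
  have "type_length v w = (\<Sum>k\<in>set (crossed [] w). if fst k \<in> {v} then coord_length w k else 0)"
    unfolding type_length_def
  proof (rule sum.mono_neutral_cong_left)
    show "{k. fst k = v \<and> coord_length w k \<noteq> 0} \<subseteq> set (crossed [] w)"
      by (rule subsetI, rule coord_length_support[of w]) simp
  qed auto
  also have "\<dots> = (\<Sum>k\<in>set (crossed [] w). if fst k \<in> {v} then len (fst k) (coord k [] w) else 0)"
    by (simp only: coord_length_def)
  also have "\<dots> = (\<Sum>x\<leftarrow>w. if fst x \<in> {v} then len (fst x) (snd x) else 0)"
    by (rule coord_reduced_sum[OF reduced_distinct_crossed[OF assms] reduced_words[OF assms]]) simp
  also have "\<dots> = letter_weight v w" unfolding letter_weight_def
    by (intro arg_cong[where f=sum_list] map_cong) auto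
  finally show ?thesis .
qed

lemma coord_star:
  assumes "u \<in> star_words v" "p \<in> words" "fst k = v" "k \<noteq> (v, hyperplane_at v p)"
  shows "coord k p u = \<one>\<^bsub>G v\<^esub>"
  using assms
proof (induction u arbitrary: p)
  case (Cons x u)
  have "hyperplane_at v (p @ [x]) = hyperplane_at v p" using Cons.prems by (intro hyperplane_at_append_star) auto
  then show ?case using Cons by auto
qed simp

lemma coord_hyperplane:
  assumes "p \<in> words" "q \<in> hyperplane_at v p" "v \<in> V" "fst k = v" "k \<noteq> (v, hyperplane_at v p)"
  shows "coord k [] q = coord k [] p"
proof -
  interpret group "G v" using assms by (intro group_vertex)
  obtain u where u: "u \<in> star_words v" "p @ u \<doteq> q" using assms by (auto simp: hyperplane_at_def)
  have "coord k [] q = coord k [] (p @ u)" using coord_cong[OF u(2), of "[]" k] assms by simp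
  also have "\<dots> = coord k [] p \<otimes>\<^bsub>G v\<^esub> coord k p u"
    using coord_append[of p u k "[]"] assms u star_words_words by auto
  also have "\<dots> = coord k [] p" using coord_star[OF u(1)] coord_closed[of p k "[]"] assms by simp
  finally show ?thesis .
qed

lemma offset_eq:
  assumes "p \<in> words" "v \<in> V"
  shows "offset (v, hyperplane_at v p) = (\<Sum>k | fst k = v \<and> k \<noteq> (v, hyperplane_at v p) \<and> coord_length p k \<noteq> 0. coord_length p k)"
proof -
  let ?q = "SOME q. q \<in> hyperplane_at v p"
  have "?q \<in> hyperplane_at v p" using hyperplane_at_self[OF assms(1)] by (rule someI)
  then have *: "coord_length ?q k = coord_length p k" if "fst k = v" "k \<noteq> (v, hyperplane_at v p)" for k
    using coord_hyperplane[OF assms(1) _ assms(2) that] that by (simp add: coord_length_def)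
  show ?thesis unfolding offset_def
    by (intro sum.cong Collect_cong) (simp_all add: * cong: conj_cong)
qed

lemma type_length_split:
  assumes "p \<in> words" "v \<in> V"
  shows "type_length v p = offset (v, hyperplane_at v p) + coord_length p (v, hyperplane_at v p)"
proof -
  let ?k = "(v, hyperplane_at v p)"
  have "type_length v p = (\<Sum>k \<in> insert ?k {k. fst k = v \<and> coord_length p k \<noteq> 0}. coord_length p k)"
    unfolding type_length_def using finite_coord_length_support[of "\<lambda>k. fst k = v" p]
    by (intro sum.mono_neutral_left) auto
  also have "insert ?k {k. fst k = v \<and> coord_length p k \<noteq> 0}
      = insert ?k {k. fst k = v \<and> k \<noteq> ?k \<and> coord_length p k \<noteq> 0}" by auto
  also have "(\<Sum>k \<in> \<dots>. coord_length p k) = coord_length p ?k + offset ?k"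
    using finite_coord_length_support[of "\<lambda>k. fst k = v \<and> k \<noteq> ?k" p]
    by (subst sum.insert) (auto simp: offset_eq[OF assms])
  finally show ?thesis by simp
qed

lemma crossed_nth:
  "i < length w \<Longrightarrow> crossed p w ! i = (fst (w ! i), hyperplane_at (fst (w ! i)) (p @ take i w))"
proof (induction w arbitrary: p i)
  case (Cons x w)
  then show ?case by (cases i) auto
qed simp

lemma length_crossed [simp]: "length (crossed p w) = length w"
  by (induction w arbitrary: p) auto

lemma words_nth: "w \<in> words \<Longrightarrow> i < length w \<Longrightarrow>
    fst (w ! i) \<in> V \<and> snd (w ! i) \<in> carrier (G (fst (w ! i)))"
proof -
  assume "w \<in> words" "i < length w"
  then have "w ! i \<in> (SIGMA v:V. carrier (G v))"
    unfolding gp_words_def in_lists_conv_set using nth_mem by blast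
  then show ?thesis by (cases "w ! i") auto
qed

lemma words_take_drop [simp]:
  "w \<in> words \<Longrightarrow> take i w \<in> words" "w \<in> words \<Longrightarrow> drop i w \<in> words"
  using words_simps(3)[of "take i w" "drop i w"] by auto

lemma reduced_take: "reduced w \<Longrightarrow> reduced (take i w)"
  using reduced_infix[of "[]" "take i w" "drop i w"] by simp

lemma reduced_coord_before:
  assumes "reduced w" "j \<le> i" "i < length w" "k = (fst (w ! i), hyperplane_at (fst (w ! i)) (take i w))"
  shows "coord k [] (take j w) = \<one>\<^bsub>G (fst k)\<^esub>"
proof (rule coord_eq_one)
  have d: "distinct (crossed [] w)" using assms by (intro reduced_distinct_crossed) auto
  have "crossed [] (take j w @ drop j w) = crossed [] (take j w) @ crossed (take j w) (drop j w)"
    using crossed_append[of "[]" "take j w" "drop j w"] by simp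
  then have e: "crossed [] w = crossed [] (take j w) @ crossed (take j w) (drop j w)" by simp
  have "k = crossed [] w ! i" using crossed_nth[of i w "[]"] assms by simp
  also have "\<dots> = crossed (take j w) (drop j w) ! (i - j)"
    using assms by (simp add: e nth_append)
  also have "\<dots> \<in> set (crossed (take j w) (drop j w))" using assms by (intro nth_mem) simp
  finally show "k \<notin> set (crossed [] (take j w))" using d unfolding e by auto
qed

lemma reduced_coord_after:
  assumes "reduced w" "i < j" "i < length w" "k = (fst (w ! i), hyperplane_at (fst (w ! i)) (take i w))"
  shows "coord k [] w = coord k [] (take j w)"
proof -
  have d: "distinct (crossed [] w)" using assms by (intro reduced_distinct_crossed) auto
  have w: "w \<in> words" using assms reduced_words by blast
  have kV: "fst k \<in> V" using words_nth[OF w assms(3)] assms(4) by simp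
  interpret group "G (fst k)" using kV by (rule group_vertex)
  have "crossed [] (take j w @ drop j w) = crossed [] (take j w) @ crossed (take j w) (drop j w)"
    using crossed_append[of "[]" "take j w" "drop j w"] by simp
  then have e: "crossed [] w = crossed [] (take j w) @ crossed (take j w) (drop j w)" by simp
  have "k = crossed [] w ! i" using crossed_nth[of i w "[]"] assms by simp
  also have "\<dots> = crossed [] (take j w) ! i"
    using assms by (simp add: e nth_append)
  also have "\<dots> \<in> set (crossed [] (take j w))" using assms by (intro nth_mem) simp
  finally have "coord k (take j w) (drop j w) = \<one>\<^bsub>G (fst k)\<^esub>"
    using d unfolding e by (intro coord_eq_one) auto
  then show ?thesis
    using coord_append[of "take j w" "drop j w" k "[]"] w kV coord_closed[of "take j w" k "[]"] by simp
qed

text \<open>In a reduced word the prefix before the letter that crosses \<open>k\<close> lies in the coset \<open>k\<close> and has a trivial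
  coordinate there. Its total length in this type is therefore the offset of \<open>k\<close>.\<close>

lemma reduced_position:
  assumes "reduced w" "i < length w" "k = (v, hyperplane_at v (take i w))" "fst (w ! i) = v"
  shows "coord k [] w = snd (w ! i)" "offset k = letter_weight v (take i w)" "coord_length w k = len v (snd (w ! i))"
proof -
  have w: "w \<in> words" using assms reduced_words by blast
  have v: "v \<in> V" and g: "snd (w ! i) \<in> carrier (G v)" using words_nth[OF w assms(2)] assms by auto
  interpret group "G v" using v by (rule group_vertex)
  have before: "coord k [] (take i w) = \<one>\<^bsub>G v\<^esub>"
    using reduced_coord_before[OF assms(1) order_refl assms(2), of k] assms by simp
  have "coord k [] w = coord k [] (take (Suc i) w)"
    using reduced_coord_after[OF assms(1) lessI assms(2), of k] assms by simp
  also have "take (Suc i) w = take i w @ [w ! i]" using assms by (simp add: take_Suc_conv_app_nth)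
  also have "coord k [] (take i w @ [w ! i]) = snd (w ! i)"
    using coord_append[of "take i w" "[w ! i]" k "[]"] w v g before assms by simp
  finally show c: "coord k [] w = snd (w ! i)" .
  then show "coord_length w k = len v (snd (w ! i))" by (simp add: coord_length_def assms)
  have "offset k = type_length v (take i w)"
    using type_length_split[of "take i w" v] before w v assms by (simp add: coord_length_def)
  also have "\<dots> = letter_weight v (take i w)" by (rule type_length_reduced[OF reduced_take[OF assms(1)]])
  finally show "offset k = letter_weight v (take i w)" .
qed

lemma coord_length_position:
  assumes "coord_length w k \<noteq> 0"
  obtains i where "i < length w" "fst (w ! i) = fst k" "k = (fst k, hyperplane_at (fst k) (take i w))"
proof -
  from coord_length_support[OF assms] obtain i where "i < length w" "k = crossed [] w ! i"
    by (auto simp: in_set_conv_nth)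
  then show ?thesis using that crossed_nth[of i w "[]"] by simp
qed

lemma letter_weight_take_mono:
  assumes "i < j" "i < length w" "fst (w ! i) = v"
  shows "letter_weight v (take i w) + len v (snd (w ! i)) \<le> letter_weight v (take j w)"
proof -
  have "take j w = take i w @ drop i (take j w)" using assms
    by (metis append_take_drop_id less_imp_le min.absorb1 take_take)
  also have "drop i (take j w) = w ! i # drop (Suc i) (take j w)"
  proof (cases "i < length (take j w)")
    case True
    then show ?thesis using assms by (simp add: Cons_nth_drop_Suc[symmetric])
  qed (use assms in auto)
  finally have "take j w = take i w @ w ! i # drop (Suc i) (take j w)" .
  then have "letter_weight v (take j w) = letter_weight v (take i w @ w ! i # drop (Suc i) (take j w))" by simp
  also have "\<dots> \<ge> letter_weight v (take i w) + len v (snd (w ! i))" by (simp add: letter_weight_def assms)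
  finally show ?thesis .
qed

lemma interval_le_type_length:
  assumes "w \<in> words" "coord_length w k \<noteq> 0" "fst k \<in> V"
  shows "offset k + coord_length w k \<le> type_length (fst k) w"
proof -
  obtain w' where w': "reduced w'" "w \<doteq> w'" using reduced_exists[OF assms(1)] .
  have c: "coord_length w k = coord_length w' k" using coord_length_cong[OF w'(2) assms(3)] .
  with assms obtain i where i: "i < length w'" "fst (w' ! i) = fst k"
    "k = (fst k, hyperplane_at (fst k) (take i w'))" using coord_length_position[of w' k] by auto
  have "letter_weight (fst k) (take i w') + len (fst k) (snd (w' ! i)) \<le> letter_weight (fst k) (take (length w') w')"
    using i by (intro letter_weight_take_mono) auto
  then have "offset k + coord_length w' k \<le> letter_weight (fst k) w'"
    using reduced_position[OF w'(1) i(1,3,2)] by simp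
  then show ?thesis
    using c type_length_cong[OF w'(2) assms(3)] type_length_reduced[OF w'(1)] by simp
qed

lemma intervals_disjoint:
  assumes "w \<in> words" "coord_length w k \<noteq> 0" "coord_length w k' \<noteq> 0" "fst k \<in> V" "fst k' = fst k" "k \<noteq> k'"
  shows "offset k + coord_length w k \<le> offset k' \<or> offset k' + coord_length w k' \<le> offset k"
proof -
  obtain w' where w': "reduced w'" "w \<doteq> w'" using reduced_exists[OF assms(1)] .
  have c: "coord_length w k = coord_length w' k" "coord_length w k' = coord_length w' k'"
    using coord_length_cong[OF w'(2)] assms by auto
  obtain i where i: "i < length w'" "fst (w' ! i) = fst k" "k = (fst k, hyperplane_at (fst k) (take i w'))"
    using coord_length_position[of w' k] assms c by metis
  obtain j where j: "j < length w'" "fst (w' ! j) = fst k" "k' = (fst k, hyperplane_at (fst k) (take j w'))"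
    using coord_length_position[of w' k'] assms c by metis
  have "i < j \<or> j < i" using i(3) j(3) assms(6) by (metis nat_neq_iff)
  then show ?thesis
    using letter_weight_take_mono[of i j w' "fst k"] letter_weight_take_mono[of j i w' "fst k"] c i(1,2) j(1,2)
      reduced_position[OF w'(1) i(1,3,2)] reduced_position[OF w'(1) j(1,3,2)] by auto
qed

text \<open>After the path has reached the coset \<open>k'\<close> it does not cross the earlier hyperplane \<open>k\<close> again. So the
  coordinate at \<open>k\<close> can be read off from an element of \<open>k'\<close>.\<close>

lemma coord_at_later:
  assumes "w \<in> words" "coord_length w k \<noteq> 0" "coord_length w k' \<noteq> 0" "fst k \<in> V" "fst k' = fst k" "offset k < offset k'"
  obtains p where "p \<in> words" "k' = (fst k, hyperplane_at (fst k) p)" "coord k [] w = coord k [] p"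
proof -
  obtain w' where w': "reduced w'" "w \<doteq> w'" using reduced_exists[OF assms(1)] .
  have c: "coord_length w k = coord_length w' k" "coord_length w k' = coord_length w' k'"
    using coord_length_cong[OF w'(2)] assms by auto
  obtain i where i: "i < length w'" "fst (w' ! i) = fst k" "k = (fst k, hyperplane_at (fst k) (take i w'))"
    using coord_length_position[of w' k] assms c by metis
  obtain j where j: "j < length w'" "fst (w' ! j) = fst k" "k' = (fst k, hyperplane_at (fst k) (take j w'))"
    using coord_length_position[of w' k'] assms c by metis
  have "i < j"
  proof (rule ccontr)
    assume "\<not> i < j"
    moreover have "i \<noteq> j" using i(3) j(3) assms(6) by auto
    ultimately have "letter_weight (fst k) (take j w') \<le> letter_weight (fst k) (take i w')"
      using letter_weight_take_mono[of j i w' "fst k"] i j by auto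
    then show False
      using assms(6) reduced_position(2)[OF w'(1) i(1,3,2)] reduced_position(2)[OF w'(1) j(1,3,2)]
      by simp
  qed
  then have "coord k [] w' = coord k [] (take j w')"
    using reduced_coord_after[OF w'(1) _ i(1), of j k] i by auto
  moreover have "coord k [] w = coord k [] w'" using coord_cong[OF w'(2)] assms by simp
  ultimately show ?thesis using that[of "take j w'"] j(3) reduced_words[OF w'(1)] by simp
qed

text \<open>Of two hyperplanes of one type crossed on the way to both \<open>x\<close> and \<open>y\<close>, the one with the smaller
  offset, say \<open>k\<close>, comes first on both ways. By \<open>coord_at_later\<close> the coordinates of \<open>x\<close> and of \<open>y\<close>
  at \<open>k\<close> are those of two elements of the coset \<open>k'\<close>, and coordinates at other hyperplanes of the same
  type are constant on that coset.\<close>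

lemma branching_unique:
  assumes xy: "x \<in> words" "y \<in> words" and v: "v \<in> V" "fst k = v" "fst k' = v" and "k \<noteq> k'"
    and nz: "coord_length x k \<noteq> 0" "coord_length y k \<noteq> 0" "coord_length x k' \<noteq> 0" "coord_length y k' \<noteq> 0"
  shows "coord k [] x = coord k [] y \<or> coord k' [] x = coord k' [] y"
proof -
  have *: "coord k [] x = coord k [] y"
    if v: "fst k = v" "fst k' = v" "k \<noteq> k'" and nz: "coord_length x k \<noteq> 0" "coord_length y k \<noteq> 0" "coord_length x k' \<noteq> 0" "coord_length y k' \<noteq> 0"
      and lt: "offset k < offset k'" for k k'
  proof -
    obtain p where p: "p \<in> words" "k' = (fst k, hyperplane_at (fst k) p)" "coord k [] x = coord k [] p"
      using coord_at_later[of x k k'] xy nz lt v \<open>v \<in> V\<close> by metis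
    obtain q where q: "q \<in> words" "k' = (fst k, hyperplane_at (fst k) q)" "coord k [] y = coord k [] q"
      using coord_at_later[of y k k'] xy nz lt v \<open>v \<in> V\<close> by metis
    have "q \<in> hyperplane_at v p" using hyperplane_at_self[OF q(1), of v] p(2) q(2) v by simp
    then have "coord k [] q = coord k [] p"
      using p v \<open>v \<in> V\<close> by (intro coord_hyperplane) auto
    then show ?thesis using p q by simp
  qed
  have "offset k < offset k' \<or> offset k' < offset k"
    using intervals_disjoint[OF xy(1) nz(1,3)] nz v \<open>k \<noteq> k'\<close> by auto
  then show ?thesis using *[of k k'] *[of k' k] assms by blast
qed

section \<open>Weighted profiles\<close>

text \<open>Point \<open>j\<close> of the interval of \<open>k\<close> carries the weight of its distance from the right end of the tiling.
  Points of the interval have distance at least \<open>1\<close>, so the value \<open>W 0 = 0\<close> fits the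
  absence of a point just beyond the right end.\<close>

definition profile :: "(nat \<Rightarrow> real) \<Rightarrow> ('v \<times> 'a) list \<Rightarrow> ('v \<times> ('v \<times> 'a) list set) \<Rightarrow> nat \<Rightarrow> real" where
  "profile W w k j = (if j < coord_length w k then W (type_length (fst k) w - (offset k + j)) else 0)"

text \<open>The intervals of the tiling are disjoint and end at \<open>type_length v w\<close> or before, so the truncated
  subtraction is exact and distances from the right end determine the point.\<close>

lemma position_inj:
  assumes "w \<in> words" "v \<in> V"
  shows "inj_on (\<lambda>(k, j). type_length v w - (offset k + j)) {(k, j). fst k = v \<and> j < coord_length w k}"
proof (rule inj_onI)
  fix s t assume st: "s \<in> {(k, j). fst k = v \<and> j < coord_length w k}" "t \<in> {(k, j). fst k = v \<and> j < coord_length w k}"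
    and eq: "(\<lambda>(k, j). type_length v w - (offset k + j)) s = (\<lambda>(k, j). type_length v w - (offset k + j)) t"
  obtain k i k' j where [simp]: "s = (k, i)" "t = (k', j)" by fastforce
  have k: "fst k = v" "fst k' = v" "i < coord_length w k" "j < coord_length w k'" using st by auto
  have "offset k + coord_length w k \<le> type_length v w" "offset k' + coord_length w k' \<le> type_length v w"
    using k interval_le_type_length[OF assms(1), of k] interval_le_type_length[OF assms(1), of k'] assms(2)
    by auto
  then have eq': "offset k + i = offset k' + j" using eq k by simp
  have "k = k'"
  proof (rule ccontr)
    assume "k \<noteq> k'"
    then show False
      using intervals_disjoint[OF assms(1), of k k'] k assms(2) eq' by auto
  qed
  then show "s = t" using eq' by simp
qed

lemma sum_positions:
  assumes "w \<in> words" "v \<in> V" "finite B" "\<And>k. k \<in> B \<Longrightarrow> fst k = v"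
  obtains D where "finite D" "0 \<notin> D" "card D = (\<Sum>k\<in>B. coord_length w k)"
    "\<And>F :: nat \<Rightarrow> real. (\<Sum>k\<in>B. \<Sum>j<coord_length w k. F (type_length v w - (offset k + j))) = (\<Sum>d\<in>D. F d)"
proof -
  let ?S = "SIGMA k:B. {..<coord_length w k}"
  let ?f = "\<lambda>(k, j). type_length v w - (offset k + j)"
  have inj: "inj_on ?f ?S"
    by (rule inj_on_subset[OF position_inj[OF assms(1,2)]]) (use assms(4) in auto)
  have "0 \<notin> ?f ` ?S"
  proof
    assume "0 \<in> ?f ` ?S"
    then obtain k j where "k \<in> B" "j < coord_length w k" "0 = type_length v w - (offset k + j)" by auto
    moreover from this have "offset k + coord_length w k \<le> type_length v w"
      using interval_le_type_length[OF assms(1), of k] assms by auto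
    ultimately show False by auto
  qed
  moreover have "card (?f ` ?S) = (\<Sum>k\<in>B. coord_length w k)"
    using assms(3) by (simp add: card_image[OF inj] card_SigmaI)
  moreover have "(\<Sum>k\<in>B. \<Sum>j<coord_length w k. F (type_length v w - (offset k + j))) = (\<Sum>d\<in>?f ` ?S. F d)" for F :: "nat \<Rightarrow> real"
    unfolding sum.reindex[OF inj] using assms(3)
    by (subst sum.Sigma) (auto intro!: sum.cong simp: case_prod_unfold)
  moreover have "finite (?f ` ?S)" using assms(3) by auto
  ultimately show ?thesis using that by blast
qed

lemma coord_append_letter:
  assumes "w \<in> words" "x \<in> V" "g \<in> carrier (G x)" "fst k \<in> V"
  shows "coord k [] (w @ [(x, g)]) =
    (if k = (x, hyperplane_at x w) then coord k [] w \<otimes>\<^bsub>G x\<^esub> g else coord k [] w)"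
proof -
  interpret group "G x" using assms(2) by (rule group_vertex)
  interpret k: group "G (fst k)" using assms(4) by (rule group_vertex)
  show ?thesis
    using coord_append[of w "[(x, g)]" k "[]"] coord_closed[of w k "[]"] assms by auto
qed

text \<open>Passing from \<open>y\<close> to \<open>z\<close> appends one point to the tiling of type \<open>v\<close> at its right end. All other points
  of this type get one step farther from the end, and the new point changes the value from \<open>W 0\<close> to
  \<open>W 1\<close>. Hence the differences are increments of \<open>W\<close>, each taken at most once.\<close>

lemma profile_step:
  assumes y: "y \<in> words" and z: "z \<in> words" and v: "v \<in> V"
    and same: "hyperplane_at v y = hyperplane_at v z"
    and other: "\<And>k. fst k \<in> V \<Longrightarrow> k \<noteq> (v, hyperplane_at v y) \<Longrightarrow> coord_length y k = coord_length z k"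
    and here: "coord_length z (v, hyperplane_at v y) = Suc (coord_length y (v, hyperplane_at v y))"
    and W0: "W 0 = 0"
    and B: "\<And>n. (\<Sum>d<n. \<bar>W (Suc d) - W d\<bar> powr p) \<le> B"
    and F: "finite F" "\<And>k j. (k, j) \<in> F \<Longrightarrow> fst k \<in> V"
  shows "(\<Sum>(k, j)\<in>F. \<bar>profile W z k j - profile W y k j\<bar> powr p) \<le> B"
proof -
  let ?k = "(v, hyperplane_at v y)"
  have type_v: "type_length v z = Suc (type_length v y)"
    using type_length_split[OF y v] type_length_split[OF z v] same here by simp
  have type_u: "type_length u z = type_length u y" if "u \<in> V" "u \<noteq> v" for u
    unfolding type_length_def using that by (intro sum.cong) (auto simp: other)
  let ?S = "{(k, j). fst k = v \<and> j < coord_length z k}"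
  let ?f = "\<lambda>(k, j). type_length v z - (offset k + j)"
  have out: "profile W z k j - profile W y k j = 0" if "fst k \<in> V" "(k, j) \<notin> ?S" for k j
  proof (cases "fst k = v")
    case True
    then have "\<not> j < coord_length z k" using that by simp
    moreover have "coord_length y k \<le> coord_length z k" using other[OF that(1)] here by (cases "k = ?k") auto
    ultimately show ?thesis by (simp add: profile_def)
  next
    case False
    then have "k \<noteq> ?k" by auto
    then have "coord_length y k = coord_length z k" using other[OF that(1)] by simp
    then show ?thesis using type_u[of "fst k"] False that by (simp add: profile_def)
  qed
  have ins: "profile W z k j - profile W y k j = W (?f (k, j)) - W (?f (k, j) - 1) \<and> ?f (k, j) \<noteq> 0"
    if "(k, j) \<in> ?S" for k j
  proof -
    have k: "fst k = v" "j < coord_length z k" using that by auto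
    have le: "offset k + coord_length z k \<le> type_length v z" using interval_le_type_length[OF z, of k] k v by auto
    have "profile W y k j = W (type_length v z - (offset k + j) - 1)"
    proof (cases "k = ?k \<and> j = coord_length y ?k")
      case True
      then have "type_length v z = offset k + coord_length z k" using type_length_split[OF z v] same by simp
      then have "type_length v z - (offset k + j) - 1 = 0" using True here by simp
      moreover have "profile W y k j = 0" using True by (simp add: profile_def)
      ultimately show ?thesis using W0 by simp
    next
      case False
      then have "j < coord_length y k" using k other[of k] here v by (cases "k = ?k") auto
      then show ?thesis using type_v k by (simp add: profile_def)
    qed
    then show ?thesis using k le by (simp add: profile_def)
  qed
  have "(\<Sum>(k, j)\<in>F. \<bar>profile W z k j - profile W y k j\<bar> powr p)
      = (\<Sum>(k, j)\<in>F \<inter> ?S. \<bar>profile W z k j - profile W y k j\<bar> powr p)"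
  proof (rule sum.mono_neutral_right[OF F(1)])
    show "\<forall>i\<in>F - F \<inter> ?S. (case i of (k, j) \<Rightarrow> \<bar>profile W z k j - profile W y k j\<bar> powr p) = 0"
    proof
      fix s assume s: "s \<in> F - F \<inter> ?S"
      obtain k j where kj: "s = (k, j)" by (cases s)
      then have "fst k \<in> V" "(k, j) \<notin> ?S" using s F(2)[of k j] by blast+
      from out[OF this] kj
      show "(case s of (k, j) \<Rightarrow> \<bar>profile W z k j - profile W y k j\<bar> powr p) = 0" by simp
    qed
  qed auto
  also have "\<dots> = (\<Sum>s\<in>F \<inter> ?S. \<bar>W (Suc (?f s - 1)) - W (?f s - 1)\<bar> powr p)"
  proof (rule sum.cong[OF HOL.refl])
    fix s assume s: "s \<in> F \<inter> ?S"
    obtain k j where kj: "s = (k, j)" by (cases s)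
    then have "(k, j) \<in> ?S" using s by blast
    note ins[OF this]
    moreover from this have "Suc (?f (k, j) - 1) = ?f (k, j)" by linarith
    ultimately show "(case s of (k, j) \<Rightarrow> \<bar>profile W z k j - profile W y k j\<bar> powr p)
        = \<bar>W (Suc (?f s - 1)) - W (?f s - 1)\<bar> powr p" by (simp only: kj prod.case)
  qed
  also have "\<dots> = (\<Sum>d\<in>(\<lambda>s. ?f s - 1) ` (F \<inter> ?S). \<bar>W (Suc d) - W d\<bar> powr p)"
  proof (subst sum.reindex)
    have inj: "inj_on ?f ?S" by (rule position_inj[OF z v])
    show "inj_on (\<lambda>s. ?f s - 1) (F \<inter> ?S)"
    proof (rule inj_onI)
      fix s t assume st: "s \<in> F \<inter> ?S" "t \<in> F \<inter> ?S" "?f s - 1 = ?f t - 1"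
      have "?f s \<noteq> 0" "?f t \<noteq> 0" using st(1,2) ins by blast+
      then have "?f s = ?f t" using st(3) by linarith
      then show "s = t" using inj_onD[OF inj] st by blast
    qed
  qed simp
  also have "\<dots> \<le> (\<Sum>d<Suc (Max (insert 0 ((\<lambda>s. ?f s - 1) ` (F \<inter> ?S)))). \<bar>W (Suc d) - W d\<bar> powr p)"
  proof (rule sum_mono2)
    show "(\<lambda>s. ?f s - 1) ` (F \<inter> ?S) \<subseteq> {..<Suc (Max (insert 0 ((\<lambda>s. ?f s - 1) ` (F \<inter> ?S))))}"
    proof
      fix d assume "d \<in> (\<lambda>s. ?f s - 1) ` (F \<inter> ?S)"
      then have "d \<le> Max (insert 0 ((\<lambda>s. ?f s - 1) ` (F \<inter> ?S)))" using F(1) by (intro Max_ge) blast+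
      then show "d \<in> {..<Suc (Max (insert 0 ((\<lambda>s. ?f s - 1) ` (F \<inter> ?S))))}" by simp
    qed
  qed auto
  also have "\<dots> \<le> B" by (rule B)
  finally show ?thesis .
qed

section \<open>The word metric of the graph product\<close>

abbreviation "P \<equiv> graph_product V E G"
abbreviation "gens \<equiv> (\<Union>v\<in>V. gp_incl V E G v ` X v)"
abbreviation "cls w \<equiv> gp_class V E G w"

lemma group_P: "group P" using group_graph_product[of V G E] group_vertex by blast

lemma carrier_P: "carrier P = cls ` words" by (simp add: graph_product_def)

lemma one_P: "\<one>\<^bsub>P\<^esub> = cls []" by (simp add: graph_product_def)

lemma mult_P: "a \<in> words \<Longrightarrow> b \<in> words \<Longrightarrow> cls a \<otimes>\<^bsub>P\<^esub> cls b = cls (a @ b)"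
  using gp_mult_class[of V G a b E] group_vertex by blast

lemma cls_eq_iff: "a \<in> words \<Longrightarrow> cls a = cls b \<longleftrightarrow> a \<doteq> b"
  using gp_class_eq_iff[of V G a E b] group_vertex by blast

lemma incl_group_hom: "v \<in> V \<Longrightarrow> group_hom (G v) P (gp_incl V E G v)"
  using gp_incl_hom[of V G v E] group_vertex group_P
  by (auto simp: group_hom_def group_hom_axioms_def)

lemma letter_expansion:
  assumes v: "v \<in> V" and g: "g \<in> carrier (G v)"
  shows "\<exists>ys. set ys \<subseteq> gens \<union> m_inv P ` gens \<and> foldr (\<otimes>\<^bsub>P\<^esub>) ys \<one>\<^bsub>P\<^esub> = cls [(v, g)] \<and> length ys = len v g"
proof -
  interpret group "G v" by (rule group_vertex[OF v])
  interpret h: group_hom "G v" P "gp_incl V E G v" by (rule incl_group_hom[OF v])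
  obtain xs where xs: "length xs = len v g" "set xs \<subseteq> X v \<union> m_inv (G v) ` X v"
      "foldr (\<otimes>\<^bsub>G v\<^esub>) xs \<one>\<^bsub>G v\<^esub> = g"
    using geodesic_word_exists[OF generates_vertex[OF v] g] by blast
  have Xc: "X v \<subseteq> carrier (G v)" using generates_vertex[OF v] by (simp add: generates_def)
  have xsc: "set xs \<subseteq> carrier (G v)"
    using xs(2) symmetric_generators_closed[OF generates_vertex[OF v]] by blast
  then have fold: "foldr (\<otimes>\<^bsub>P\<^esub>) (map (gp_incl V E G v) xs) \<one>\<^bsub>P\<^esub>
      = gp_incl V E G v (foldr (\<otimes>\<^bsub>G v\<^esub>) xs \<one>\<^bsub>G v\<^esub>)"
    by (induction xs) (auto simp: foldr_mult_closed)
  have "gp_incl V E G v a \<in> gens \<union> m_inv P ` gens" if "a \<in> set xs" for a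
  proof -
    from that xs(2) consider "a \<in> X v" | b where "b \<in> X v" "a = inv\<^bsub>G v\<^esub> b" by blast
    then show ?thesis
    proof cases
      case 1
      then show ?thesis using v by blast
    next
      case 2
      then have "gp_incl V E G v a = inv\<^bsub>P\<^esub> gp_incl V E G v b" using Xc by auto
      then show ?thesis using 2 v by blast
    qed
  qed
  then have "set (map (gp_incl V E G v) xs) \<subseteq> gens \<union> m_inv P ` gens"
    unfolding set_map image_subset_iff by blast
  moreover have "foldr (\<otimes>\<^bsub>P\<^esub>) (map (gp_incl V E G v) xs) \<one>\<^bsub>P\<^esub> = cls [(v, g)]"
    using fold xs(3) by (simp add: gp_incl_def)
  moreover have "length (map (gp_incl V E G v) xs) = len v g" by (simp add: xs(1))
  ultimately show ?thesis by (intro exI conjI)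
qed

lemma gens_closed: "gens \<union> m_inv P ` gens \<subseteq> carrier P"
proof -
  interpret P: group P by (rule group_P)
  have "gp_incl V E G v a \<in> carrier P" if "v \<in> V" "a \<in> X v" for v a
    using that generates_vertex[OF that(1)] by (auto simp: gp_incl_def carrier_P generates_def)
  then show ?thesis by auto
qed

text \<open>Replacing every letter by a geodesic word in its vertex group bounds the length in the graph
  product by the total length of the letters.\<close>

lemma word_expansion:
  assumes "w \<in> words"
  shows "\<exists>ys. set ys \<subseteq> gens \<union> m_inv P ` gens \<and> foldr (\<otimes>\<^bsub>P\<^esub>) ys \<one>\<^bsub>P\<^esub> = cls w \<and>
    length ys = (\<Sum>x\<leftarrow>w. len (fst x) (snd x))"
  using assms
proof (induction w)
  case Nil
  show ?case by (rule exI[of _ "[]"]) (simp add: one_P)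
next
  case (Cons x w)
  interpret P: group P by (rule group_P)
  have x: "fst x \<in> V" "snd x \<in> carrier (G (fst x))" and w: "w \<in> words" using Cons.prems by auto
  from Cons.IH[OF w] obtain ys where ys: "set ys \<subseteq> gens \<union> m_inv P ` gens"
    "foldr (\<otimes>\<^bsub>P\<^esub>) ys \<one>\<^bsub>P\<^esub> = cls w" "length ys = (\<Sum>x\<leftarrow>w. len (fst x) (snd x))" by blast
  from letter_expansion[OF x] obtain zs where zs: "set zs \<subseteq> gens \<union> m_inv P ` gens"
    "foldr (\<otimes>\<^bsub>P\<^esub>) zs \<one>\<^bsub>P\<^esub> = cls [x]" "length zs = len (fst x) (snd x)" by auto
  have "foldr (\<otimes>\<^bsub>P\<^esub>) (zs @ ys) \<one>\<^bsub>P\<^esub> = cls [x] \<otimes>\<^bsub>P\<^esub> cls w"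
    using P.foldr_mult_append[OF subset_trans[OF zs(1) gens_closed] subset_trans[OF ys(1) gens_closed]]
      ys(2) zs(2) by (simp del: foldr_append)
  also have "\<dots> = cls (x # w)" using mult_P[of "[x]" w] x w by simp
  finally have "foldr (\<otimes>\<^bsub>P\<^esub>) (zs @ ys) \<one>\<^bsub>P\<^esub> = cls (x # w)" .
  moreover have "set (zs @ ys) \<subseteq> gens \<union> m_inv P ` gens" using ys(1) zs(1) by (simp only: set_append Un_subset_iff)
  moreover have "length (zs @ ys) = (\<Sum>x\<leftarrow>x # w. len (fst x) (snd x))" using ys(3) zs(3) by simp
  ultimately show ?case by (intro exI conjI)
qed

definition generator_letter :: "'v \<times> 'a \<Rightarrow> bool" where
  "generator_letter x \<longleftrightarrow> fst x \<in> V \<and> snd x \<in> X (fst x) \<union> m_inv (G (fst x)) ` X (fst x)"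

lemma generator_letter_carrier:
  assumes "generator_letter x" shows "fst x \<in> V" "snd x \<in> carrier (G (fst x))"
proof -
  show v: "fst x \<in> V" using assms by (simp add: generator_letter_def)
  show "snd x \<in> carrier (G (fst x))"
    using assms group.symmetric_generators_closed[OF group_vertex[OF v] generates_vertex[OF v]]
    by (auto simp: generator_letter_def)
qed

lemma generator_letters_words:
  assumes "\<And>a. a \<in> set as \<Longrightarrow> generator_letter a"
  shows "as \<in> words"
proof -
  have "a \<in> (SIGMA v:V. carrier (G v))" if "a \<in> set as" for a
    using generator_letter_carrier[OF assms[OF that]] by (cases a) auto
  then show ?thesis by (auto simp: gp_words_def)
qed

lemma generator_of_P:
  assumes "a \<in> gens \<union> m_inv P ` gens"
  shows "\<exists>x. generator_letter x \<and> a = cls [x]"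
proof -
  from assms consider v g where "v \<in> V" "g \<in> X v" "a = gp_incl V E G v g"
    | v g where "v \<in> V" "g \<in> X v" "a = inv\<^bsub>P\<^esub> gp_incl V E G v g" by blast
  then show ?thesis
  proof cases
    case 1
    then show ?thesis by (intro exI[of _ "(v, g)"]) (auto simp: generator_letter_def gp_incl_def)
  next
    case 2
    interpret h: group_hom "G v" P "gp_incl V E G v" by (rule incl_group_hom[OF 2(1)])
    have "g \<in> carrier (G v)" using 2 generates_vertex[OF 2(1)] by (auto simp: generates_def)
    then have "a = gp_incl V E G v (inv\<^bsub>G v\<^esub> g)" using 2 by simp
    then show ?thesis using 2
      by (intro exI[of _ "(v, inv\<^bsub>G v\<^esub> g)"]) (auto simp: generator_letter_def gp_incl_def)
  qed
qed

lemma inv_P: "x \<in> words \<Longrightarrow> inv\<^bsub>P\<^esub> (cls x) = cls (inv_word x)"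
proof -
  interpret P: group P by (rule group_P)
  assume x: "x \<in> words"
  have "cls (inv_word x) \<otimes>\<^bsub>P\<^esub> cls x = \<one>\<^bsub>P\<^esub>"
    using x cong_inv_left[OF x] by (simp add: mult_P one_P cls_eq_iff)
  then show ?thesis using x by (intro P.inv_equality) (auto simp: carrier_P)
qed

lemma geodesic_path:
  assumes x: "x \<in> words" and y: "y \<in> words"
  obtains as where "length as = word_dist P gens (cls x) (cls y)"
    "\<And>a. a \<in> set as \<Longrightarrow> generator_letter a" "cls y = cls (x @ as)"
proof -
  interpret P: group P by (rule group_P)
  let ?g = "inv\<^bsub>P\<^esub> (cls x) \<otimes>\<^bsub>P\<^esub> cls y"
  have g: "?g = cls (inv_word x @ y)" using x y by (simp add: inv_P mult_P)
  obtain zs where "set zs \<subseteq> gens \<union> m_inv P ` gens" "foldr (\<otimes>\<^bsub>P\<^esub>) zs \<one>\<^bsub>P\<^esub> = ?g"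
    using word_expansion[of "inv_word x @ y"] x y g by auto
  then obtain ys where ys: "length ys = word_length P gens ?g" "set ys \<subseteq> gens \<union> m_inv P ` gens"
      "foldr (\<otimes>\<^bsub>P\<^esub>) ys \<one>\<^bsub>P\<^esub> = ?g"
    by (rule word_length_attained)
  have "\<exists>as. length as = length ys \<and> (\<forall>a\<in>set as. generator_letter a) \<and>
      foldr (\<otimes>\<^bsub>P\<^esub>) ys \<one>\<^bsub>P\<^esub> = cls as"
    using ys(2)
  proof (induction ys)
    case Nil
    then show ?case by (simp add: one_P)
  next
    case (Cons b ys)
    then obtain as where as: "length as = length ys" "\<forall>a\<in>set as. generator_letter a"
      "foldr (\<otimes>\<^bsub>P\<^esub>) ys \<one>\<^bsub>P\<^esub> = cls as" by auto
    have "b \<in> gens \<union> m_inv P ` gens" using Cons.prems by simp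
    from generator_of_P[OF this] obtain a where a: "generator_letter a" "b = cls [a]" by blast
    have "as \<in> words" using as(2) by (intro generator_letters_words) blast
    then have "cls [a] \<otimes>\<^bsub>P\<^esub> cls as = cls (a # as)"
      using mult_P[of "[a]" as] generator_letter_carrier[OF a(1)] by simp
    then show ?case using a as by (intro exI[of _ "a # as"]) auto
  qed
  then obtain as where as: "length as = length ys" "\<forall>a\<in>set as. generator_letter a" "?g = cls as"
    using ys(3) by auto
  have asw: "as \<in> words" using as(2) by (intro generator_letters_words) blast
  have "cls x \<in> carrier P" "cls y \<in> carrier P" using x y unfolding carrier_P by blast+
  then have "cls y = cls x \<otimes>\<^bsub>P\<^esub> ?g" by (simp add: P.m_assoc[symmetric])
  then have "cls y = cls (x @ as)" using as(3) mult_P[OF x asw] by simp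
  moreover have "length as = word_dist P gens (cls x) (cls y)"
    unfolding word_dist_def using as(1) ys(1) by (rule HOL.trans)
  ultimately show ?thesis using that as(2) by blast
qed

definition hyperplanes :: "('v \<times> ('v \<times> 'a) list set) set" where
  "hyperplanes = {(v, hyperplane_at v p) | v p. v \<in> V \<and> p \<in> words}"

lemma hyperplanes_V: "k \<in> hyperplanes \<Longrightarrow> fst k \<in> V" by (auto simp: hyperplanes_def)

lemma crossed_hyperplanes: "p \<in> words \<Longrightarrow> w \<in> words \<Longrightarrow> set (crossed p w) \<subseteq> hyperplanes"
proof (induction w arbitrary: p)
  case (Cons x w)
  then have "set (crossed (p @ [x]) w) \<subseteq> hyperplanes" by (intro Cons.IH) auto
  then show ?case using Cons.prems by (auto simp: hyperplanes_def)
qed simp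

abbreviation coord_dist :: "('v \<times> 'a) list \<Rightarrow> ('v \<times> 'a) list \<Rightarrow> ('v \<times> ('v \<times> 'a) list set) \<Rightarrow> nat" where
  "coord_dist x y k \<equiv> word_dist (G (fst k)) (X (fst k)) (coord k [] x) (coord k [] y)"

text \<open>A reduced word from \<open>x\<close> to \<open>y\<close> crosses each hyperplane at most once, and its letters are the quotients
  of the coordinates of \<open>x\<close> and \<open>y\<close>.\<close>

lemma dist_le_sum_coord_dist:
  assumes x: "x \<in> words" and y: "y \<in> words"
  obtains K where "finite K" "K \<subseteq> hyperplanes"
    "word_dist P gens (cls x) (cls y) \<le> (\<Sum>k\<in>K. coord_dist x y k)"
proof -
  interpret P: group P by (rule group_P)
  obtain w where w: "reduced w" "inv_word x @ y \<doteq> w"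
    using reduced_exists[of "inv_word x @ y"] x y by auto
  have ww: "w \<in> words" using w reduced_words by blast
  have "x @ inv_word x @ y \<doteq> [] @ y"
    using cong_append[OF cong_inv_right[OF x] cong_refl[OF y]] by simp
  moreover have "x @ inv_word x @ y \<doteq> x @ w" using cong_append[OF cong_refl[OF x] w(2)] .
  ultimately have yx: "y \<doteq> x @ w" using cong_sym cong_trans by (metis append_Nil)
  let ?K = "set (crossed x w)"
  have g: "inv\<^bsub>P\<^esub> (cls x) \<otimes>\<^bsub>P\<^esub> cls y = cls w"
    using x y w(2) by (simp add: inv_P mult_P cls_eq_iff)
  obtain ys where "set ys \<subseteq> gens \<union> m_inv P ` gens" "foldr (\<otimes>\<^bsub>P\<^esub>) ys \<one>\<^bsub>P\<^esub> = cls w"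
    "length ys = (\<Sum>x\<leftarrow>w. len (fst x) (snd x))" using word_expansion[OF ww] by auto
  then have "word_dist P gens (cls x) (cls y) \<le> (\<Sum>x\<leftarrow>w. len (fst x) (snd x))"
    unfolding word_dist_def g using P.word_length_le[of ys gens "cls w"] by simp
  also have "\<dots> = (\<Sum>k\<in>?K. len (fst k) (coord k x w))"
    using coord_reduced_sum[OF reduced_distinct_crossed[OF w(1) x] ww, of UNIV] by simp
  also have "\<dots> = (\<Sum>k\<in>?K. coord_dist x y k)"
  proof (rule sum.cong[OF HOL.refl])
    fix k assume "k \<in> ?K"
    then have k: "fst k \<in> V" using crossed_fst_V[OF ww] by blast
    interpret group "G (fst k)" by (rule group_vertex[OF k])
    have "coord k [] y = coord k [] x \<otimes>\<^bsub>G (fst k)\<^esub> coord k x w"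
      using coord_cong[OF yx, of "[]" k] coord_append[OF x ww k, of "[]"] k by simp
    then show "len (fst k) (coord k x w) = coord_dist x y k"
      using coord_closed[OF x k, of "[]"] coord_closed[OF ww k, of x]
      by (simp add: word_dist_def m_assoc[symmetric])
  qed
  finally show ?thesis using that[of ?K] crossed_hyperplanes[OF x ww] by simp
qed

lemma countable_hyperplanes:
  assumes "finite V" "\<And>v. v \<in> V \<Longrightarrow> finite (X v)"
  shows "countable hyperplanes"
proof -
  have "countable (carrier (G v))" if "v \<in> V" for v
    using group.countable_carrier_if_generated[OF group_vertex[OF that] generates_vertex[OF that]]
      assms(2)[OF that] by (simp add: countable_finite)
  then have "countable words"
    unfolding gp_words_def using countable_finite[OF assms(1)] by (intro countable_lists countable_SIGMA)
  then have "countable ((\<lambda>(v, p). (v, hyperplane_at v p)) ` (V \<times> words))"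
    using countable_finite[OF assms(1)] by (intro countable_image countable_SIGMA)
  moreover have "hyperplanes \<subseteq> (\<lambda>(v, p). (v, hyperplane_at v p)) ` (V \<times> words)"
    by (auto simp: hyperplanes_def)
  ultimately show ?thesis by (rule countable_subset[rotated])
qed

lemma coord_dist_step:
  assumes "x \<in> words" "generator_letter a" "fst k \<in> V"
  shows "coord_dist (x @ [a]) x k \<le> (if k = (fst a, hyperplane_at (fst a) x) then 1 else 0)"
proof -
  note a = generator_letter_carrier[OF assms(2)]
  interpret group "G (fst k)" by (rule group_vertex[OF assms(3)])
  have c: "coord k [] (x @ [a]) = (if k = (fst a, hyperplane_at (fst a) x)
      then coord k [] x \<otimes>\<^bsub>G (fst k)\<^esub> snd a else coord k [] x)"
    using coord_append_letter[OF assms(1) a assms(3)] by auto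
  have cl: "coord k [] x \<in> carrier (G (fst k))" using coord_closed assms by simp
  show ?thesis
  proof (cases "k = (fst a, hyperplane_at (fst a) x)")
    case True
    then have k: "fst k = fst a" by simp
    have sa: "snd a \<in> carrier (G (fst k))" using a k by simp
    have "inv\<^bsub>G (fst k)\<^esub> (coord k [] x \<otimes>\<^bsub>G (fst k)\<^esub> snd a) \<otimes>\<^bsub>G (fst k)\<^esub> coord k [] x
        = inv\<^bsub>G (fst k)\<^esub> snd a"
      using cl sa by (simp add: inv_mult_group m_assoc)
    moreover have "len (fst k) (inv\<^bsub>G (fst k)\<^esub> snd a) \<le> 1"
      using word_length_inv[OF generates_vertex[OF assms(3)] sa] assms(2) k
        word_length_generator[OF generates_vertex[OF assms(3)], of "snd a"]
      by (simp add: generator_letter_def)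
    ultimately show ?thesis unfolding word_dist_def c using True by simp
  next
    case False
    then show ?thesis unfolding word_dist_def c using cl by simp
  qed
qed

lemma coord_length_step:
  assumes "x \<in> words" "generator_letter a"
  shows "coord_length (x @ [a]) (fst a, hyperplane_at (fst a) x) \<le> Suc (coord_length x (fst a, hyperplane_at (fst a) x))"
    and "coord_length x (fst a, hyperplane_at (fst a) x) \<le> Suc (coord_length (x @ [a]) (fst a, hyperplane_at (fst a) x))"
proof -
  note a = generator_letter_carrier[OF assms(2)]
  let ?k = "(fst a, hyperplane_at (fst a) x)"
  let ?c = "coord ?k [] x"
  interpret group "G (fst a)" by (rule group_vertex[OF a(1)])
  note gen = generates_vertex[OF a(1)]
  have c: "coord ?k [] (x @ [a]) = ?c \<otimes>\<^bsub>G (fst a)\<^esub> snd a"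
    using coord_append_letter[OF assms(1) a, of ?k] a by simp
  have cl: "?c \<in> carrier (G (fst a))" using coord_closed[of x ?k] assms a by simp
  have l: "len (fst a) (snd a) \<le> 1" "len (fst a) (inv\<^bsub>G (fst a)\<^esub> snd a) \<le> 1"
    using word_length_inv[OF gen a(2)] assms(2) word_length_generator[OF gen, of "snd a"]
    by (simp_all add: generator_letter_def)
  show "coord_length (x @ [a]) ?k \<le> Suc (coord_length x ?k)"
    using word_length_mult_le[OF gen cl a(2)] l by (simp add: coord_length_def c)
  have "?c = (?c \<otimes>\<^bsub>G (fst a)\<^esub> snd a) \<otimes>\<^bsub>G (fst a)\<^esub> inv\<^bsub>G (fst a)\<^esub> snd a"
    using cl a by (simp add: m_assoc)
  then have "len (fst a) ?c \<le> len (fst a) (?c \<otimes>\<^bsub>G (fst a)\<^esub> snd a) + len (fst a) (inv\<^bsub>G (fst a)\<^esub> snd a)"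
    using word_length_mult_le[OF gen, of "?c \<otimes>\<^bsub>G (fst a)\<^esub> snd a" "inv\<^bsub>G (fst a)\<^esub> snd a"] cl a by simp
  then show "coord_length x ?k \<le> Suc (coord_length (x @ [a]) ?k)"
    using l by (simp add: coord_length_def c)
qed

lemma profile_step_letter:
  assumes x: "x \<in> words" and a: "generator_letter a" and W0: "W 0 = 0"
    and B: "\<And>n. (\<Sum>d<n. \<bar>W (Suc d) - W d\<bar> powr p) \<le> B"
    and F: "finite F" "\<And>k j. (k, j) \<in> F \<Longrightarrow> fst k \<in> V"
  shows "(\<Sum>(k, j)\<in>F. \<bar>profile W (x @ [a]) k j - profile W x k j\<bar> powr p) \<le> B"
proof -
  note ac = generator_letter_carrier[OF a]
  let ?v = "fst a" and ?z = "x @ [a]"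
  let ?k = "(?v, hyperplane_at ?v x)"
  have z: "?z \<in> words" using x ac by simp
  have same: "hyperplane_at ?v ?z = hyperplane_at ?v x" using x ac by (intro hyperplane_at_append_star) auto
  have other: "coord_length ?z k = coord_length x k" if "fst k \<in> V" "k \<noteq> ?k" for k
    using coord_append_letter[OF x ac that(1)] that by (simp add: coord_length_def)
  consider "coord_length ?z ?k = Suc (coord_length x ?k)" | "coord_length x ?k = Suc (coord_length ?z ?k)" | "coord_length ?z ?k = coord_length x ?k"
    using coord_length_step[OF x a] by linarith
  then show ?thesis
  proof cases
    case 1
    then show ?thesis using profile_step[OF x z ac(1) same[symmetric] _ _ W0 B F] other by simp
  next
    case 2
    have "(\<Sum>(k, j)\<in>F. \<bar>profile W x k j - profile W ?z k j\<bar> powr p) \<le> B"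
      using 2 other by (intro profile_step[OF z x ac(1) same _ _ W0 B F]) (auto simp: same)
    then show ?thesis by (simp add: abs_minus_commute)
  next
    case 3
    have eq: "coord_length ?z k = coord_length x k" if "fst k \<in> V" for k using other[OF that] 3 by (cases "k = ?k") auto
    then have "type_length u ?z = type_length u x" if "u \<in> V" for u
      unfolding type_length_def using that by (intro sum.cong) auto
    then have "\<bar>profile W ?z k j - profile W x k j\<bar> powr p = 0" if "(k, j) \<in> F" for k j
      using eq F(2)[OF that] by (simp add: profile_def)
    then have "(\<Sum>(k, j)\<in>F. \<bar>profile W ?z k j - profile W x k j\<bar> powr p) = 0"
      by (intro sum.neutral) auto
    then show ?thesis using B[of 0] by simp
  qed
qed

section \<open>Embedding the graph product\<close>

text \<open>The direct sum of \<open>f\<close> applied to all coordinates and of all profiles. The summand with index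
  \<open>(k, 0)\<close> is the coordinate at \<open>k\<close>, normalised to vanish at the identity so that supports are finite;
  the summand with index \<open>(k, Suc j)\<close> is point \<open>j\<close> of the profile at \<open>k\<close>, over a one-point measure space.
  The sum over \<open>K\<close> and \<open>{..<m}\<close> may be taken over any range that contains the supports.\<close>

lemma direct_sum_map:
  fixes M :: "'v \<Rightarrow> 'w measure" and f :: "'v \<Rightarrow> 'a \<Rightarrow> 'w \<Rightarrow> real"
  assumes p: "1 \<le> p" and fin: "finite V" "\<And>v. v \<in> V \<Longrightarrow> finite (X v)"
    and f: "\<And>v a. v \<in> V \<Longrightarrow> a \<in> carrier (G v) \<Longrightarrow> f v a \<in> Lp_space p (M v)"
  obtains N :: "(nat \<times> 'w) measure" and \<phi> where
    "\<And>c. c \<in> carrier P \<Longrightarrow> \<phi> c \<in> Lp_space p N"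
    "\<And>x y K m. x \<in> words \<Longrightarrow> y \<in> words \<Longrightarrow> finite K \<Longrightarrow> K \<subseteq> hyperplanes \<Longrightarrow>
      set (crossed [] x) \<union> set (crossed [] y) \<subseteq> K \<Longrightarrow> (\<And>k. k \<in> K \<Longrightarrow> coord_length x k \<le> m \<and> coord_length y k \<le> m) \<Longrightarrow>
      Lp_dist p N (\<phi> (cls x)) (\<phi> (cls y)) powr p =
        (\<Sum>k\<in>K. Lp_dist p (M (fst k)) (f (fst k) (coord k [] x)) (f (fst k) (coord k [] y)) powr p
          + (\<Sum>j<m. \<bar>profile W x k j - profile W y k j\<bar> powr p))"
proof -
  define I :: "(('v \<times> ('v \<times> 'a) list set) \<times> nat) set" where "I = hyperplanes \<times> UNIV"
  define M' :: "('v \<times> ('v \<times> 'a) list set) \<times> nat \<Rightarrow> 'w measure"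
    where "M' = (\<lambda>(k, j). case j of 0 \<Rightarrow> M (fst k) | Suc _ \<Rightarrow> count_space {undefined})"
  define \<psi> :: "('v \<times> 'a) list \<Rightarrow> ('v \<times> ('v \<times> 'a) list set) \<times> nat \<Rightarrow> 'w \<Rightarrow> real"
    where "\<psi> w = (\<lambda>(k, j). case j of
        0 \<Rightarrow> (\<lambda>t. f (fst k) (coord k [] w) t - f (fst k) \<one>\<^bsub>G (fst k)\<^esub> t)
      | Suc i \<Rightarrow> (\<lambda>_. profile W w k i))" for w
  \<comment> \<open>classes are evaluated at a representative; on the index set \<open>I\<close> its choice has no effect\<close>
  define rep where "rep c = (SOME w. w \<in> words \<and> cls w = c)" for c
  have rep: "rep c \<in> words" "cls (rep c) = c" if "c \<in> carrier P" for c
    using someI_ex[of "\<lambda>w. w \<in> words \<and> cls w = c"] that by (auto simp: rep_def carrier_P)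
  have \<psi>_rep: "\<psi> (rep (cls x)) i = \<psi> x i" if x: "x \<in> words" and i: "i \<in> I" for x i
  proof -
    have c: "cls x \<in> carrier P" using x by (simp add: carrier_P)
    have e: "rep (cls x) \<doteq> x" using rep[OF c] cls_eq_iff by blast
    obtain k j where kj: "i = (k, j)" "k \<in> hyperplanes" using i by (auto simp: I_def)
    have "coord k [] (rep (cls x)) = coord k [] x"
      using coord_cong[OF e, of "[]" k] hyperplanes_V[OF kj(2)] by simp
    moreover have "profile W (rep (cls x)) k = profile W x k"
      using coord_length_cong[OF e hyperplanes_V[OF kj(2)]] type_length_cong[OF e hyperplanes_V[OF kj(2)]]
      by (simp add: profile_def fun_eq_iff)
    ultimately show ?thesis by (simp add: \<psi>_def kj)
  qed
  have \<psi>_out: "\<psi> w (k, j) = (\<lambda>_. 0)" if "k \<notin> set (crossed [] w) \<or> coord_length w k < j" for w k j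
  proof (cases j)
    case 0
    then show ?thesis using that coord_eq_one[of k "[]" w] by (simp add: \<psi>_def)
  next
    case (Suc i)
    then have "\<not> i < coord_length w k" using that coord_length_support[of w k] by auto
    then show ?thesis by (simp add: \<psi>_def Suc profile_def)
  qed
  have I: "countable I"
    unfolding I_def using countable_hyperplanes[OF fin] by (intro countable_SIGMA) auto
  have Lp: "\<psi> (rep c) i \<in> Lp_space p (M' i)" if c: "c \<in> carrier P" and i: "i \<in> I" for c i
  proof -
    obtain k j where kj: "i = (k, j)" "k \<in> hyperplanes" using i by (auto simp: I_def)
    note k = hyperplanes_V[OF kj(2)]
    interpret group "G (fst k)" by (rule group_vertex[OF k])
    show ?thesis
    proof (cases j)
      case 0
      then show ?thesis
        using f[OF k] coord_closed[OF rep(1)[OF c] k] by (simp add: \<psi>_def M'_def kj Lp_space_diff[OF p])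
    next
      case (Suc n)
      then show ?thesis
        by (simp add: \<psi>_def M'_def kj Lp_space_def integrable_count_space)
    qed
  qed
  have fin_supp: "finite {i \<in> I. \<psi> (rep c) i \<noteq> (\<lambda>_. 0)}" if "c \<in> carrier P" for c
  proof (rule finite_subset)
    show "{i \<in> I. \<psi> (rep c) i \<noteq> (\<lambda>_. 0)} \<subseteq> (SIGMA k:set (crossed [] (rep c)). {..coord_length (rep c) k})"
    proof
      fix i assume i: "i \<in> {i \<in> I. \<psi> (rep c) i \<noteq> (\<lambda>_. 0)}"
      obtain k j where kj: "i = (k, j)" by (cases i)
      have "\<psi> (rep c) (k, j) \<noteq> (\<lambda>_. 0)" using i unfolding kj by blast
      then have "k \<in> set (crossed [] (rep c))" "\<not> coord_length (rep c) k < j"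
        using \<psi>_out[of k "rep c" j] by blast+
      then show "i \<in> (SIGMA k:set (crossed [] (rep c)). {..coord_length (rep c) k})" by (simp add: kj)
    qed
  qed auto
  show ?thesis
  proof (rule Lp_direct_sum[where A = "carrier P" and \<psi> = "\<lambda>c. \<psi> (rep c)", OF p I Lp fin_supp])
    fix N :: "(nat \<times> 'w) measure" and \<phi>
    assume N: "\<And>c. c \<in> carrier P \<Longrightarrow> \<phi> c \<in> Lp_space p N"
      and d: "\<And>c c' F. c \<in> carrier P \<Longrightarrow> c' \<in> carrier P \<Longrightarrow> finite F \<Longrightarrow> F \<subseteq> I \<Longrightarrow>
      (\<And>i. i \<in> I - F \<Longrightarrow> \<psi> (rep c) i = \<psi> (rep c') i) \<Longrightarrow>
      (\<integral>x. \<bar>\<phi> c x - \<phi> c' x\<bar> powr p \<partial>N) = (\<Sum>i\<in>F. \<integral>w. \<bar>\<psi> (rep c) i w - \<psi> (rep c') i w\<bar> powr p \<partial>M' i)"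
    show ?thesis
    proof (rule that[OF N])
      fix x y K and m :: nat
      assume x: "x \<in> words" and y: "y \<in> words" and K: "finite K" "K \<subseteq> hyperplanes"
        "set (crossed [] x) \<union> set (crossed [] y) \<subseteq> K" and m: "\<And>k. k \<in> K \<Longrightarrow> coord_length x k \<le> m \<and> coord_length y k \<le> m"
      have "Lp_dist p N (\<phi> (cls x)) (\<phi> (cls y)) powr p = (\<integral>t. \<bar>\<phi> (cls x) t - \<phi> (cls y) t\<bar> powr p \<partial>N)"
        unfolding Lp_dist_def using p by (intro Lp_norm_powr) simp
      also have "\<dots> = (\<Sum>i\<in>K \<times> {..<Suc m}. \<integral>w. \<bar>\<psi> (rep (cls x)) i w - \<psi> (rep (cls y)) i w\<bar> powr p \<partial>M' i)"
      proof (rule d)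
        show "\<psi> (rep (cls x)) i = \<psi> (rep (cls y)) i" if i: "i \<in> I - K \<times> {..<Suc m}" for i
        proof -
          obtain k j where kj: "i = (k, j)" by (cases i)
          have *: "k \<notin> K \<or> m < j" using i kj by auto
          have "coord_length w k < j \<or> k \<notin> set (crossed [] w)" if "w = x \<or> w = y" for w
            using * m[of k] K(3) that by fastforce
          then have "\<psi> x i = (\<lambda>_. 0)" "\<psi> y i = (\<lambda>_. 0)" using \<psi>_out kj by blast+
          then show ?thesis using \<psi>_rep x y i by simp
        qed
      qed (use x y K in \<open>auto simp: carrier_P I_def\<close>)
      also have "\<dots> = (\<Sum>i\<in>K \<times> {..<Suc m}. \<integral>w. \<bar>\<psi> x i w - \<psi> y i w\<bar> powr p \<partial>M' i)"
      proof (rule sum.cong[OF HOL.refl])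
        fix i assume "i \<in> K \<times> {..<Suc m}"
        then have "i \<in> I" using K by (auto simp: I_def)
        then show "(\<integral>w. \<bar>\<psi> (rep (cls x)) i w - \<psi> (rep (cls y)) i w\<bar> powr p \<partial>M' i)
            = (\<integral>w. \<bar>\<psi> x i w - \<psi> y i w\<bar> powr p \<partial>M' i)" by (simp only: \<psi>_rep x y)
      qed
      also have "\<dots> = (\<Sum>k\<in>K. \<Sum>j<Suc m. \<integral>w. \<bar>\<psi> x (k, j) w - \<psi> y (k, j) w\<bar> powr p \<partial>M' (k, j))"
        by (simp only: sum.cartesian_product case_prod_unfold prod.collapse)
      also have "\<dots> = (\<Sum>k\<in>K. Lp_dist p (M (fst k)) (f (fst k) (coord k [] x)) (f (fst k) (coord k [] y)) powr p
            + (\<Sum>j<m. \<bar>profile W x k j - profile W y k j\<bar> powr p))"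
      proof (rule sum.cong[OF HOL.refl])
        fix k assume "k \<in> K"
        have "(\<integral>w. \<bar>\<psi> x (k, 0) w - \<psi> y (k, 0) w\<bar> powr p \<partial>M' (k, 0))
          = Lp_dist p (M (fst k)) (f (fst k) (coord k [] x)) (f (fst k) (coord k [] y)) powr p"
          unfolding Lp_dist_def using p by (subst Lp_norm_powr) (auto simp: \<psi>_def M'_def)
        moreover have "(\<integral>w. \<bar>\<psi> x (k, Suc j) w - \<psi> y (k, Suc j) w\<bar> powr p \<partial>M' (k, Suc j))
          = \<bar>profile W x k j - profile W y k j\<bar> powr p" for j
          by (simp add: \<psi>_def M'_def lebesgue_integral_count_space_finite)
        ultimately show "(\<Sum>j<Suc m. \<integral>w. \<bar>\<psi> x (k, j) w - \<psi> y (k, j) w\<bar> powr p \<partial>M' (k, j)) =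
            Lp_dist p (M (fst k)) (f (fst k) (coord k [] x)) (f (fst k) (coord k [] y)) powr p
            + (\<Sum>j<m. \<bar>profile W x k j - profile W y k j\<bar> powr p)"
          unfolding sum.lessThan_Suc_shift by simp
      qed
      finally show "Lp_dist p N (\<phi> (cls x)) (\<phi> (cls y)) powr p = \<dots>" .
    qed
  qed
qed

lemma coord_length_eq_0D:
  assumes "x \<in> words" "fst k \<in> V" "coord_length x k = 0"
  shows "coord k [] x = \<one>\<^bsub>G (fst k)\<^esub>"
  using group.word_length_eq_0D[OF group_vertex[OF assms(2)] generates_vertex[OF assms(2)]
      coord_closed[OF assms(1,2)]] assms(3) by (simp add: coord_length_def)

lemma coord_dist_one:
  assumes "x \<in> words" "y \<in> words" "fst k \<in> V"
  shows "coord_length y k = 0 \<Longrightarrow> coord_dist x y k = coord_length x k" "coord_length x k = 0 \<Longrightarrow> coord_dist x y k = coord_length y k"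
    "coord k [] x = coord k [] y \<Longrightarrow> coord_dist x y k = 0"
proof -
  interpret group "G (fst k)" by (rule group_vertex[OF assms(3)])
  have c: "coord k [] x \<in> carrier (G (fst k))" "coord k [] y \<in> carrier (G (fst k))"
    using coord_closed assms by simp_all
  show "coord_dist x y k = coord_length x k" if "coord_length y k = 0"
    unfolding word_dist_def coord_length_eq_0D[OF assms(2,3) that]
    using c word_length_inv[OF generates_vertex[OF assms(3)] c(1)] by (simp add: coord_length_def)
  show "coord_dist x y k = coord_length y k" if "coord_length x k = 0"
    unfolding word_dist_def coord_length_eq_0D[OF assms(1,3) that] using c by (simp add: coord_length_def)
  show "coord_dist x y k = 0" if "coord k [] x = coord k [] y"
    unfolding word_dist_def that using c by simp
qed

text \<open>Where \<open>y\<close> has trivial coordinates its profile vanishes, so the profile of \<open>x\<close> is fully visible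
  there. It takes its weights at as many distinct positive distances as the total length of the
  coordinates.\<close>

lemma profile_sum_ge:
  assumes x: "x \<in> words" and y: "y \<in> words" and v: "v \<in> V"
    and A: "finite A" "\<And>k. k \<in> A \<Longrightarrow> fst k = v \<and> coord_length y k = 0 \<and> coord_length x k \<le> m"
    and W: "mono W" "\<And>n. 0 \<le> W n" and p: "1 \<le> p"
  shows "(\<Sum>d=1..(\<Sum>k\<in>A. coord_length x k). W d powr p)
    \<le> (\<Sum>k\<in>A. \<Sum>j<m. \<bar>profile W x k j - profile W y k j\<bar> powr p)"
proof -
  obtain D where D: "finite D" "0 \<notin> D" "card D = (\<Sum>k\<in>A. coord_length x k)"
    "\<And>F :: nat \<Rightarrow> real. (\<Sum>k\<in>A. \<Sum>j<coord_length x k. F (type_length v x - (offset k + j))) = (\<Sum>d\<in>D. F d)"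
    using sum_positions[OF x v A(1)] A(2) by blast
  have "mono (\<lambda>d. W d powr p)"
    using W p by (intro monoI powr_mono2) (auto simp: monoD)
  then have "(\<Sum>d=1..card D. W d powr p) \<le> (\<Sum>d\<in>D. W d powr p)"
    using D by (intro sum_atLeastAtMost_card_le)
  also have "\<dots> = (\<Sum>k\<in>A. \<Sum>j<coord_length x k. W (type_length v x - (offset k + j)) powr p)"
    using D(4)[of "\<lambda>d. W d powr p"] by simp
  also have "\<dots> \<le> (\<Sum>k\<in>A. \<Sum>j<m. \<bar>profile W x k j - profile W y k j\<bar> powr p)"
  proof (rule sum_mono)
    fix k assume k: "k \<in> A"
    have "(\<Sum>j<coord_length x k. W (type_length v x - (offset k + j)) powr p)
        = (\<Sum>j<coord_length x k. \<bar>profile W x k j - profile W y k j\<bar> powr p)"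
      using A(2)[OF k] W(2) by (intro sum.cong) (auto simp: profile_def)
    also have "\<dots> \<le> (\<Sum>j<m. \<bar>profile W x k j - profile W y k j\<bar> powr p)"
      using A(2)[OF k] by (intro sum_mono2) auto
    finally show "(\<Sum>j<coord_length x k. W (type_length v x - (offset k + j)) powr p) \<le> \<dots>" .
  qed
  finally show ?thesis by (simp add: D(3))
qed

text \<open>Some type contributes at least the fraction \<open>1 / card V\<close> of the distance. The hyperplanes of this
  type with different coordinates fall into three parts: those where both coordinates are
  nontrivial, of which there is at most one, and those where the coordinate of \<open>y\<close>, respectively of
  \<open>x\<close>, is trivial. The part of total length \<open>a\<close>, at least a third, provides the bound.\<close>

lemma energy_dichotomy:
  fixes e :: "('v \<times> ('v \<times> 'a) list set) \<Rightarrow> real"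
  assumes x: "x \<in> words" and y: "y \<in> words" and V: "finite V"
    and K: "finite K" "K \<subseteq> hyperplanes" and n: "n \<le> (\<Sum>k\<in>K. coord_dist x y k)"
    and m: "\<And>k. k \<in> K \<Longrightarrow> coord_length x k \<le> m \<and> coord_length y k \<le> m"
    and e: "\<And>k. k \<in> K \<Longrightarrow> \<rho> (coord_dist x y k) powr p \<le> e k" "\<rho> 0 = 0"
    and W: "mono W" "\<And>n. 0 \<le> W n" and p: "1 \<le> p"
  shows "\<exists>a. n \<le> 3 * card V * a \<and>
    min (\<rho> a powr p) (\<Sum>d=1..a. W d powr p)
      \<le> (\<Sum>k\<in>K. e k + (\<Sum>j<m. \<bar>profile W x k j - profile W y k j\<bar> powr p))"
    (is "\<exists>a. _ \<and> _ \<le> ?E")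
proof (cases "n = 0")
  case True
  have "0 \<le> e k" if "k \<in> K" for k using e(1)[OF that] powr_ge_zero order_trans by blast
  then have "0 \<le> ?E" by (intro sum_nonneg add_nonneg_nonneg) auto
  then show ?thesis using True e(2) by (intro exI[of _ 0]) auto
next
  case False
  have KV: "fst k \<in> V" if "k \<in> K" for k using that K hyperplanes_V by blast
  let ?S = "\<lambda>v. \<Sum>k\<in>{k\<in>K. fst k = v}. coord_dist x y k"
  have "(\<Sum>v\<in>V. ?S v) = (\<Sum>k\<in>K. coord_dist x y k)"
    using KV by (intro sum.group K V) auto
  then have nS: "n \<le> (\<Sum>v\<in>V. ?S v)" using n by simp
  have "\<exists>v\<in>V. n \<le> card V * ?S v"
  proof (rule ccontr)
    assume "\<not> (\<exists>v\<in>V. n \<le> card V * ?S v)"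
    then have lt: "card V * ?S v < n" if "v \<in> V" for v using that by force
    have "V \<noteq> {}" using nS False by auto
    then have "(\<Sum>v\<in>V. card V * ?S v) < (\<Sum>v\<in>V. n)" using lt V by (intro sum_strict_mono) auto
    then show False using nS by (simp add: sum_distrib_left[symmetric])
  qed
  then obtain v where v: "v \<in> V" "n \<le> card V * ?S v" by blast
  let ?A = "{k\<in>K. fst k = v \<and> coord_length x k \<noteq> 0 \<and> coord_length y k \<noteq> 0 \<and> coord k [] x \<noteq> coord k [] y}"
  let ?B = "{k\<in>K. fst k = v \<and> coord_length y k = 0}"
  let ?C = "{k\<in>K. fst k = v \<and> coord_length x k = 0}"
  have "?S v = (\<Sum>k\<in>{k\<in>K. fst k = v} \<inter> (?A \<union> ?B \<union> ?C). coord_dist x y k)"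
    using K coord_dist_one(3)[OF x y] v(1) by (intro sum.mono_neutral_right) auto
  also have "\<dots> \<le> (\<Sum>k\<in>?A \<union> ?B \<union> ?C. coord_dist x y k)" using K by (intro sum_mono2) auto
  also have "\<dots> \<le> (\<Sum>k\<in>?A. coord_dist x y k) + (\<Sum>k\<in>?B. coord_dist x y k) + (\<Sum>k\<in>?C. coord_dist x y k)"
    using K by (simp add: sum_Un_nat)
  also have "(\<Sum>k\<in>?B. coord_dist x y k) = (\<Sum>k\<in>?B. coord_length x k)"
    using coord_dist_one(1)[OF x y] v(1) by (intro sum.cong) auto
  also have "(\<Sum>k\<in>?C. coord_dist x y k) = (\<Sum>k\<in>?C. coord_length y k)"
    using coord_dist_one(2)[OF x y] v(1) by (intro sum.cong) auto
  finally have S: "?S v \<le> (\<Sum>k\<in>?A. coord_dist x y k) + (\<Sum>k\<in>?B. coord_length x k) + (\<Sum>k\<in>?C. coord_length y k)" .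
  have e0: "0 \<le> e k" if "k \<in> K" for k using e(1)[OF that] powr_ge_zero order_trans by blast
  let ?Q = "\<lambda>k. \<Sum>j<m. \<bar>profile W x k j - profile W y k j\<bar> powr p"
  have Q0: "0 \<le> ?Q k" for k by (intro sum_nonneg) auto
  have sub: "(\<Sum>k\<in>Z. ?Q k) \<le> ?E" if "Z \<subseteq> K" for Z
  proof -
    have "(\<Sum>k\<in>Z. ?Q k) \<le> (\<Sum>k\<in>K. ?Q k)" using that K Q0 by (intro sum_mono2) auto
    also have "\<dots> \<le> ?E" using e0 by (intro sum_mono) auto
    finally show ?thesis .
  qed
  have scale: "n \<le> 3 * card V * a" if "?S v \<le> 3 * a" for a
  proof -
    have "n \<le> card V * ?S v" by (rule v(2))
    also have "\<dots> \<le> card V * (3 * a)" using that by (rule mult_le_mono2)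
    finally show ?thesis by simp
  qed
  consider "?S v \<le> 3 * (\<Sum>k\<in>?A. coord_dist x y k)" | "?S v \<le> 3 * (\<Sum>k\<in>?B. coord_length x k)"
    | "?S v \<le> 3 * (\<Sum>k\<in>?C. coord_length y k)" using S by linarith
  then show ?thesis
  proof cases
    case 1
    have "\<rho> (\<Sum>k\<in>?A. coord_dist x y k) powr p \<le> ?E"
    proof (cases "?A = {}")
      case True
      have "0 \<le> ?E" using e0 Q0 by (intro sum_nonneg add_nonneg_nonneg) auto
      then show ?thesis unfolding True using e(2) by simp
    next
      case False
      then obtain k where k: "k \<in> ?A" by blast
      then have A: "?A = {k}" using branching_unique[OF x y v(1), of k] by blast
      have kK: "k \<in> K" using k by blast
      have "\<rho> (\<Sum>k\<in>?A. coord_dist x y k) powr p \<le> e k + ?Q k"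
        unfolding A using e(1)[OF kK] Q0[of k] by simp
      also have "\<dots> = (\<Sum>k\<in>{k}. e k + ?Q k)" by simp
      also have "\<dots> \<le> ?E" using K(1) kK e0 Q0 by (intro sum_mono2) auto
      finally show ?thesis .
    qed
    then show ?thesis using scale[OF 1] by (intro exI[of _ "\<Sum>k\<in>?A. coord_dist x y k"]) (simp add: min.coboundedI1)
  next
    case 2
    have "(\<Sum>d=1..(\<Sum>k\<in>?B. coord_length x k). W d powr p) \<le> (\<Sum>k\<in>?B. ?Q k)"
      using K m by (intro profile_sum_ge[OF x y v(1) _ _ W p]) auto
    also have "\<dots> \<le> ?E" by (rule sub) blast
    finally show ?thesis using scale[OF 2] by (intro exI[of _ "\<Sum>k\<in>?B. coord_length x k"]) (simp add: min.coboundedI2)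
  next
    case 3
    have "(\<Sum>d=1..(\<Sum>k\<in>?C. coord_length y k). W d powr p)
        \<le> (\<Sum>k\<in>?C. \<Sum>j<m. \<bar>profile W y k j - profile W x k j\<bar> powr p)"
      using K m by (intro profile_sum_ge[OF y x v(1) _ _ W p]) auto
    also have "\<dots> = (\<Sum>k\<in>?C. ?Q k)" by (simp add: abs_minus_commute)
    also have "\<dots> \<le> ?E" by (rule sub) blast
    finally show ?thesis using scale[OF 3] by (intro exI[of _ "\<Sum>k\<in>?C. coord_length y k"]) (simp add: min.coboundedI2)
  qed
qed

text \<open>The two parts of the embedding for an arbitrary weight: a generator changes one coordinate by at
  most \<open>1\<close> and the profiles by at most \<open>B\<close> in the \<open>p\<close>-th power, and the \<open>p\<close>-th power of the distance of
  two images is a sum over a set of hyperplanes large enough to bound the word distance.\<close>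

lemma graph_product_embedding:
  fixes M :: "'v \<Rightarrow> 'w measure" and f :: "'v \<Rightarrow> 'a \<Rightarrow> 'w \<Rightarrow> real"
  assumes p: "1 \<le> p" and fin: "finite V" "\<And>v. v \<in> V \<Longrightarrow> finite (X v)"
    and f: "\<And>v a. v \<in> V \<Longrightarrow> a \<in> carrier (G v) \<Longrightarrow> f v a \<in> Lp_space p (M v)"
    and lip: "\<And>v a b. v \<in> V \<Longrightarrow> a \<in> carrier (G v) \<Longrightarrow> b \<in> carrier (G v) \<Longrightarrow>
      Lp_dist p (M v) (f v a) (f v b) \<le> real (word_dist (G v) (X v) a b)"
    and W0: "W 0 = 0" and B: "\<And>n. (\<Sum>d<n. \<bar>W (Suc d) - W d\<bar> powr p) \<le> B"
  obtains N :: "(nat \<times> 'w) measure" and \<phi> where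
    "\<And>c. c \<in> carrier P \<Longrightarrow> \<phi> c \<in> Lp_space p N"
    "\<And>c c'. c \<in> carrier P \<Longrightarrow> c' \<in> carrier P \<Longrightarrow>
      Lp_dist p N (\<phi> c) (\<phi> c') \<le> (1 + B) powr (1 / p) * real (word_dist P gens c c')"
    "\<And>x y. x \<in> words \<Longrightarrow> y \<in> words \<Longrightarrow> \<exists>K m. finite K \<and> K \<subseteq> hyperplanes \<and>
      word_dist P gens (cls x) (cls y) \<le> (\<Sum>k\<in>K. coord_dist x y k) \<and>
      (\<forall>k\<in>K. coord_length x k \<le> m \<and> coord_length y k \<le> m) \<and>
      Lp_dist p N (\<phi> (cls x)) (\<phi> (cls y)) powr p =
        (\<Sum>k\<in>K. Lp_dist p (M (fst k)) (f (fst k) (coord k [] x)) (f (fst k) (coord k [] y)) powr p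
          + (\<Sum>j<m. \<bar>profile W x k j - profile W y k j\<bar> powr p))"
proof -
  show ?thesis
  proof (rule direct_sum_map[where f = f and M = M and W = W, OF p fin f])
    fix N :: "(nat \<times> 'w) measure" and \<phi>
    assume N: "\<And>c. c \<in> carrier P \<Longrightarrow> \<phi> c \<in> Lp_space p N"
    and d: "\<And>x y K m. x \<in> words \<Longrightarrow> y \<in> words \<Longrightarrow> finite K \<Longrightarrow> K \<subseteq> hyperplanes \<Longrightarrow>
      set (crossed [] x) \<union> set (crossed [] y) \<subseteq> K \<Longrightarrow> (\<And>k. k \<in> K \<Longrightarrow> coord_length x k \<le> m \<and> coord_length y k \<le> m) \<Longrightarrow>
      Lp_dist p N (\<phi> (cls x)) (\<phi> (cls y)) powr p =
        (\<Sum>k\<in>K. Lp_dist p (M (fst k)) (f (fst k) (coord k [] x)) (f (fst k) (coord k [] y)) powr p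
          + (\<Sum>j<m. \<bar>profile W x k j - profile W y k j\<bar> powr p))"
    have bound: "\<exists>m. \<forall>k\<in>K. coord_length x k \<le> m \<and> coord_length y k \<le> m" if "finite K" for K x y
    proof (intro exI ballI)
      fix k assume "k \<in> K"
      then have "coord_length x k + coord_length y k \<le> (\<Sum>k\<in>K. coord_length x k + coord_length y k)"
        using that by (intro member_le_sum) auto
      then show "coord_length x k \<le> (\<Sum>k\<in>K. coord_length x k + coord_length y k) \<and> coord_length y k \<le> (\<Sum>k\<in>K. coord_length x k + coord_length y k)"
        by simp
    qed
    have B0: "0 \<le> B" using B[of 0] by simp
    have step: "Lp_dist p N (\<phi> (cls (x @ [a]))) (\<phi> (cls x)) powr p \<le> 1 + B"
      if x: "x \<in> words" and a: "generator_letter a" for x a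
    proof -
      note ac = generator_letter_carrier[OF a]
      let ?z = "x @ [a]"
      have z: "?z \<in> words" using x ac by simp
      let ?K = "set (crossed [] x) \<union> set (crossed [] ?z)"
      have K: "finite ?K" "?K \<subseteq> hyperplanes" using crossed_hyperplanes[of "[]"] x z by auto
      have KV: "fst k \<in> V" if "k \<in> ?K" for k using that K(2) hyperplanes_V by blast
      obtain m where m: "\<forall>k\<in>?K. coord_length ?z k \<le> m \<and> coord_length x k \<le> m" using bound[OF K(1)] by blast
      let ?k = "(fst a, hyperplane_at (fst a) x)"
      have "Lp_dist p (M (fst k)) (f (fst k) (coord k [] ?z)) (f (fst k) (coord k [] x)) powr p
          \<le> (if k = ?k then 1 else 0)" if "k \<in> ?K" for k
      proof -
        have "Lp_dist p (M (fst k)) (f (fst k) (coord k [] ?z)) (f (fst k) (coord k [] x))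
            \<le> real (coord_dist ?z x k)"
          using KV[OF that] x z by (intro lip coord_closed) auto
        also have "\<dots> \<le> (if k = ?k then 1 else 0)" using coord_dist_step[OF x a KV[OF that]] by auto
        finally have "Lp_dist p (M (fst k)) (f (fst k) (coord k [] ?z)) (f (fst k) (coord k [] x)) powr p
            \<le> (if k = ?k then 1 else 0) powr p"
          using p by (intro powr_mono2) (auto simp: Lp_dist_def Lp_norm_def)
        then show ?thesis by (simp split: if_splits)
      qed
      then have "(\<Sum>k\<in>?K. Lp_dist p (M (fst k)) (f (fst k) (coord k [] ?z)) (f (fst k) (coord k [] x)) powr p)
          \<le> (\<Sum>k\<in>?K. if k = ?k then 1 else 0)" by (intro sum_mono)
      also have "\<dots> \<le> 1" using K(1) by (simp add: sum.delta)
      finally have 1: "(\<Sum>k\<in>?K. Lp_dist p (M (fst k)) (f (fst k) (coord k [] ?z)) (f (fst k) (coord k [] x)) powr p) \<le> 1" .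
      have "(\<Sum>(k, j)\<in>?K \<times> {..<m}. \<bar>profile W ?z k j - profile W x k j\<bar> powr p) \<le> B"
        using KV K(1) by (intro profile_step_letter[OF x a W0 B]) auto
      then have 2: "(\<Sum>k\<in>?K. \<Sum>j<m. \<bar>profile W ?z k j - profile W x k j\<bar> powr p) \<le> B"
        by (simp add: sum.cartesian_product)
      have "Lp_dist p N (\<phi> (cls ?z)) (\<phi> (cls x)) powr p =
          (\<Sum>k\<in>?K. Lp_dist p (M (fst k)) (f (fst k) (coord k [] ?z)) (f (fst k) (coord k [] x)) powr p
            + (\<Sum>j<m. \<bar>profile W ?z k j - profile W x k j\<bar> powr p))"
        using m by (intro d z x K) auto
      then show ?thesis using 1 2 by (simp add: sum.distrib)
    qed
    have upper: "Lp_dist p N (\<phi> c) (\<phi> c') \<le> (1 + B) powr (1 / p) * real (word_dist P gens c c')"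
      if c: "c \<in> carrier P" "c' \<in> carrier P" for c c'
    proof -
      obtain x y where x: "x \<in> words" "c = cls x" and y: "y \<in> words" "c' = cls y"
        using c by (auto simp: carrier_P)
      obtain as where as: "length as = word_dist P gens (cls x) (cls y)"
        "\<And>a. a \<in> set as \<Longrightarrow> generator_letter a" "cls y = cls (x @ as)"
        using geodesic_path[OF x(1) y(1)] by blast
      have asw: "as \<in> words" by (rule generator_letters_words[OF as(2)])
      let ?u = "\<lambda>i. \<phi> (cls (x @ take i as))"
      have "Lp_dist p N (?u 0) (?u (length as)) \<le> (1 + B) powr (1 / p) * real (length as)"
      proof (rule Lp_telescope[OF p])
        show "?u i \<in> Lp_space p N" for i using x asw by (intro N) (simp add: carrier_P)
        fix i assume i: "i < length as"
        have "?u (Suc i) = \<phi> (cls ((x @ take i as) @ [as ! i]))"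
          using i by (simp add: take_Suc_conv_app_nth)
        then have "Lp_dist p N (?u (Suc i)) (?u i) powr p \<le> 1 + B"
          using step[of "x @ take i as" "as ! i"] as(2)[of "as ! i"] i x asw by simp
        then show "(\<integral>t. \<bar>?u (Suc i) t - ?u i t\<bar> powr p \<partial>N) \<le> 1 + B"
          unfolding Lp_dist_def using p by (subst (asm) Lp_norm_powr) auto
      qed
      then show ?thesis using as x y by simp
    qed
    have lower: "\<exists>K m. finite K \<and> K \<subseteq> hyperplanes \<and>
        word_dist P gens (cls x) (cls y) \<le> (\<Sum>k\<in>K. coord_dist x y k) \<and>
        (\<forall>k\<in>K. coord_length x k \<le> m \<and> coord_length y k \<le> m) \<and>
        Lp_dist p N (\<phi> (cls x)) (\<phi> (cls y)) powr p =
          (\<Sum>k\<in>K. Lp_dist p (M (fst k)) (f (fst k) (coord k [] x)) (f (fst k) (coord k [] y)) powr p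
            + (\<Sum>j<m. \<bar>profile W x k j - profile W y k j\<bar> powr p))"
      if x: "x \<in> words" and y: "y \<in> words" for x y
    proof -
      obtain K where K: "finite K" "K \<subseteq> hyperplanes"
        "word_dist P gens (cls x) (cls y) \<le> (\<Sum>k\<in>K. coord_dist x y k)" by (rule dist_le_sum_coord_dist[OF x y])
      let ?K = "K \<union> set (crossed [] x) \<union> set (crossed [] y)"
      have K': "finite ?K" "?K \<subseteq> hyperplanes" using K crossed_hyperplanes[of "[]"] x y by auto
      have "(\<Sum>k\<in>K. coord_dist x y k) \<le> (\<Sum>k\<in>?K. coord_dist x y k)" using K'(1) by (intro sum_mono2) auto
      moreover obtain m where "\<forall>k\<in>?K. coord_length x k \<le> m \<and> coord_length y k \<le> m" using bound[OF K'(1)] by blast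
      ultimately show ?thesis
        using K K' d[OF x y K', of m] by (intro exI[of _ ?K] exI[of _ m]) auto
    qed
    show ?thesis by (rule that[OF N upper lower])
  qed
qed

text \<open>For \<open>p = 1\<close> the profiles are switched off by the zero weight.\<close>

lemma graph_product_embedding_L1:
  fixes M :: "'v \<Rightarrow> 'w measure" and f :: "'v \<Rightarrow> 'a \<Rightarrow> 'w \<Rightarrow> real"
  assumes fin: "finite V" "\<And>v. v \<in> V \<Longrightarrow> finite (X v)"
    and f: "\<And>v a. v \<in> V \<Longrightarrow> a \<in> carrier (G v) \<Longrightarrow> f v a \<in> Lp_space 1 (M v)"
    and lip: "\<And>v a b. v \<in> V \<Longrightarrow> a \<in> carrier (G v) \<Longrightarrow> b \<in> carrier (G v) \<Longrightarrow>
      Lp_dist 1 (M v) (f v a) (f v b) \<le> real (word_dist (G v) (X v) a b)"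
    and low: "\<And>v a b. v \<in> V \<Longrightarrow> a \<in> carrier (G v) \<Longrightarrow> b \<in> carrier (G v) \<Longrightarrow>
      \<rho> (word_dist (G v) (X v) a b) \<le> Lp_dist 1 (M v) (f v a) (f v b)"
    and \<rho>: "concave_map \<rho>" "filterlim \<rho> at_top sequentially"
  shows "\<exists>(N :: (nat \<times> 'w) measure) \<phi>. coarse_embedding_Lp 1 N P gens \<phi> \<and>
    (\<forall>c\<in>carrier P. \<forall>c'\<in>carrier P. \<rho> (word_dist P gens c c') \<le> Lp_dist 1 N (\<phi> c) (\<phi> c'))"
proof (rule graph_product_embedding[where p = 1 and W = "\<lambda>_. 0" and B = 0 and f = f and M = M,
      OF order_refl fin f lip])
  fix N :: "(nat \<times> 'w) measure" and \<phi>
  assume N: "\<And>c. c \<in> carrier P \<Longrightarrow> \<phi> c \<in> Lp_space 1 N"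
    and upper: "\<And>c c'. c \<in> carrier P \<Longrightarrow> c' \<in> carrier P \<Longrightarrow>
      Lp_dist 1 N (\<phi> c) (\<phi> c') \<le> (1 + 0) powr (1 / 1) * real (word_dist P gens c c')"
    and energy: "\<And>x y. x \<in> words \<Longrightarrow> y \<in> words \<Longrightarrow> \<exists>K m. finite K \<and> K \<subseteq> hyperplanes \<and>
      word_dist P gens (cls x) (cls y) \<le> (\<Sum>k\<in>K. coord_dist x y k) \<and>
      (\<forall>k\<in>K. coord_length x k \<le> m \<and> coord_length y k \<le> m) \<and>
      Lp_dist 1 N (\<phi> (cls x)) (\<phi> (cls y)) powr 1 =
        (\<Sum>k\<in>K. Lp_dist 1 (M (fst k)) (f (fst k) (coord k [] x)) (f (fst k) (coord k [] y)) powr 1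
          + (\<Sum>j<m. \<bar>profile (\<lambda>_. 0) x k j - profile (\<lambda>_. 0) y k j\<bar> powr 1))"
  have lower: "\<rho> (word_dist P gens c c') \<le> Lp_dist 1 N (\<phi> c) (\<phi> c')"
    if c: "c \<in> carrier P" "c' \<in> carrier P" for c c'
  proof -
    obtain x y where x: "x \<in> words" "c = cls x" and y: "y \<in> words" "c' = cls y"
      using c by (auto simp: carrier_P)
    obtain K m where K: "finite K" "K \<subseteq> hyperplanes"
      "word_dist P gens c c' \<le> (\<Sum>k\<in>K. coord_dist x y k)"
      and E: "Lp_dist 1 N (\<phi> c) (\<phi> c') powr 1 =
        (\<Sum>k\<in>K. Lp_dist 1 (M (fst k)) (f (fst k) (coord k [] x)) (f (fst k) (coord k [] y)) powr 1
          + (\<Sum>j<m. \<bar>profile (\<lambda>_. 0) x k j - profile (\<lambda>_. 0) y k j\<bar> powr 1))"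
      using energy[OF x(1) y(1)] x y by blast
    have "\<rho> (word_dist P gens c c') \<le> \<rho> (\<Sum>k\<in>K. coord_dist x y k)"
      using \<rho>(1) K(3) by (simp add: concave_map_def monoD)
    also have "\<dots> \<le> (\<Sum>k\<in>K. \<rho> (coord_dist x y k))" by (rule concave_map_sum_le[OF \<rho>(1) K(1)])
    also have "\<dots> \<le> (\<Sum>k\<in>K. Lp_dist 1 (M (fst k)) (f (fst k) (coord k [] x)) (f (fst k) (coord k [] y)) powr 1
          + (\<Sum>j<m. \<bar>profile (\<lambda>_. 0) x k j - profile (\<lambda>_. 0) y k j\<bar> powr 1))"
    proof (rule sum_mono)
      fix k assume "k \<in> K"
      then have k: "fst k \<in> V" using K(2) hyperplanes_V by blast
      have "\<rho> (coord_dist x y k) \<le> Lp_dist 1 (M (fst k)) (f (fst k) (coord k [] x)) (f (fst k) (coord k [] y))"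
        using k x y by (intro low coord_closed) auto
      moreover have "0 \<le> (\<Sum>j<m. \<bar>profile (\<lambda>_. 0) x k j - profile (\<lambda>_. 0) y k j\<bar> powr 1)"
        by (intro sum_nonneg) auto
      ultimately show "\<rho> (coord_dist x y k)
        \<le> Lp_dist 1 (M (fst k)) (f (fst k) (coord k [] x)) (f (fst k) (coord k [] y)) powr 1
          + (\<Sum>j<m. \<bar>profile (\<lambda>_. 0) x k j - profile (\<lambda>_. 0) y k j\<bar> powr 1)"
        unfolding powr_one[OF Lp_dist_nonneg] by linarith
    qed
    also have "\<dots> = Lp_dist 1 N (\<phi> c) (\<phi> c')"
      unfolding E[symmetric] by (rule powr_one[OF Lp_dist_nonneg])
    finally show ?thesis .
  qed
  have "coarse_embedding_Lp 1 N P gens \<phi>"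
    using \<rho> N lower upper by (intro coarse_embedding_LpI[where R = \<rho> and C = 1])
      (auto simp: concave_map_def)
  then show ?thesis using lower by blast
qed auto

text \<open>The lower control function is the minimum of \<open>\<rho>\<close> and \<open>max (h n) (n powr (1 / p))\<close>: the power of \<open>n\<close> is
  provided by the weight as well and keeps the control function unbounded when \<open>h\<close> is bounded.
  The scaling factor \<open>C\<close> compensates for the proportion of the distance in \<open>energy_dichotomy\<close> and for
  the factor in \<open>weight_sum_ge\<close>.\<close>

lemma graph_product_embedding_Lp:
  fixes M :: "'v \<Rightarrow> 'w measure" and f :: "'v \<Rightarrow> 'a \<Rightarrow> 'w \<Rightarrow> real"
  assumes p: "1 \<le> p" and fin: "finite V" "\<And>v. v \<in> V \<Longrightarrow> finite (X v)"
    and f: "\<And>v a. v \<in> V \<Longrightarrow> a \<in> carrier (G v) \<Longrightarrow> f v a \<in> Lp_space p (M v)"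
    and lip: "\<And>v a b. v \<in> V \<Longrightarrow> a \<in> carrier (G v) \<Longrightarrow> b \<in> carrier (G v) \<Longrightarrow>
      Lp_dist p (M v) (f v a) (f v b) \<le> real (word_dist (G v) (X v) a b)"
    and low: "\<And>v a b. v \<in> V \<Longrightarrow> a \<in> carrier (G v) \<Longrightarrow> b \<in> carrier (G v) \<Longrightarrow>
      \<rho> (word_dist (G v) (X v) a b) \<le> Lp_dist p (M v) (f v a) (f v b)"
    and \<rho>: "concave_map \<rho>" "filterlim \<rho> at_top sequentially"
    and h: "concave_map h" "tessera_C p h"
  shows "\<exists>(N :: (nat \<times> 'w) measure) \<phi>. coarse_embedding_Lp p N P gens \<phi> \<and>
    (\<forall>c\<in>carrier P. \<forall>c'\<in>carrier P.
      min (\<rho> (word_dist P gens c c')) (h (word_dist P gens c c')) \<le> Lp_dist p N (\<phi> c) (\<phi> c'))"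
proof -
  let ?W = "weight p h"
  have p0: "0 < p" using p by simp
  obtain B where B: "\<And>n. (\<Sum>d<n. \<bar>?W (Suc d) - ?W d\<bar> powr p) \<le> B"
    using weight_steps_bounded[OF p h] by blast
  have B0: "0 \<le> B" using B[of 0] by simp
  have W: "mono ?W" "\<And>n. 0 \<le> ?W n"
    using weight_mono[OF p h(1)] weight_nonneg[OF p h(1)] by (auto intro: monoI)
  have \<rho>0: "\<rho> 0 = 0" "\<And>n. 0 \<le> \<rho> n" "mono \<rho>" and h0: "\<And>n. 0 \<le> h n" "mono h"
    using \<rho>(1) h(1) by (auto simp: concave_map_def)
  \<comment> \<open>the summand \<open>1\<close> keeps \<open>s\<close> positive for the empty graph\<close>
  define s where "s = 3 * card V + 1"
  define C where "C = 14 * real s"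
  define R where "R n = min (\<rho> n) (max (h n) (real n powr (1 / p)))" for n
  have s: "1 \<le> real s" by (simp add: s_def)
  have C: "real s \<le> C" "0 < C" using s by (simp_all add: C_def)
  have R: "mono R" "\<And>n. 0 \<le> R n"
  proof -
    show "mono R" unfolding R_def
      using \<rho>0(3) h0(2) p0 by (intro monoI min.mono max.mono powr_mono2) (auto simp: monoD)
    show "0 \<le> R n" for n using \<rho>0(2) h0(1) by (simp add: R_def le_max_iff_disj)
  qed
  have "filterlim (\<lambda>n. real n powr (1 / p)) at_top sequentially"
    unfolding filterlim_at_top
  proof
    fix Z
    show "\<forall>\<^sub>F n in sequentially. Z \<le> real n powr (1 / p)"
    proof (rule eventually_sequentiallyI)
      fix n assume "nat \<lceil>\<bar>Z\<bar> powr p\<rceil> \<le> n"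
      then have "\<bar>Z\<bar> powr p \<le> real n" by linarith
      then have "(\<bar>Z\<bar> powr p) powr (1 / p) \<le> real n powr (1 / p)"
        using p0 by (intro powr_mono2) auto
      then show "Z \<le> real n powr (1 / p)" using p0 by (simp add: powr_powr)
    qed
  qed
  then have Rlim: "filterlim R at_top sequentially"
    using \<rho>(2) unfolding filterlim_at_top
  proof (intro allI)
    fix Z assume "\<forall>Z. \<forall>\<^sub>F n in sequentially. Z \<le> real n powr (1 / p)" "\<forall>Z. \<forall>\<^sub>F n in sequentially. Z \<le> \<rho> n"
    then have "\<forall>\<^sub>F n in sequentially. Z \<le> real n powr (1 / p)" "\<forall>\<^sub>F n in sequentially. Z \<le> \<rho> n" by blast+
    then show "\<forall>\<^sub>F n in sequentially. Z \<le> R n"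
      by eventually_elim (simp add: R_def le_max_iff_disj)
  qed
  have root: "real a powr (1 / p) \<le> D" if "real a \<le> D powr p" "0 \<le> D" for a D
  proof -
    have "real a powr (1 / p) \<le> (D powr p) powr (1 / p)" using that p0 by (intro powr_mono2) auto
    also have "\<dots> = D" using that p0 by (simp add: powr_powr)
    finally show ?thesis .
  qed
  have control: "R n \<le> C * D"
    if n: "n \<le> 3 * card V * a" and D: "0 \<le> D"
      and le: "min (\<rho> a powr p) (\<Sum>d=1..a. ?W d powr p) \<le> D powr p" for n a D
  proof -
    have ns: "n \<le> s * a" using n by (simp add: s_def)
    consider "\<rho> a powr p \<le> D powr p" | "(\<Sum>d=1..a. ?W d powr p) \<le> D powr p"
      using le by (auto simp: min_le_iff_disj)
    then show ?thesis
    proof cases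
      case 1
      have "R n \<le> \<rho> n" by (simp add: R_def)
      also have "\<dots> \<le> \<rho> (s * a)" using ns by (rule monoD[OF \<rho>0(3)])
      also have "\<dots> \<le> real s * \<rho> a" by (rule concave_map_mult_le[OF \<rho>(1)])
      also have "\<dots> \<le> real s * D" using powr_le_powrD[OF p0 D 1] by (intro mult_left_mono) auto
      also have "\<dots> \<le> C * D" using C D by (intro mult_right_mono) auto
      finally show ?thesis .
    next
      case 2
      have "h a / 14 \<le> D"
        using powr_le_powrD[OF p0 D order_trans[OF weight_sum_ge(1)[OF p h(1)] 2]] .
      then have ha: "h a \<le> 14 * D" by simp
      have "h n \<le> h (s * a)" using ns by (rule monoD[OF h0(2)])
      also have "\<dots> \<le> real s * h a" by (rule concave_map_mult_le[OF h(1)])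
      also have "\<dots> \<le> real s * (14 * D)" using ha by (intro mult_left_mono) auto
      finally have hn: "h n \<le> C * D" by (simp add: C_def)
      have "real n powr (1 / p) \<le> (real s * real a) powr (1 / p)"
        using ns p0 by (intro powr_mono2) (auto simp flip: of_nat_mult)
      also have "\<dots> = real s powr (1 / p) * real a powr (1 / p)" by (simp add: powr_mult)
      also have "\<dots> \<le> real s powr 1 * D"
        using s p order_trans[OF weight_sum_ge(2)[OF p h(1)] 2] D
        by (intro mult_mono powr_mono root) auto
      also have "\<dots> \<le> C * D" using C D s by (intro mult_right_mono) auto
      finally show ?thesis using hn by (simp add: R_def)
    qed
  qed
  show ?thesis
  proof (rule graph_product_embedding[where W = ?W and f = f and M = M,
        OF p fin f lip weight_0[OF p h(1)] B])
    fix N :: "(nat \<times> 'w) measure" and \<phi>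
    assume N: "\<And>c. c \<in> carrier P \<Longrightarrow> \<phi> c \<in> Lp_space p N"
      and upper: "\<And>c c'. c \<in> carrier P \<Longrightarrow> c' \<in> carrier P \<Longrightarrow>
        Lp_dist p N (\<phi> c) (\<phi> c') \<le> (1 + B) powr (1 / p) * real (word_dist P gens c c')"
      and energy: "\<And>x y. x \<in> words \<Longrightarrow> y \<in> words \<Longrightarrow> \<exists>K m. finite K \<and> K \<subseteq> hyperplanes \<and>
        word_dist P gens (cls x) (cls y) \<le> (\<Sum>k\<in>K. coord_dist x y k) \<and>
        (\<forall>k\<in>K. coord_length x k \<le> m \<and> coord_length y k \<le> m) \<and>
        Lp_dist p N (\<phi> (cls x)) (\<phi> (cls y)) powr p =
          (\<Sum>k\<in>K. Lp_dist p (M (fst k)) (f (fst k) (coord k [] x)) (f (fst k) (coord k [] y)) powr p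
            + (\<Sum>j<m. \<bar>profile ?W x k j - profile ?W y k j\<bar> powr p))"
    let ?\<phi> = "\<lambda>c t. C * \<phi> c t"
    have dist: "Lp_dist p N (?\<phi> c) (?\<phi> c') = C * Lp_dist p N (\<phi> c) (\<phi> c')" for c c'
      using p0 C by (intro Lp_dist_cmult) auto
    have lower: "R (word_dist P gens c c') \<le> Lp_dist p N (?\<phi> c) (?\<phi> c')"
      if c: "c \<in> carrier P" "c' \<in> carrier P" for c c'
    proof -
      obtain x y where x: "x \<in> words" "c = cls x" and y: "y \<in> words" "c' = cls y"
        using c by (auto simp: carrier_P)
      let ?e = "\<lambda>k. Lp_dist p (M (fst k)) (f (fst k) (coord k [] x)) (f (fst k) (coord k [] y)) powr p"
      obtain K m where K: "finite K" "K \<subseteq> hyperplanes"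
        and n: "word_dist P gens c c' \<le> (\<Sum>k\<in>K. coord_dist x y k)"
        and m: "\<forall>k\<in>K. coord_length x k \<le> m \<and> coord_length y k \<le> m"
        and E: "Lp_dist p N (\<phi> c) (\<phi> c') powr p =
          (\<Sum>k\<in>K. ?e k + (\<Sum>j<m. \<bar>profile ?W x k j - profile ?W y k j\<bar> powr p))"
        using energy[OF x(1) y(1)] x y by blast
      have e: "\<rho> (coord_dist x y k) powr p \<le> ?e k" if "k \<in> K" for k
      proof -
        have k: "fst k \<in> V" using that K(2) hyperplanes_V by blast
        have "\<rho> (coord_dist x y k) \<le> Lp_dist p (M (fst k)) (f (fst k) (coord k [] x)) (f (fst k) (coord k [] y))"
          using k x y by (intro low coord_closed) auto
        then show ?thesis using p0 \<rho>0 by (intro powr_mono2) auto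
      qed
      have m': "coord_length x k \<le> m \<and> coord_length y k \<le> m" if "k \<in> K" for k using m that by blast
      from energy_dichotomy[where e = ?e, OF x(1) y(1) fin(1) K n m' e \<rho>0(1) W p]
      obtain a where "word_dist P gens c c' \<le> 3 * card V * a"
        "min (\<rho> a powr p) (\<Sum>d=1..a. ?W d powr p) \<le> Lp_dist p N (\<phi> c) (\<phi> c') powr p"
        unfolding E by blast
      then show ?thesis unfolding dist by (intro control Lp_dist_nonneg)
    qed
    have "coarse_embedding_Lp p N P gens ?\<phi>"
    proof (rule coarse_embedding_LpI[where R = R and C = "C * (1 + B) powr (1 / p)"])
      show "?\<phi> c \<in> Lp_space p N" if "c \<in> carrier P" for c
        using N[OF that] by (rule Lp_space_cmult)
      show "Lp_dist p N (?\<phi> c) (?\<phi> c') \<le> C * (1 + B) powr (1 / p) * real (word_dist P gens c c')"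
        if "c \<in> carrier P" "c' \<in> carrier P" for c c'
        unfolding dist mult.assoc using upper[OF that] C by (intro mult_left_mono) auto
      show "0 < C * (1 + B) powr (1 / p)" using C B0 by simp
    qed (use R Rlim lower in auto)
    moreover have "min (\<rho> n) (h n) \<le> R n" for n by (auto simp: R_def)
    ultimately show ?thesis using lower order_trans by blast
  qed
qed

end

section \<open>The embedding theorem\<close>

theorem theorem5p7:
  fixes p :: real
    and V :: "'v set" and E :: "'v set set"
    and G :: "'v \<Rightarrow> ('a, 'b) monoid_scheme" and X :: "'v \<Rightarrow> 'a set"
    and M :: "'v \<Rightarrow> 'w measure" and f :: "'v \<Rightarrow> 'a \<Rightarrow> 'w \<Rightarrow> real"
    and \<rho>' :: "nat \<Rightarrow> real"
  assumes "1 \<le> p"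
    and "finite V" and "simplicial_graph V E"
    and "\<And>v. v \<in> V \<Longrightarrow> group (G v)"
    and "\<And>v. v \<in> V \<Longrightarrow> finite (X v)"
    and "\<And>v. v \<in> V \<Longrightarrow> generates (G v) (X v)"
    and "\<And>v. v \<in> V \<Longrightarrow> coarse_embedding_Lp p (M v) (G v) (X v) (f v)"
    and "concave_map \<rho>'" and "filterlim \<rho>' at_top sequentially"
    and "\<And>v x y. v \<in> V \<Longrightarrow> x \<in> carrier (G v) \<Longrightarrow> y \<in> carrier (G v) \<Longrightarrow>
           real (word_dist (G v) (X v) x y) \<ge> Lp_dist p (M v) (f v x) (f v y) \<and>
           Lp_dist p (M v) (f v x) (f v y) \<ge> \<rho>' (word_dist (G v) (X v) x y)"
  defines "P \<equiv> graph_product V E G"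
    and "Y \<equiv> (\<Union>v\<in>V. gp_incl V E G v ` X v)"
  shows "(p = 1 \<longrightarrow>
           (\<exists>(N :: (nat \<times> 'w) measure) \<phi>. coarse_embedding_Lp p N P Y \<phi> \<and>
             (\<forall>x\<in>carrier P. \<forall>y\<in>carrier P.
               Lp_dist p N (\<phi> x) (\<phi> y) \<ge> \<rho>' (word_dist P Y x y)))) \<and>
         (p > 1 \<longrightarrow>
           (\<forall>h :: nat \<Rightarrow> real. concave_tessera_C p h \<longrightarrow>
             (\<exists>(N :: (nat \<times> 'w) measure) \<phi>. coarse_embedding_Lp p N P Y \<phi> \<and>
               (\<forall>x\<in>carrier P. \<forall>y\<in>carrier P.
                 Lp_dist p N (\<phi> x) (\<phi> y) \<ge>
                   min (\<rho>' (word_dist P Y x y)) (h (word_dist P Y x y))))))"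
proof -
  interpret graph_product_data V E G X
    using assms(3,4,6) by (intro graph_product_data.intro)
  have p: "1 \<le> p" by (rule assms(1))
  have f: "f v a \<in> Lp_space p (M v)" if "v \<in> V" "a \<in> carrier (G v)" for v a
    using assms(7)[OF that(1)] that(2) by (auto simp: coarse_embedding_Lp_def)
  have lip: "Lp_dist p (M v) (f v a) (f v b) \<le> real (word_dist (G v) (X v) a b)"
    and low: "\<rho>' (word_dist (G v) (X v) a b) \<le> Lp_dist p (M v) (f v a) (f v b)"
    if "v \<in> V" "a \<in> carrier (G v)" "b \<in> carrier (G v)" for v a b
    using assms(10)[OF that] by auto
  let ?H = "graph_product V E G" and ?Z = "\<Union>v\<in>V. gp_incl V E G v ` X v"
  show ?thesis
    unfolding P_def Y_def
  proof (intro conjI impI allI)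
    assume p1: "p = 1"
    show "\<exists>(N :: (nat \<times> 'w) measure) \<phi>. coarse_embedding_Lp p N ?H ?Z \<phi> \<and>
        (\<forall>x\<in>carrier ?H. \<forall>y\<in>carrier ?H. \<rho>' (word_dist ?H ?Z x y) \<le> Lp_dist p N (\<phi> x) (\<phi> y))"
      unfolding p1
      by (rule graph_product_embedding_L1[OF assms(2,5) f[unfolded p1] lip[unfolded p1]
            low[unfolded p1] assms(8,9)])
  next
    fix h assume "concave_tessera_C p h"
    then have h: "concave_map h" "tessera_C p h" by (simp_all add: concave_tessera_C_def)
    show "\<exists>(N :: (nat \<times> 'w) measure) \<phi>. coarse_embedding_Lp p N ?H ?Z \<phi> \<and>
        (\<forall>x\<in>carrier ?H. \<forall>y\<in>carrier ?H. min (\<rho>' (word_dist ?H ?Z x y)) (h (word_dist ?H ?Z x y))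
          \<le> Lp_dist p N (\<phi> x) (\<phi> y))"
      by (rule graph_product_embedding_Lp[OF p assms(2,5) f lip low assms(8,9) h])
  qed
qed

end
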